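(* Let $d \ge 1$ and assume that $\alpha,\beta \in [-1/2,\infty)^d$. Then (i) $T_*^{\alpha,\beta}$ is bounded from $L^1(d\varrho_{\alpha,\beta})$ to weak $L^1(d\varrho_{\alpha,\beta})$; (ii) $\mathcal{T}_*^{\alpha,\beta}$ is bounded from $L^1(d\mu_{\alpha,\beta})$ to weak $L^1(d\mu_{\alpha,\beta})$; (iii) $\mathbb{T}_*^{\alpha,\beta}$ is bounded from $L^1(d\theta)$ to weak $L^1(d\theta)$.
   Context: One-dimensional objects. For real $a,b>-1$ and $n=0,1,2,\ldots$, $P_n^{a,b}$ is the classical Jacobi polynomial, $P_n^{a,b}(x) = \frac{(-1)^n}{2^n n!} (1-x)^{-a}(1+x)^{-b} \frac{d^n}{dx^n}[ (1-x)^{a+n}(1+x)^{b+n}]$, and $h_n^{a,b} = \int_{-1}^1 [P_n^{a,b}(x)]^2 (1-x)^{a}(1+x)^{b}\,dx$. Set $$\mathcal{P}_n^{a,b}(\theta) = 2^{(a+b+1)/2} (h_n^{a,b})^{-1/2} P_n^{a,b}(\cos\theta),\qquad \phi_n^{a,b}(\theta) = \Big( \sin\frac{\theta}2 \Big)^{a+1/2} \Big( \cos\frac{\theta}2\Big)^{b+1/2}\mathcal{P}_n^{a,b}(\theta).$$ The one-dimensional measures are $d\varrho_{a,b}(x)=(1-x)^a(1+x)^b\,dx$ on $[-1,1]$, $d\mu_{a,b}(\theta) = (\sin\frac{\theta}2)^{2a+1}(\cos\frac{\theta}2)^{2b+1}\,d\theta$ on $[0,\pi]$, and Lebesgue measure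 $d\theta$ on $[0,\pi]$. The one-dimensional heat kernels are, for $t>0$, $$G_t^{a,b}(x,y) = \sum_{n=0}^{\infty} e^{-t n(n+a+b+1)} \frac{P_n^{a,b}(x) P_n^{a,b}(y)}{h_n^{a,b}},$$ $$\mathcal{G}_t^{a,b}(\theta,\varphi) = \sum_{n=0}^{\infty} e^{-t(n+\frac{a+b+1}{2})^2}\mathcal{P}_n^{a,b}(\theta)\mathcal{P}_n^{a,b}(\varphi),\qquad \mathbb{G}_t^{a,b}(\theta,\varphi) = \sum_{n=0}^{\infty} e^{-t(n+\frac{a+b+1}{2})^2}\phi_n^{a,b}(\theta)\phi_n^{a,b}(\varphi).$$ Multi-dimensional objects. For $\alpha=(\alpha_1,\dots,\alpha_d)$, $\beta=(\beta_1,\dots,\beta_d)\in(-1,\infty)^d$, the measures are the products $\varrho_{\alpha,\beta}=\bigotimes_{i=1}^d\varrho_{\alpha_i,\beta_i}$ on $[-1,1]^d$, $\mu_{\alpha,\beta}=\bigotimes_{i=1}^d\mu_{\alpha_i,\beta_i}$ on $[0,\pi]^d$, and $d\theta$ is $d$-dimensional Lebesgue measure on $[0,\pi]^d$. The kernels are the tensor products $G_t^{\alpha,\beta}(x,y)=\prod_{i=1}^d G_t^{\alpha_i,\beta_i}(x_i,y_i)$, and likewise $\mathcal{G}_t^{\alpha,\beta}$ and $\mathbb{G}_t^{\alpha,\beta}$. The semigroups are $$T_t^{\alpha,\beta}f(x)=\int_{[-1,1]^d} G_t^{\alpha,\beta}(x,y)f(y)\,d\varrho_{\alpha,\beta}(y),$$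 $$\mathcal{T}_t^{\alpha,\beta}f(\theta)=\int_{[0,\pi]^d} \mathcal{G}_t^{\alpha,\beta}(\theta,\varphi)f(\varphi)\,d\mu_{\alpha,\beta}(\varphi),\qquad \mathbb{T}_t^{\alpha,\beta}f(\theta)=\int_{[0,\pi]^d} \mathbb{G}_t^{\alpha,\beta}(\theta,\varphi)f(\varphi)\,d\varphi.$$ The maximal operators are $T_*^{\alpha,\beta}f(x)=\sup_{t>0}|T_t^{\alpha,\beta}f(x)|$, $\mathcal{T}_*^{\alpha,\beta}f(\theta)=\sup_{t>0}|\mathcal{T}_t^{\alpha,\beta}f(\theta)|$, $\mathbb{T}_*^{\alpha,\beta}f(\theta)=\sup_{t>0}|\mathbb{T}_t^{\alpha,\beta}f(\theta)|$. An operator $S$ is bounded from $L^1(m)$ to weak $L^1(m)$ (weak type $(1,1)$) if there is a constant $C$ with $m(\{|Sf|>s\})\le \frac{C}{s}\|f\|_{L^1(m)}$ for all $s>0$ and $f\in L^1(m)$. *)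

theory Defs
  imports "HOL-Analysis.Analysis"
begin

definition jacobi_rodrigues :: "real \<Rightarrow> real \<Rightarrow> nat \<Rightarrow> real \<Rightarrow> real" where
  "jacobi_rodrigues a b n x =
     (-1) ^ n / (2 ^ n * fact n) * (1 - x) powr (- a) * (1 + x) powr (- b) *
     (deriv ^^ n) (\<lambda>u. (1 - u) powr (a + real n) * (1 + u) powr (b + real n)) x"

text \<open>The Rodrigues formula only makes sense on the open interval \<open>(-1, 1)\<close>; the values
  of the Jacobi polynomial at the endpoints are those of the unique polynomial that agrees
  with it there (existence and uniqueness: \<open>jacobi_poly_ex1\<close> below).\<close>

definition jacobi_poly :: "real \<Rightarrow> real \<Rightarrow> nat \<Rightarrow> real poly" where
  "jacobi_poly a b n = (THE p. \<forall>x\<in>{-1<..<1}. poly p x = jacobi_rodrigues a b n x)"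

lemma jacobi_higher_deriv:
  fixes A B :: real
  shows "\<exists>q :: real poly. \<forall>x\<in>{-1<..<1}.
    (deriv ^^ k) (\<lambda>u. (1 - u) powr A * (1 + u) powr B) x =
    (1 - x) powr (A - real k) * (1 + x) powr (B - real k) * poly q x"
proof (induction k)
  case 0
  show ?case by (intro exI[of _ 1]) simp
next
  case (Suc k)
  let ?f = "(deriv ^^ k) (\<lambda>u. (1 - u) powr A * (1 + u) powr B)"
  from Suc obtain q :: "real poly" where q: "\<And>x. x \<in> {-1<..<1} \<Longrightarrow>
    ?f x = (1 - x) powr (A - real k) * (1 + x) powr (B - real k) * poly q x" by blast
  define r where "r = [:-(A - real k), -(A - real k):] * q + [:B - real k, -(B - real k):] * q
      + [:1, 0, -1:] * pderiv q"
  show ?case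
  proof (intro exI[of _ r] ballI)
    fix x :: real assume x: "x \<in> {-1<..<1}"
    let ?g = "\<lambda>u. (1 - u) powr (A - real k) * (1 + u) powr (B - real k) * poly q u"
    have ev: "eventually (\<lambda>u. ?f u = ?g u) (nhds x)"
      using x q by (intro eventually_nhds_in_open[THEN eventually_mono, of "{-1<..<1}"]) auto
    have p1: "(1 - x) powr (A - real k) = (1 - x) * (1 - x) powr (A - real (Suc k))"
      using x powr_mult_base[of "1 - x" "A - real (Suc k)"] by simp
    have p2: "(1 + x) powr (B - real k) = (1 + x) * (1 + x) powr (B - real (Suc k))"
      using x powr_mult_base[of "1 + x" "B - real (Suc k)"] by simp
    have d1: "((\<lambda>u. (1 - u) powr (A - real k)) has_real_derivative
        - (A - real k) * (1 - x) powr (A - real (Suc k))) (at x)"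
      using x by (auto intro!: derivative_eq_intros simp: algebra_simps)
    have d2: "((\<lambda>u. (1 + u) powr (B - real k)) has_real_derivative
        (B - real k) * (1 + x) powr (B - real (Suc k))) (at x)"
      using x by (auto intro!: derivative_eq_intros simp: algebra_simps)
    have "(?g has_real_derivative
        (1 - x) powr (A - real (Suc k)) * (1 + x) powr (B - real (Suc k)) * poly r x) (at x)"
      by (rule DERIV_cong[OF DERIV_mult[OF DERIV_mult[OF d1 d2] poly_DERIV]],
          simp only: p1 p2, simp add: r_def algebra_simps)
    then have "deriv ?g x =
        (1 - x) powr (A - real (Suc k)) * (1 + x) powr (B - real (Suc k)) * poly r x"
      by (rule DERIV_imp_deriv)
    then show "(deriv ^^ Suc k) (\<lambda>u. (1 - u) powr A * (1 + u) powr B) x =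
        (1 - x) powr (A - real (Suc k)) * (1 + x) powr (B - real (Suc k)) * poly r x"
      using deriv_cong_ev[OF ev refl] by simp
  qed
qed

lemma jacobi_poly_ex1:
  "\<exists>!p :: real poly. \<forall>x\<in>{-1<..<1}. poly p x = jacobi_rodrigues a b n x"
proof (rule ex_ex1I)
  obtain q :: "real poly" where q: "\<And>x. x \<in> {-1<..<1} \<Longrightarrow>
    (deriv ^^ n) (\<lambda>u. (1 - u) powr (a + real n) * (1 + u) powr (b + real n)) x =
    (1 - x) powr a * (1 + x) powr b * poly q x"
    using jacobi_higher_deriv[of n "a + real n" "b + real n"] by auto
  show "\<exists>p :: real poly. \<forall>x\<in>{-1<..<1}. poly p x = jacobi_rodrigues a b n x"
  proof (intro exI[of _ "smult ((-1) ^ n / (2 ^ n * fact n)) q"] ballI)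
    fix x :: real assume x: "x \<in> {-1<..<1}"
    then have "(1 - x) powr (- a) * (1 - x) powr a = 1" "(1 + x) powr (- b) * (1 + x) powr b = 1"
      by (simp_all flip: powr_add)
    then have "((1 - x) powr (- a) * (1 - x) powr a) * ((1 + x) powr (- b) * (1 + x) powr b) = 1"
      by simp
    then show "poly (smult ((-1) ^ n / (2 ^ n * fact n)) q) x = jacobi_rodrigues a b n x"
      unfolding jacobi_rodrigues_def q[OF x] by (simp add: mult_ac)
  qed
next
  fix p q :: "real poly"
  assume "\<forall>x\<in>{-1<..<1}. poly p x = jacobi_rodrigues a b n x"
    and "\<forall>x\<in>{-1<..<1}. poly q x = jacobi_rodrigues a b n x"
  then have "{-1<..<1} \<subseteq> {x. poly (p - q) x = 0}" by auto
  then have "infinite {x. poly (p - q) x = 0}"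
    using infinite_Ioo[of "-1::real" 1] by (meson finite_subset neg_less_0_iff_less less_trans zero_less_one)
  then show "p = q" using poly_roots_finite[of "p - q"] by auto
qed

lemma poly_jacobi_poly:
  "x \<in> {-1<..<1} \<Longrightarrow> poly (jacobi_poly a b n) x = jacobi_rodrigues a b n x"
  using theI'[OF jacobi_poly_ex1[of a b n]] unfolding jacobi_poly_def by blast

definition jacobi_h :: "real \<Rightarrow> real \<Rightarrow> nat \<Rightarrow> real" where
  "jacobi_h a b n =
     (LBINT x:{-1..1}. (poly (jacobi_poly a b n) x)\<^sup>2 * (1 - x) powr a * (1 + x) powr b)"

definition jacobi_trig :: "real \<Rightarrow> real \<Rightarrow> nat \<Rightarrow> real \<Rightarrow> real" where
  "jacobi_trig a b n \<theta> =
     2 powr ((a + b + 1) / 2) * jacobi_h a b n powr (- 1 / 2) * poly (jacobi_poly a b n) (cos \<theta>)"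

definition jacobi_phi :: "real \<Rightarrow> real \<Rightarrow> nat \<Rightarrow> real \<Rightarrow> real" where
  "jacobi_phi a b n \<theta> =
     sin (\<theta> / 2) powr (a + 1 / 2) * cos (\<theta> / 2) powr (b + 1 / 2) * jacobi_trig a b n \<theta>"

text \<open>Points of \<open>\<real>\<^sup>d\<close> are (extensional) functions on \<open>{..<d}\<close>. Since \<open>0 powr c = 0\<close> in HOL for
  every \<open>c\<close>, the densities below and \<open>jacobi_phi\<close> may differ from the usual conventions at the
  interval endpoints, which are null sets.\<close>

definition rho1 :: "real \<Rightarrow> real \<Rightarrow> real measure" where
  "rho1 a b = density (restrict_space lborel {-1..1})
     (\<lambda>x. ennreal ((1 - x) powr a * (1 + x) powr b))"

definition mu1 :: "real \<Rightarrow> real \<Rightarrow> real measure" where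
  "mu1 a b = density (restrict_space lborel {0..pi})
     (\<lambda>\<theta>. ennreal (sin (\<theta> / 2) powr (2 * a + 1) * cos (\<theta> / 2) powr (2 * b + 1)))"

definition rho :: "nat \<Rightarrow> (nat \<Rightarrow> real) \<Rightarrow> (nat \<Rightarrow> real) \<Rightarrow> (nat \<Rightarrow> real) measure" where
  "rho d \<alpha> \<beta> = (\<Pi>\<^sub>M i\<in>{..<d}. rho1 (\<alpha> i) (\<beta> i))"

definition mu :: "nat \<Rightarrow> (nat \<Rightarrow> real) \<Rightarrow> (nat \<Rightarrow> real) \<Rightarrow> (nat \<Rightarrow> real) measure" where
  "mu d \<alpha> \<beta> = (\<Pi>\<^sub>M i\<in>{..<d}. mu1 (\<alpha> i) (\<beta> i))"

definition lebesgue_cube :: "nat \<Rightarrow> (nat \<Rightarrow> real) measure" where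
  "lebesgue_cube d = (\<Pi>\<^sub>M i\<in>{..<d}. restrict_space lborel {0..pi})"

definition G1 :: "real \<Rightarrow> real \<Rightarrow> real \<Rightarrow> real \<Rightarrow> real \<Rightarrow> real" where
  "G1 a b t x y =
     (\<Sum>n. exp (- t * (real n * (real n + a + b + 1))) *
       (poly (jacobi_poly a b n) x * poly (jacobi_poly a b n) y / jacobi_h a b n))"

definition G1_trig :: "real \<Rightarrow> real \<Rightarrow> real \<Rightarrow> real \<Rightarrow> real \<Rightarrow> real" where
  "G1_trig a b t \<theta> \<phi> =
     (\<Sum>n. exp (- t * (real n + (a + b + 1) / 2)\<^sup>2) * jacobi_trig a b n \<theta> * jacobi_trig a b n \<phi>)"

definition G1_phi :: "real \<Rightarrow> real \<Rightarrow> real \<Rightarrow> real \<Rightarrow> real \<Rightarrow> real" where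
  "G1_phi a b t \<theta> \<phi> =
     (\<Sum>n. exp (- t * (real n + (a + b + 1) / 2)\<^sup>2) * jacobi_phi a b n \<theta> * jacobi_phi a b n \<phi>)"

definition G :: "nat \<Rightarrow> (nat \<Rightarrow> real) \<Rightarrow> (nat \<Rightarrow> real) \<Rightarrow> real \<Rightarrow>
    (nat \<Rightarrow> real) \<Rightarrow> (nat \<Rightarrow> real) \<Rightarrow> real" where
  "G d \<alpha> \<beta> t x y = (\<Prod>i<d. G1 (\<alpha> i) (\<beta> i) t (x i) (y i))"

definition G_trig :: "nat \<Rightarrow> (nat \<Rightarrow> real) \<Rightarrow> (nat \<Rightarrow> real) \<Rightarrow> real \<Rightarrow>
    (nat \<Rightarrow> real) \<Rightarrow> (nat \<Rightarrow> real) \<Rightarrow> real" where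
  "G_trig d \<alpha> \<beta> t \<theta> \<phi> = (\<Prod>i<d. G1_trig (\<alpha> i) (\<beta> i) t (\<theta> i) (\<phi> i))"

definition G_phi :: "nat \<Rightarrow> (nat \<Rightarrow> real) \<Rightarrow> (nat \<Rightarrow> real) \<Rightarrow> real \<Rightarrow>
    (nat \<Rightarrow> real) \<Rightarrow> (nat \<Rightarrow> real) \<Rightarrow> real" where
  "G_phi d \<alpha> \<beta> t \<theta> \<phi> = (\<Prod>i<d. G1_phi (\<alpha> i) (\<beta> i) t (\<theta> i) (\<phi> i))"

definition T :: "nat \<Rightarrow> (nat \<Rightarrow> real) \<Rightarrow> (nat \<Rightarrow> real) \<Rightarrow> real \<Rightarrow>
    ((nat \<Rightarrow> real) \<Rightarrow> complex) \<Rightarrow> (nat \<Rightarrow> real) \<Rightarrow> complex" where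
  "T d \<alpha> \<beta> t f x = (LINT y|rho d \<alpha> \<beta>. complex_of_real (G d \<alpha> \<beta> t x y) * f y)"

definition T_trig :: "nat \<Rightarrow> (nat \<Rightarrow> real) \<Rightarrow> (nat \<Rightarrow> real) \<Rightarrow> real \<Rightarrow>
    ((nat \<Rightarrow> real) \<Rightarrow> complex) \<Rightarrow> (nat \<Rightarrow> real) \<Rightarrow> complex" where
  "T_trig d \<alpha> \<beta> t f \<theta> = (LINT \<phi>|mu d \<alpha> \<beta>. complex_of_real (G_trig d \<alpha> \<beta> t \<theta> \<phi>) * f \<phi>)"

definition T_phi :: "nat \<Rightarrow> (nat \<Rightarrow> real) \<Rightarrow> (nat \<Rightarrow> real) \<Rightarrow> real \<Rightarrow>
    ((nat \<Rightarrow> real) \<Rightarrow> complex) \<Rightarrow> (nat \<Rightarrow> real) \<Rightarrow> complex" where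
  "T_phi d \<alpha> \<beta> t f \<theta> = (LINT \<phi>|lebesgue_cube d. complex_of_real (G_phi d \<alpha> \<beta> t \<theta> \<phi>) * f \<phi>)"

definition maximal :: "(real \<Rightarrow> ('x \<Rightarrow> complex) \<Rightarrow> 'x \<Rightarrow> complex) \<Rightarrow>
    ('x \<Rightarrow> complex) \<Rightarrow> 'x \<Rightarrow> ennreal" where
  "maximal S f x = (SUP t\<in>{0<..}. ennreal (cmod (S t f x)))"

text \<open>Measurability of the level sets is part of the definition because \<open>emeasure\<close> is \<open>0\<close> on
  non-measurable sets.\<close>

definition weak_type_1_1 :: "'x measure \<Rightarrow> (('x \<Rightarrow> complex) \<Rightarrow> 'x \<Rightarrow> ennreal) \<Rightarrow> bool" where
  "weak_type_1_1 M S \<longleftrightarrow>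
     (\<exists>C::real. C \<ge> 0 \<and> (\<forall>f s. integrable M f \<longrightarrow> s > 0 \<longrightarrow>
        {x \<in> space M. S f x > ennreal s} \<in> sets M \<and>
        emeasure M {x \<in> space M. S f x > ennreal s} \<le> ennreal (C / s * (LINT x|M. cmod (f x)))))"

end

theory Submission
  imports Defs
begin

text \<open>
  The kernels of (i) and (ii) are handled without estimating them. If a symmetric Markovian kernel
  family \<open>K\<close> on a finite measure space is such that \<open>t powr \<kappa> * K t x y\<close> is nondecreasing in \<open>t\<close>, then
  \<open>K t\<close> is at most a constant times \<open>K s\<close> for every \<open>s \<in> {t..4 * t}\<close>, so that the maximal function is
  dominated by the ergodic averages of the powers of \<open>K h\<close>, uniformly in the step \<open>h\<close>, and Hopf's maximal
  ergodic theorem gives the weak type (1,1) estimate. The hypothesis is stable under tensor products, and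
  in one dimension it is the Li--Yau inequality: for \<open>a, b \<ge> -1/2\<close> the Jacobi operator satisfies the
  curvature-dimension condition \<open>CD(0, N)\<close> with \<open>N = 2a + 2b + 4\<close>.

  The semigroup of (iii) is not a contraction on \<open>L\<^sup>\<infinity>\<close>. There the kernel is shown to be at most \<open>C\<close>
      times the
  Neumann heat kernel of \<open>[0, \<pi>]\<close> at time \<open>5 t\<close>: the Harnack inequality that follows from Li--Yau, combined
  with the decay of \<open>\<integral> u\<^sup>2 exp (2 l \<theta>)\<close> along the flow, gives a Gaussian upper bound, and the
  Harnack inequality for the Neumann kernel gives a matching Gaussian lower bound.
\<close>

section \<open>Maximal functions of semigroups with almost monotone kernels\<close>

text \<open>The obstacle is the common time: the supremum over t does not split over the
  coordinates, and composing one-dimensional weak type (1,1) estimates does not give weak type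
  (1,1). So each coordinate contributes only a property that products inherit, and the maximal
  inequality is proved once, on the product space.

  CD(0, N) rests on a, b >= -1/2: the first-order part of Gamma_2 then has the nonnegative
  coefficient (a + 1/2) (1 + x) + (b + 1/2) (1 - x). Li--Yau makes
  \<open>t powr (N / 2) * K t x y\<close> nondecreasing, so \<kappa> is N / 2 in one dimension, and
  the exponents add up in a product.

  For (iii) the upper bound decays like exp (- (\<theta> - \<phi>)^2 / (10 t)), while Harnack bounds
  the Neumann kernel at time s below by a multiple of exp (- (\<theta> - \<phi>)^2 / (2 s)); the
  exponents agree for s = 5 t. The square roots of the weights stay attached to the kernel, so for
  small t the prefactor is 1 / sqrt t whatever a and b are.

  Positivity, Li--Yau and the energy decay are proved for finite sums, the flows of polynomials, and
  reach the kernel by approximation.\<close>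

locale heat_family = finite_measure M for M :: "'x measure" +
  fixes K :: "real \<Rightarrow> 'x \<Rightarrow> 'x \<Rightarrow> real" and \<kappa> :: real
  assumes kernel_measurable: "t > 0 \<Longrightarrow> (\<lambda>z. K t (fst z) (snd z)) \<in> borel_measurable (M \<Otimes>\<^sub>M M)"
    and kernel_nonneg: "t > 0 \<Longrightarrow> x \<in> space M \<Longrightarrow> y \<in> space M \<Longrightarrow> 0 \<le> K t x y"
    and kernel_bounded: "t > 0 \<Longrightarrow> \<exists>B. \<forall>x\<in>space M. \<forall>y\<in>space M. K t x y \<le> B"
    and kernel_sym: "t > 0 \<Longrightarrow> x \<in> space M \<Longrightarrow> y \<in> space M \<Longrightarrow> K t x y = K t y x"
    and kernel_mass: "t > 0 \<Longrightarrow> x \<in> space M \<Longrightarrow> (\<integral>y. K t x y \<partial>M) \<le> 1"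
    and kernel_semigroup: "t > 0 \<Longrightarrow> s > 0 \<Longrightarrow> x \<in> space M \<Longrightarrow> y \<in> space M \<Longrightarrow>
      (\<integral>z. K t x z * K s z y \<partial>M) = K (t + s) x y"
    and kernel_mono: "0 < t \<Longrightarrow> t \<le> s \<Longrightarrow> x \<in> space M \<Longrightarrow> y \<in> space M \<Longrightarrow>
      t powr \<kappa> * K t x y \<le> s powr \<kappa> * K s x y"
    and exponent_nonneg: "\<kappa> \<ge> 0"
begin

section \<open>Positivity, contraction and composition of the integral operators\<close>

definition op :: "real \<Rightarrow> ('x \<Rightarrow> real) \<Rightarrow> 'x \<Rightarrow> real" where
  "op t f x = (\<integral>y. K t x y * f y \<partial>M)"

lemma kernel_measurable_snd [measurable]:
  assumes "t > 0" "x \<in> space M" shows "K t x \<in> borel_measurable M"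
  using measurable_compose[OF measurable_Pair1'[OF assms(2)] kernel_measurable[OF assms(1)]] by simp

lemma integrable_kernel_mult:
  fixes f :: "'x \<Rightarrow> real"
  assumes "t > 0" "x \<in> space M" "integrable M f"
  shows "integrable M (\<lambda>y. K t x y * f y)"
proof -
  obtain B where B: "\<forall>x\<in>space M. \<forall>y\<in>space M. K t x y \<le> B" using kernel_bounded[OF assms(1)] by blast
  have [measurable]: "f \<in> borel_measurable M" using assms(3) by auto
  show ?thesis
  proof (rule Bochner_Integration.integrable_bound[OF integrable_mult_right[OF integrable_norm[OF
      assms(3)], of B]])
    show "(\<lambda>y. K t x y * f y) \<in> borel_measurable M"
      using kernel_measurable_snd[OF assms(1,2)] by measurable
    show "AE y in M. norm (K t x y * f y) \<le> norm (B * norm (f y))"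
    proof (rule AE_I2)
      fix y assume y: "y \<in> space M"
      have "0 \<le> K t x y" "K t x y \<le> B" using kernel_nonneg B assms y by auto
      then show "norm (K t x y * f y) \<le> norm (B * norm (f y))"
        by (auto simp: abs_mult intro!: mult_right_mono)
    qed
  qed
qed

lemma integrable_op:
  assumes "t > 0" "integrable M f" shows "integrable M (op t f)"
proof -
  obtain B where B: "\<forall>x\<in>space M. \<forall>y\<in>space M. K t x y \<le> B" using kernel_bounded[OF assms(1)] by blast
  have [measurable]: "f \<in> borel_measurable M" using assms(2) by auto
  have [measurable]: "(\<lambda>z. K t (fst z) (snd z)) \<in> borel_measurable (M \<Otimes>\<^sub>M M)"
    by (rule kernel_measurable[OF assms(1)])
  show ?thesis
  proof (rule integrable_const_bound)
    have "(\<lambda>z. K t (fst z) (snd z) * f (snd z)) \<in> borel_measurable (M \<Otimes>\<^sub>M M)" by measurable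
    then have "(\<lambda>x. \<integral>y. K t x y * f y \<partial>M) \<in> borel_measurable M"
      by (intro borel_measurable_lebesgue_integral) (simp add: case_prod_beta)
    then show "op t f \<in> borel_measurable M" unfolding op_def[abs_def] .
    show "AE x in M. norm (op t f x) \<le> (\<integral>y. B * \<bar>f y\<bar> \<partial>M)"
    proof (rule AE_I2)
      fix x assume x: "x \<in> space M"
      have "norm (op t f x) \<le> (\<integral>y. norm (K t x y * f y) \<partial>M)"
        unfolding op_def by (rule integral_norm_bound)
      also have "\<dots> \<le> (\<integral>y. B * \<bar>f y\<bar> \<partial>M)"
      proof (rule integral_mono)
        show "integrable M (\<lambda>y. norm (K t x y * f y))"
          by (rule integrable_norm[OF integrable_kernel_mult[OF assms(1) x assms(2)]])
        show "integrable M (\<lambda>y. B * \<bar>f y\<bar>)" using assms(2) by auto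
        show "norm (K t x y * f y) \<le> B * \<bar>f y\<bar>" if "y \<in> space M" for y
          using kernel_nonneg[OF assms(1) x that] B x that by (auto simp: abs_mult intro!: mult_right_mono)
      qed
      finally show "norm (op t f x) \<le> (\<integral>y. B * \<bar>f y\<bar> \<partial>M)" .
    qed
  qed
qed

lemma op_mono:
  assumes "t > 0" "integrable M f" "integrable M g" "\<And>y. y \<in> space M \<Longrightarrow> f y \<le> g y" "x \<in> space M"
  shows "op t f x \<le> op t g x"
  unfolding op_def
  by (intro integral_mono integrable_kernel_mult assms mult_left_mono kernel_nonneg)

lemma op_add:
  assumes "t > 0" "integrable M f" "integrable M g" "x \<in> space M"
  shows "op t (\<lambda>y. f y + g y) x = op t f x + op t g x"
  unfolding op_def by (simp add: distrib_left integrable_kernel_mult assms)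

lemma op_diff_const:
  assumes "t > 0" "integrable M f" "x \<in> space M" "c \<ge> 0"
  shows "op t (\<lambda>y. f y - c) x \<ge> op t f x - c"
proof -
  have "op t (\<lambda>y. f y - c) x = op t f x - (\<integral>y. K t x y * c \<partial>M)"
    unfolding op_def right_diff_distrib
    by (intro Bochner_Integration.integral_diff integrable_kernel_mult assms integrable_const)
  moreover have "(\<integral>y. K t x y * c \<partial>M) \<le> 1 * c"
    using mult_right_mono[OF kernel_mass[OF assms(1,3)] assms(4)] by simp
  ultimately show ?thesis by simp
qed

lemma op_nonneg:
  assumes "t > 0" "\<And>y. y \<in> space M \<Longrightarrow> 0 \<le> f y" "x \<in> space M"
  shows "0 \<le> op t f x"
  unfolding op_def by (intro integral_nonneg_AE AE_I2 mult_nonneg_nonneg kernel_nonneg assms)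

lemma integrable_pair_kernel:
  assumes "t > 0" "x \<in> space M" "s > 0" "integrable M f"
  shows "integrable (M \<Otimes>\<^sub>M M) (\<lambda>(z, y). K t x z * K s z y * f y)"
proof -
  interpret pair_sigma_finite M M ..
  obtain B1 where B1: "\<forall>x\<in>space M. \<forall>y\<in>space M. K t x y \<le> B1" using kernel_bounded[OF assms(1)] by blast
  obtain B2 where B2: "\<forall>x\<in>space M. \<forall>y\<in>space M. K s x y \<le> B2" using kernel_bounded[OF assms(3)] by blast
  have [measurable]: "f \<in> borel_measurable M" using assms by auto
  have [measurable]: "(\<lambda>z. K s (fst z) (snd z)) \<in> borel_measurable (M \<Otimes>\<^sub>M M)"
    by (rule kernel_measurable[OF assms(3)])
  have [measurable]: "K t x \<in> borel_measurable M" by (rule kernel_measurable_snd[OF assms(1,2)])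
  have m: "(\<lambda>(z, y). K t x z * K s z y * f y) \<in> borel_measurable (M \<Otimes>\<^sub>M M)"
    unfolding case_prod_beta by measurable
  have i: "integrable (M \<Otimes>\<^sub>M M) (\<lambda>z. B1 * B2 * f (snd z))"
    by (rule Fubini_integrable) (auto intro!: integrable_mult_right integrable_abs assms)
  show ?thesis
  proof (rule Bochner_Integration.integrable_bound[OF i m], rule AE_I2)
    fix z assume "z \<in> space (M \<Otimes>\<^sub>M M)"
    then have z: "fst z \<in> space M" "snd z \<in> space M" by (auto simp: space_pair_measure)
    have "0 \<le> K t x (fst z)" "0 \<le> K s (fst z) (snd z)" "K t x (fst z) \<le> B1" "K s (fst z) (snd z) \<le> B2"
      using z kernel_nonneg B1 B2 assms by auto
    then have "\<bar>K t x (fst z)\<bar> * \<bar>K s (fst z) (snd z)\<bar> \<le> B1 * B2"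
      by (intro mult_mono) auto
    then show "norm (case z of (z, y) \<Rightarrow> K t x z * K s z y * f y) \<le> norm (B1 * B2 * f (snd z))"
      by (auto simp: case_prod_beta abs_mult intro!: mult_right_mono order_trans[OF _ abs_ge_self[of "B1
          * B2", unfolded abs_mult]])
  qed
qed

lemma op_op:
  assumes "t > 0" "s > 0" "integrable M f" "x \<in> space M"
  shows "op t (op s f) x = op (t + s) f x"
proof -
  interpret pair_sigma_finite M M ..
  have "op t (op s f) x = (\<integral>z. (\<integral>y. K t x z * K s z y * f y \<partial>M) \<partial>M)"
    unfolding op_def by (simp add: mult.assoc)
  also have "\<dots> = (\<integral>y. (\<integral>z. K t x z * K s z y * f y \<partial>M) \<partial>M)"
    using Fubini_integral[OF integrable_pair_kernel[OF assms(1,4,2,3)]] by simp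
  also have "\<dots> = (\<integral>y. K (t + s) x y * f y \<partial>M)"
    by (intro Bochner_Integration.integral_cong refl) (simp add: kernel_semigroup assms)
  finally show ?thesis unfolding op_def .
qed

text \<open>By Tonelli and symmetry the inner integral is the mass of \<open>K t y\<close>, at most
  1. Positivity and this L^1 contraction are all that Hopf's argument asks of an operator.\<close>

lemma integral_op_le:
  assumes "t > 0" "integrable M f" "\<And>y. y \<in> space M \<Longrightarrow> 0 \<le> f y"
  shows "(\<integral>x. op t f x \<partial>M) \<le> (\<integral>x. f x \<partial>M)"
proof -
  interpret pair_sigma_finite M M ..
  have [measurable]: "f \<in> borel_measurable M" using assms by auto
  have [measurable]: "(\<lambda>z. K t (fst z) (snd z)) \<in> borel_measurable (M \<Otimes>\<^sub>M M)"
    by (rule kernel_measurable[OF assms(1)])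
  have "ennreal (\<integral>x. op t f x \<partial>M) = (\<integral>\<^sup>+x. ennreal (op t f x) \<partial>M)"
    by (rule nn_integral_eq_integral[symmetric])
       (auto intro!: integrable_op assms AE_I2 op_nonneg)
  also have "\<dots> = (\<integral>\<^sup>+x. (\<integral>\<^sup>+y. ennreal (K t x y * f y) \<partial>M) \<partial>M)"
    unfolding op_def
    by (intro nn_integral_cong nn_integral_eq_integral[symmetric] integrable_kernel_mult assms AE_I2
          mult_nonneg_nonneg kernel_nonneg)
  also have "\<dots> = (\<integral>\<^sup>+y. (\<integral>\<^sup>+x. ennreal (K t x y * f y) \<partial>M) \<partial>M)"
  proof -
    have "(\<lambda>z. ennreal (K t (fst z) (snd z) * f (snd z))) \<in> borel_measurable (M \<Otimes>\<^sub>M M)" by measurable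
    from Fubini'[of "\<lambda>x y. ennreal (K t x y * f y)"] this show ?thesis by (simp add: case_prod_beta)
  qed
  also have "\<dots> = (\<integral>\<^sup>+y. ennreal (\<integral>x. K t y x * f y \<partial>M) \<partial>M)"
  proof (intro nn_integral_cong)
    fix y assume y: "y \<in> space M"
    have "(\<integral>\<^sup>+x. ennreal (K t x y * f y) \<partial>M) = (\<integral>\<^sup>+x. ennreal (K t y x * f y) \<partial>M)"
      by (intro nn_integral_cong) (simp add: kernel_sym[OF assms(1) y])
    also have "\<dots> = ennreal (\<integral>x. K t y x * f y \<partial>M)"
      by (intro nn_integral_eq_integral integrable_kernel_mult[OF assms(1) y] AE_I2
          mult_nonneg_nonneg kernel_nonneg assms y) simp
    finally show "(\<integral>\<^sup>+x. ennreal (K t x y * f y) \<partial>M) = ennreal (\<integral>x. K t y x * f y \<partial>M)" .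
  qed
  also have "\<dots> \<le> (\<integral>\<^sup>+y. ennreal (f y) \<partial>M)"
  proof (intro nn_integral_mono ennreal_leI)
    fix y assume y: "y \<in> space M"
    have "(\<integral>x. K t y x * f y \<partial>M) = (\<integral>x. K t y x \<partial>M) * f y" by simp
    also have "\<dots> \<le> 1 * f y" by (intro mult_right_mono kernel_mass assms y)
    finally show "(\<integral>x. K t y x * f y \<partial>M) \<le> f y" by simp
  qed
  also have "\<dots> = ennreal (\<integral>x. f x \<partial>M)"
    by (rule nn_integral_eq_integral) (auto intro!: assms)
  finally show ?thesis
    using integral_nonneg_AE[OF AE_I2, of M f] assms(3) by (subst (asm) ennreal_le_iff) auto
qed

text \<open>Horner form of the ergodic sum f + T f + ... + T^(k-1) f for T = \<open>op h\<close>.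
  The recursion lets positivity of T act on a whole sum at once, as \<open>max_sum_le\<close>
  requires.\<close>

primrec partial_sum :: "real \<Rightarrow> ('x \<Rightarrow> real) \<Rightarrow> nat \<Rightarrow> 'x \<Rightarrow> real" where
  "partial_sum h f 0 x = 0"
| "partial_sum h f (Suc k) x = f x + op h (partial_sum h f k) x"

text \<open>The empty sum 0 takes part in the maximum, which is therefore nonnegative, and positive
  exactly where some partial sum is.\<close>

primrec max_sum :: "real \<Rightarrow> ('x \<Rightarrow> real) \<Rightarrow> nat \<Rightarrow> 'x \<Rightarrow> real" where
  "max_sum h f 0 x = 0"
| "max_sum h f (Suc k) x = max (max_sum h f k x) (partial_sum h f (Suc k) x)"

lemma integrable_partial_sum:
  assumes "h > 0" "integrable M f" shows "integrable M (partial_sum h f k)"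
proof (induction k)
  case 0
  have "partial_sum h f 0 = (\<lambda>x. 0)" by auto
  then show ?case by simp
next
  case (Suc k)
  have "partial_sum h f (Suc k) = (\<lambda>x. f x + op h (partial_sum h f k) x)" by auto
  then show ?case using integrable_op[OF assms(1) Suc] assms by simp
qed

lemma integrable_max_sum:
  assumes "h > 0" "integrable M f" shows "integrable M (max_sum h f k)"
proof (induction k)
  case 0
  have "max_sum h f 0 = (\<lambda>x. 0)" by auto
  then show ?case by simp
next
  case (Suc k)
  have "max_sum h f (Suc k) = (\<lambda>x. max (max_sum h f k x) (partial_sum h f (Suc k) x))" by auto
  then show ?case using integrable_max[OF Suc integrable_partial_sum[OF assms, of "Suc k"]]
      by (simp del: partial_sum.simps)
qed

lemma max_sum_nonneg: "0 \<le> max_sum h f k x"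
  by (induction k) auto

lemma partial_sum_le_max_sum: "j \<le> k \<Longrightarrow> partial_sum h f j x \<le> max_sum h f k x"
  by (induction k) (auto simp: le_Suc_eq)

text \<open>A positive maximum is attained at some index j + 1, where the sum is f plus
  \<open>op h\<close> of the sum of index j; by positivity of \<open>op h\<close> the maximum may
  replace that inner sum.\<close>

lemma max_sum_le:
  assumes "h > 0" "integrable M f" "x \<in> space M" "max_sum h f n x > 0"
  shows "max_sum h f n x \<le> f x + op h (max_sum h f n) x"
proof -
  have step: "partial_sum h f (Suc j) x \<le> f x + op h (max_sum h f n) x" if "j \<le> n" for j
    using op_mono[OF assms(1) integrable_partial_sum[OF assms(1,2)] integrable_max_sum[OF assms(1,2)]
        partial_sum_le_max_sum[OF that] assms(3)] by simp
  have "max_sum h f m x = 0 \<or> (\<exists>j<m. max_sum h f m x = partial_sum h f (Suc j) x)" for m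
    by (induction m) (auto simp: max_def intro: less_SucI simp del: partial_sum.simps)
  from this[of n] assms(4) step show ?thesis by fastforce
qed

text \<open>Garsia's proof of Hopf's maximal ergodic lemma.\<close>

lemma hopf_maximal:
  assumes "h > 0" "integrable M f"
  shows "0 \<le> (\<integral>x. indicator {x\<in>space M. max_sum h f n x > 0} x * f x \<partial>M)"
proof -
  let ?m = "max_sum h f n"
  let ?E = "{x\<in>space M. ?m x > 0}"
  note int = integrable_max_sum[OF assms, of n]
  have [measurable]: "?m \<in> borel_measurable M" using int by auto
  have E: "?E \<in> sets M" by measurable
  have ind: "integrable M (\<lambda>x. indicator ?E x * f x)"
    using integrable_mult_indicator[OF E assms(2)] by simp
  \<comment> \<open>On E this is \<open>max_sum_le\<close>; off E the maximum vanishes and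
    \<open>op h\<close> of it is nonnegative. The L^1 contraction then makes the left side
    nonnegative.\<close>
  have "(\<integral>x. ?m x - op h ?m x \<partial>M) \<le> (\<integral>x. indicator ?E x * f x \<partial>M)"
  proof (rule integral_mono[OF _ ind])
    show "integrable M (\<lambda>x. ?m x - op h ?m x)" using int integrable_op[OF assms(1) int] by simp
    fix x assume x: "x \<in> space M"
    show "?m x - op h ?m x \<le> indicator ?E x * f x"
    proof (cases "?m x > 0")
      case True then show ?thesis using max_sum_le[OF assms x True] x by (simp add: algebra_simps)
    next
      case False
      then have "?m x = 0" using max_sum_nonneg[of h f n x] by simp
      then show ?thesis using op_nonneg[OF assms(1) _ x, of ?m] max_sum_nonneg by simp
    qed
  qed
  moreover have "(\<integral>x. op h ?m x \<partial>M) \<le> (\<integral>x. ?m x \<partial>M)"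
    by (rule integral_op_le[OF assms(1) int max_sum_nonneg])
  ultimately show ?thesis using int integrable_op[OF assms(1) int] by simp
qed

text \<open>The semigroup law turns the j-th power of \<open>op h\<close> into the operator at time
  j h. The term f stands apart because no kernel is given at time 0.\<close>

lemma partial_sum_eq:
  assumes "h > 0" "integrable M f" "x \<in> space M"
  shows "partial_sum h f (Suc k) x = f x + (\<Sum>j=1..k. op (real j * h) f x)"
  using assms(3)
proof (induction k arbitrary: x)
  case 0 then show ?case by (simp add: op_def)
next
  case (Suc k)
  have int: "integrable M (\<lambda>y. \<Sum>j=1..k. op (real j * h) f y)"
    using assms by (intro Bochner_Integration.integrable_sum integrable_op) auto
  have "partial_sum h f (Suc (Suc k)) x = f x + op h (\<lambda>y. f y + (\<Sum>j=1..k. op (real j * h) f y)) x"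
  proof -
    have "op h (partial_sum h f (Suc k)) x = op h (\<lambda>y. f y + (\<Sum>j=1..k. op (real j * h) f y)) x"
      unfolding op_def[of h]
      by (intro Bochner_Integration.integral_cong refl arg_cong2[where f="(*)"] Suc.IH)
    then show ?thesis by simp
  qed
  also have "\<dots> = f x + (op h f x + op h (\<lambda>y. \<Sum>j=1..k. op (real j * h) f y) x)"
    using op_add[OF assms(1,2) int Suc.prems] by simp
  also have "op h (\<lambda>y. \<Sum>j=1..k. op (real j * h) f y) x = (\<Sum>j=1..k. op h (op (real j * h) f) x)"
    unfolding op_def[of h] sum_distrib_left
    using assms Suc.prems by (intro Bochner_Integration.integral_sum integrable_kernel_mult
        integrable_op) auto
  also have "\<dots> = (\<Sum>j=1..k. op (real (Suc j) * h) f x)"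
    using assms Suc.prems by (intro sum.cong refl, subst op_op) (auto simp: algebra_simps)
  also have "op h f x + \<dots> = (\<Sum>j=0..k. op (real (Suc j) * h) f x)"
    by (simp add: sum.atLeast_Suc_atMost[of 0 k])
  also have "\<dots> = (\<Sum>j=1..Suc k. op (real j * h) f x)"
    using sum.shift_bounds_cl_Suc_ivl[of "\<lambda>j. op (real j * h) f x" 0 k] by simp
  finally show ?case .
qed

text \<open>Since kernels have mass at most 1, lowering f by s lowers each of the k summands by at
  most s.\<close>

lemma partial_sum_diff_const:
  assumes "h > 0" "integrable M f" "x \<in> space M" "s \<ge> 0"
  shows "partial_sum h (\<lambda>y. f y - s) k x \<ge> partial_sum h f k x - real k * s"
  using assms(3)
proof (induction k arbitrary: x)
  case (Suc k)
  note i = integrable_partial_sum[OF assms(1,2), of k]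
  have "op h (partial_sum h f k) x - real k * s \<le> op h (\<lambda>y. partial_sum h f k y - real k * s) x"
    using op_diff_const[OF assms(1) i Suc.prems] assms(4) by simp
  also have "\<dots> \<le> op h (partial_sum h (\<lambda>y. f y - s) k) x"
    using i assms by (intro op_mono Suc integrable_partial_sum) auto
  finally show ?case by (simp add: algebra_simps)
qed simp

text \<open>Monotonicity costs the factor (s / t) powr \<kappa>. The window reaches 4 t because
  rounding t up to a multiple of h may double it, and the ergodic sum is then followed up to twice
  that multiple.\<close>

lemma op_le_later:
  assumes "0 < t" "t \<le> s" "s \<le> 4 * t" "integrable M f" "\<And>y. y \<in> space M \<Longrightarrow> 0 \<le> f y" "x \<in> space M"
  shows "op t f x \<le> 4 powr \<kappa> * op s f x"
proof -
  have "op t f x \<le> (\<integral>y. 4 powr \<kappa> * (K s x y * f y) \<partial>M)"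
    unfolding op_def
  proof (intro integral_mono integrable_kernel_mult integrable_mult_right assms)
    fix y assume y: "y \<in> space M"
    have "t powr \<kappa> * K t x y \<le> s powr \<kappa> * K s x y" by (rule kernel_mono[OF assms(1,2,6) y])
    also have "\<dots> \<le> (4 * t) powr \<kappa> * K s x y"
      using assms y exponent_nonneg by (intro mult_right_mono powr_mono2 kernel_nonneg) auto
    finally have "t powr \<kappa> * K t x y \<le> t powr \<kappa> * (4 powr \<kappa> * K s x y)"
      using assms(1) by (simp add: powr_mult mult_ac)
    then have "K t x y \<le> 4 powr \<kappa> * K s x y" using assms(1) by simp
    then show "K t x y * f y \<le> 4 powr \<kappa> * (K s x y * f y)"
      using mult_right_mono[OF _ assms(5)[OF y]] by (metis mult.assoc)
  qed (use assms in auto)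
  then show ?thesis unfolding op_def by simp
qed

text \<open>Monotonicity of \<open>t powr \<kappa> * K t\<close> bounds \<open>op t f\<close> by the terms of the ergodic sum between
  \<open>t / h\<close> and \<open>2 * t / h\<close>.\<close>

lemma large_op_imp_max_sum_pos:
  assumes h: "h > 0" "h \<le> t" and f: "integrable M f" "\<And>y. y \<in> space M \<Longrightarrow> 0 \<le> f y"
    and x: "x \<in> space M" and s: "s \<ge> 0" and large: "op t f x > 2 * 4 powr \<kappa> * s"
  shows "\<exists>n. max_sum h (\<lambda>y. f y - s) n x > 0"
proof -
  \<comment> \<open>n h is the first multiple of h at or after t, and h <= t gives n h <= 2 t. Hence
    j h lies in [t, 4 t] for all j from n to 2 n.\<close>
  define n where "n = nat \<lceil>t / h\<rceil>"
  have "t / h \<ge> 1" using h by simp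
  then have n: "real n \<ge> t / h" "real n \<le> t / h + 1" "n \<ge> 1" unfolding n_def by linarith+
  have n': "real n * h \<ge> t" "real n * h \<le> 2 * t"
    using n h by (auto simp: field_simps)
  have pos: "0 \<le> op (real j * h) f x" if "j \<ge> 1" for j
    using that h f x by (intro op_nonneg) auto
  have "real (n + 1) * (op t f x / 4 powr \<kappa>) = (\<Sum>j=n..2*n. op t f x / 4 powr \<kappa>)" by simp
  also have "\<dots> \<le> (\<Sum>j=n..2*n. op (real j * h) f x)"
  proof (rule sum_mono)
    fix j assume j: "j \<in> {n..2*n}"
    have "real j * h \<le> real (2 * n) * h" using j h by (intro mult_right_mono of_nat_mono) auto
    moreover have "real n * h \<le> real j * h" using j h by (intro mult_right_mono of_nat_mono) auto
    moreover have "real (2 * n) * h = 2 * (real n * h)" by simp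
    ultimately have "t \<le> real j * h" "real j * h \<le> 4 * t"
      using n' by linarith+
    then have "op t f x \<le> 4 powr \<kappa> * op (real j * h) f x"
      using n' h f x by (intro op_le_later) (auto simp: mult.assoc)
    then show "op t f x / 4 powr \<kappa> \<le> op (real j * h) f x" by (simp add: field_simps)
  qed
  also have "\<dots> \<le> (\<Sum>j=1..2*n. op (real j * h) f x)"
    using n pos by (intro sum_mono2) auto
  also have "\<dots> \<le> partial_sum h f (Suc (2*n)) x"
    using partial_sum_eq[OF h(1) f(1) x] f(2)[OF x] by simp
  finally have "real (n + 1) * (op t f x / 4 powr \<kappa>) - real (Suc (2*n)) * s
      \<le> max_sum h (\<lambda>y. f y - s) (Suc (2*n)) x"
    using partial_sum_diff_const[OF h(1) f(1) x s, of "Suc (2*n)"]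
      partial_sum_le_max_sum[of "Suc (2*n)" "Suc (2*n)" h "\<lambda>y. f y - s" x] by linarith
  moreover have "real (n + 1) * (op t f x / 4 powr \<kappa>) > real (n + 1) * (2 * s)"
    using large by (intro mult_strict_left_mono) (auto simp: field_simps)
  \<comment> \<open>The n + 1 good terms must outweigh the 2 n + 1 copies of s subtracted in the
    whole sum; this is the origin of the factor 2 in the threshold.\<close>
  moreover have "real (n + 1) * (2 * s) \<ge> real (Suc (2*n)) * s" using s by (simp add: algebra_simps)
  ultimately have "max_sum h (\<lambda>y. f y - s) (Suc (2*n)) x > 0" by linarith
  then show ?thesis by blast
qed

text \<open>Hopf's lemma on the positivity set E n gives s times its measure at most the integral of
  f over it, and these sets increase with n. The bound does not depend on h, so all positive times
  are reached later by letting h tend to 0.\<close>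

lemma emeasure_large_op:
  assumes "h > 0" "integrable M f" "\<And>y. y \<in> space M \<Longrightarrow> 0 \<le> f y" "s > 0"
    and V: "V \<subseteq> {x\<in>space M. \<exists>t\<ge>h. op t f x > 2 * 4 powr \<kappa> * s}"
  shows "emeasure M V \<le> ennreal ((\<integral>x. f x \<partial>M) / s)"
proof -
  define E where "E n = {x\<in>space M. max_sum h (\<lambda>y. f y - s) n x > 0}" for n
  have fs: "integrable M (\<lambda>y. f y - s)" using assms by auto
  have [measurable]: "max_sum h (\<lambda>y. f y - s) n \<in> borel_measurable M" for n
    using integrable_max_sum[OF assms(1) fs] by auto
  have E[measurable]: "E n \<in> sets M" for n unfolding E_def by measurable
  have inc: "incseq E"
    unfolding E_def by (intro incseq_SucI) (auto simp: less_max_iff_disj)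
  have "V \<subseteq> (\<Union>n. E n)"
  proof
    fix x assume "x \<in> V"
    then obtain t where "x \<in> space M" "t \<ge> h" "op t f x > 2 * 4 powr \<kappa> * s" using V by blast
    with large_op_imp_max_sum_pos[OF assms(1) _ assms(2,3), of t x s] assms(4) show "x \<in> (\<Union>n. E n)"
      unfolding E_def by auto
  qed
  then have "emeasure M V \<le> emeasure M (\<Union>n. E n)" by (intro emeasure_mono) auto
  also have "\<dots> = (SUP n. emeasure M (E n))"
    using E inc by (intro SUP_emeasure_incseq[symmetric]) auto
  also have "\<dots> \<le> ennreal ((\<integral>x. f x \<partial>M) / s)"
  proof (rule SUP_least)
    fix n
    have if': "integrable M (\<lambda>x. indicator (E n) x * f x)"
      using integrable_mult_indicator[OF E assms(2)] by simp
    have "0 \<le> (\<integral>x. indicator (E n) x * (f x - s) \<partial>M)"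
      using hopf_maximal[OF assms(1) fs, of n] unfolding E_def .
    also have "\<dots> = (\<integral>x. indicator (E n) x * f x - indicator (E n) x * s \<partial>M)"
      by (simp add: right_diff_distrib)
    also have "\<dots> = (\<integral>x. indicator (E n) x * f x \<partial>M) - measure M (E n) * s"
      using if' E by (subst Bochner_Integration.integral_diff) (auto simp: less_top[symmetric])
    also have "(\<integral>x. indicator (E n) x * f x \<partial>M) \<le> (\<integral>x. f x \<partial>M)"
      using if' assms by (intro integral_mono) (auto simp: indicator_def)
    finally have "measure M (E n) \<le> (\<integral>x. f x \<partial>M) / s" using assms(4) by (simp add: field_simps)
    then show "emeasure M (E n) \<le> ennreal ((\<integral>x. f x \<partial>M) / s)"
      by (simp add: emeasure_eq_measure ennreal_leI)
  qed
  finally show ?thesis .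
qed

text \<open>No semigroup law is asked of k, only domination by K at a proportional time. Continuity
  in t and bounds uniform for t away from 0 reduce the supremum to rational times, which makes the
  level sets measurable.\<close>

theorem weak_type_dominated:
  fixes k :: "real \<Rightarrow> 'x \<Rightarrow> 'x \<Rightarrow> real"
  assumes k_meas: "\<And>t. t > 0 \<Longrightarrow> (\<lambda>z. k t (fst z) (snd z)) \<in> borel_measurable (M \<Otimes>\<^sub>M M)"
    and k_bounded: "\<And>t0. t0 > 0 \<Longrightarrow> \<exists>B. \<forall>t\<ge>t0. \<forall>x\<in>space M. \<forall>y\<in>space M. \<bar>k t x y\<bar> \<le> B"
    and k_cont: "\<And>x y. x \<in> space M \<Longrightarrow> y \<in> space M \<Longrightarrow> continuous_on {0<..} (\<lambda>t. k t x y)"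
    and k_dom: "\<And>t x y. t > 0 \<Longrightarrow> x \<in> space M \<Longrightarrow> y \<in> space M \<Longrightarrow> \<bar>k t x y\<bar> \<le> C * K (c * t) x y"
    and "C > 0" "c > 0"
  shows "weak_type_1_1 M (maximal (\<lambda>t f x. LINT y|M. complex_of_real (k t x y) * f y))" (is
      "weak_type_1_1 M ?T")
proof -
  \<comment> \<open>The threshold factor of \<open>large_op_imp_max_sum_pos\<close>, times the
    domination constant.\<close>
  define D where "D = 2 * 4 powr \<kappa> * C"
  have "D > 0" unfolding D_def using \<open>C > 0\<close> by simp
  show ?thesis
    unfolding weak_type_1_1_def
  proof (intro exI[of _ D] conjI allI impI)
    show "0 \<le> D" using \<open>D > 0\<close> by simp
    fix f :: "'x \<Rightarrow> complex" and s :: real assume f: "integrable M f" and s: "s > 0"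
    define g where "g = (\<lambda>x. cmod (f x))"
    have g: "integrable M g" "\<And>y. 0 \<le> g y" unfolding g_def using f by auto
    have [measurable]: "f \<in> borel_measurable M" using f by auto
    define S where "S = (\<lambda>t x. LINT y|M. complex_of_real (k t x y) * f y)"
    have bound: "\<exists>B. \<forall>t\<ge>t0. \<forall>y\<in>space M. \<bar>k t x y\<bar> \<le> B" if "t0 > 0" "x \<in> space M" for t0 x
      using k_bounded[OF that(1)] that(2) by blast
    have km: "k t x \<in> borel_measurable M" if "t > 0" "x \<in> space M" for t x
      using measurable_compose[OF measurable_Pair1'[OF that(2)] k_meas[OF that(1)]] by simp
    have S_meas: "S t \<in> borel_measurable M" if "t > 0" for t
    proof -
      have [measurable]: "(\<lambda>z. k t (fst z) (snd z)) \<in> borel_measurable (M \<Otimes>\<^sub>M M)" by (rule k_meas[OF that])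
      have "(\<lambda>z. complex_of_real (k t (fst z) (snd z)) * f (snd z)) \<in> borel_measurable (M \<Otimes>\<^sub>M M)"
        by measurable
      then show ?thesis unfolding S_def by (intro borel_measurable_lebesgue_integral) (simp add:
          case_prod_beta)
    qed
    have S_le: "cmod (S t x) \<le> C * op (c * t) g x" if "t > 0" "x \<in> space M" for t x
    proof -
      have ct: "c * t > 0" using that \<open>c > 0\<close> by simp
      have "cmod (S t x) \<le> (\<integral>y. cmod (complex_of_real (k t x y) * f y) \<partial>M)"
        unfolding S_def by (rule integral_norm_bound)
      also have "\<dots> \<le> (\<integral>y. C * (K (c * t) x y * g y) \<partial>M)"
      proof (rule integral_mono_AE')
        show "integrable M (\<lambda>y. C * (K (c * t) x y * g y))"
          by (intro integrable_mult_right integrable_kernel_mult ct that g)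
        show "AE y in M. cmod (complex_of_real (k t x y) * f y) \<le> C * (K (c * t) x y * g y)"
          using k_dom[OF that] by (intro AE_I2) (auto simp: norm_mult g_def mult.assoc[symmetric]
              intro!: mult_right_mono)
        show "AE y in M. 0 \<le> C * (K (c * t) x y * g y)"
          using \<open>C > 0\<close> g(2) kernel_nonneg[OF ct that(2)] by (intro AE_I2) auto
      qed
      finally show ?thesis unfolding op_def by simp
    qed
    have S_cont: "continuous_on {0<..} (\<lambda>t. S t x)" if x: "x \<in> space M" for x
      unfolding continuous_on_sequentially
    proof (intro allI ballI impI)
      fix u t assume t: "t \<in> {0<..}" and u: "(\<forall>n. u n \<in> {0<..}) \<and> u \<longlonglongrightarrow> (t::real)"
      \<comment> \<open>Beyond t / 2 the kernel is bounded uniformly in time, which supplies the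
        integrable majorant for dominated convergence.\<close>
      then have "eventually (\<lambda>n. u n > t / 2) sequentially" by (intro order_tendstoD(1)[of u t]) auto
      then obtain N where N: "\<And>n. n \<ge> N \<Longrightarrow> u n > t / 2" by (auto simp: eventually_sequentially)
      obtain B where B: "\<forall>t'\<ge>t/2. \<forall>y\<in>space M. \<bar>k t' x y\<bar> \<le> B" using bound[of "t/2" x] t x by auto
      have "(\<lambda>n. S (u (n + N)) x) \<longlonglongrightarrow> S t x"
        unfolding S_def
      proof (rule integral_dominated_convergence[where w="\<lambda>y. B * g y"])
        show "(\<lambda>y. complex_of_real (k t x y) * f y) \<in> borel_measurable M"
          "(\<lambda>y. complex_of_real (k (u (n + N)) x y) * f y) \<in> borel_measurable M" for n
          using km[of t x] km[of "u (n + N)" x] t u x by auto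
        show "integrable M (\<lambda>y. B * g y)" using g by simp
        show "AE y in M. (\<lambda>n. complex_of_real (k (u (n + N)) x y) * f y) \<longlonglongrightarrow> complex_of_real (k t x y) * f y"
        proof (rule AE_I2)
          fix y assume y: "y \<in> space M"
          have "(\<lambda>n. k (u n) x y) \<longlonglongrightarrow> k t x y"
            using k_cont[OF x y] u t unfolding continuous_on_sequentially comp_def by blast
          then have "(\<lambda>n. k (u (n + N)) x y) \<longlonglongrightarrow> k t x y" by (rule LIMSEQ_ignore_initial_segment)
          then show "(\<lambda>n. complex_of_real (k (u (n + N)) x y) * f y) \<longlonglongrightarrow> complex_of_real (k t x y) * f y"
            by (intro tendsto_intros)
        qed
        show "AE y in M. norm (complex_of_real (k (u (n + N)) x y) * f y) \<le> B * g y" for n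
          using N[of "n + N"] B by (intro AE_I2) (auto simp: norm_mult g_def intro!: mult_right_mono)
      qed
      then show "((\<lambda>t. S t x) \<circ> u) \<longlonglongrightarrow> S t x"
        by (simp add: LIMSEQ_offset[of "\<lambda>n. S (u n) x" N] comp_def)
    qed
    \<comment> \<open>Rational times make \<open>V m\<close> a countable union, and the lower bound
      on t allows one step size, c / (m + 1), for all of it.\<close>
    define V where "V = (\<lambda>m. \<Union>t\<in>{t\<in>\<rat>. t \<ge> 1 / real (Suc m)}. {x\<in>space M. cmod (S t x) > s})"
    have level: "{x\<in>space M. ?T f x > ennreal s} = (\<Union>m. V m)"
    proof (intro set_eqI iffI)
      fix x assume "x \<in> {x\<in>space M. ?T f x > ennreal s}"
      then obtain t where x: "x \<in> space M" and t: "t > 0" "cmod (S t x) > s"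
        using s by (auto simp: maximal_def less_SUP_iff S_def ennreal_less_iff)
      \<comment> \<open>The inequality is strict and continuous in the time, so it persists at some
        rational time slightly after t.\<close>
      have "open ({0<..} \<inter> (\<lambda>t. cmod (S t x)) -` {s<..})"
        using S_cont[OF x] by (intro continuous_open_preimage continuous_on_norm) auto
      moreover have "t \<in> {0<..} \<inter> (\<lambda>t. cmod (S t x)) -` {s<..}" using t by auto
      ultimately obtain e where e: "e > 0" "ball t e \<subseteq> {0<..} \<inter> (\<lambda>t. cmod (S t x)) -` {s<..}"
        using open_contains_ball by blast
      obtain r where r: "r \<in> \<rat>" "t < r" "r < t + e" using Rats_dense_in_real[of t "t+e"] e by auto
      then have r': "r > 0" "cmod (S r x) > s" using e(2) by (auto simp: dist_real_def subset_iff)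
      obtain m where "inverse (real (Suc m)) < r" using reals_Archimedean[OF r'(1)] by blast
      then show "x \<in> (\<Union>m. V m)" unfolding V_def using x r r'
          by (auto simp: inverse_eq_divide intro!: exI[of _ m] bexI[of _ r])
    next
      fix x assume "x \<in> (\<Union>m. V m)"
      then obtain m t where "x \<in> space M" "t \<ge> 1 / real (Suc m)" "cmod (S t x) > s" unfolding V_def by auto
      moreover from this(2) have "t > 0" by (rule less_le_trans[rotated]) simp
      ultimately show "x \<in> {x\<in>space M. ?T f x > ennreal s}"
        using s by (auto simp: maximal_def less_SUP_iff S_def ennreal_less_iff intro!: bexI[of _ t])
    qed
    have V: "V m \<in> sets M" for m
      unfolding V_def
    proof (intro sets.countable_UN'')
      show "countable {t \<in> \<rat>. 1 / real (Suc m) \<le> t}" by (rule countable_subset[OF _ countable_rat]) auto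
      fix t assume "t \<in> {t \<in> \<rat>. 1 / real (Suc m) \<le> t}"
      then have "t > 0" by (auto intro: less_le_trans[rotated])
      note [measurable] = S_meas[OF this]
      show "{x\<in>space M. cmod (S t x) > s} \<in> sets M" by measurable
    qed
    have "incseq V"
    proof (rule incseq_SucI)
      fix m show "V m \<le> V (Suc m)" unfolding V_def
        by (intro UN_mono) (auto intro: order_trans[rotated] simp: frac_le)
    qed
    have est: "emeasure M (V m) \<le> ennreal (D / s * (\<integral>x. g x \<partial>M))" for m
    proof -
      have "emeasure M (V m) \<le> ennreal ((\<integral>x. g x \<partial>M) / (s / D))"
      proof (rule emeasure_large_op[of "c / real (Suc m)"])
        show "V m \<subseteq> {x\<in>space M. \<exists>t\<ge>c / real (Suc m). op t g x > 2 * 4 powr \<kappa> * (s / D)}"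
        proof
          fix x assume "x \<in> V m"
          then obtain t where x: "x \<in> space M" "t \<ge> 1 / real (Suc m)" "cmod (S t x) > s" unfolding V_def
              by auto
          moreover from this(2) have "t > 0" by (rule less_le_trans[rotated]) simp
          ultimately have "s < C * op (c * t) g x" using S_le by fastforce
          then have "op (c * t) g x > 2 * 4 powr \<kappa> * (s / D)"
            unfolding D_def using \<open>C > 0\<close> by (simp add: field_simps)
          moreover have "c * t \<ge> c / real (Suc m)"
            using mult_left_mono[OF x(2), of c] \<open>c > 0\<close> by simp
          ultimately show "x \<in> {x\<in>space M. \<exists>t\<ge>c / real (Suc m). op t g x > 2 * 4 powr \<kappa> * (s / D)}"
            using x(1) by blast
        qed
      qed (use g s \<open>D > 0\<close> \<open>c > 0\<close> in auto)
      then show ?thesis by (simp add: field_simps)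
    qed
    show "{x\<in>space M. ?T f x > ennreal s} \<in> sets M"
      unfolding level using V by auto
    have "emeasure M (\<Union>m. V m) = (SUP m. emeasure M (V m))"
      using V \<open>incseq V\<close> by (intro SUP_emeasure_incseq[symmetric]) auto
    also have "\<dots> \<le> ennreal (D / s * (\<integral>x. g x \<partial>M))" by (intro SUP_least est)
    finally show "emeasure M {x\<in>space M. ?T f x > ennreal s}
        \<le> ennreal (D / s * (LINT x|M. cmod (f x)))"
      unfolding level g_def .
  qed
qed

end

section \<open>Tensor products of heat families\<close>

lemma PiM_kernel_measurable:
  fixes k :: "'i \<Rightarrow> 'a \<Rightarrow> 'a \<Rightarrow> real"
  assumes "finite I" "\<And>i. i \<in> I \<Longrightarrow> (\<lambda>z. k i (fst z) (snd z)) \<in> borel_measurable (M i \<Otimes>\<^sub>M M i)"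
  shows "(\<lambda>z. \<Prod>i\<in>I. k i (fst z i) (snd z i)) \<in> borel_measurable (Pi\<^sub>M I M \<Otimes>\<^sub>M Pi\<^sub>M I M)"
proof (rule borel_measurable_prod)
  fix i assume i: "i \<in> I"
  have "(\<lambda>z. (fst z i, snd z i)) \<in> (Pi\<^sub>M I M \<Otimes>\<^sub>M Pi\<^sub>M I M) \<rightarrow>\<^sub>M (M i \<Otimes>\<^sub>M M i)"
    using i by measurable
  from measurable_compose[OF this assms(2)[OF i]]
  show "(\<lambda>z. k i (fst z i) (snd z i)) \<in> borel_measurable (Pi\<^sub>M I M \<Otimes>\<^sub>M Pi\<^sub>M I M)" by simp
qed

lemma (in heat_family) integrable_kernel:
  assumes "t > 0" "x \<in> space M" shows "integrable M (K t x)"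
  using integrable_kernel_mult[OF assms, of "\<lambda>_. 1"] by simp

text \<open>Mass and semigroup law factor by Fubini. At a common time a product of nonnegative
  nondecreasing functions is nondecreasing, so monotonicity survives with the sum of the
  exponents.\<close>

lemma heat_family_PiM:
  fixes M :: "'i \<Rightarrow> 'a measure" and K :: "'i \<Rightarrow> real \<Rightarrow> 'a \<Rightarrow> 'a \<Rightarrow> real"
  assumes I: "finite I" and sf: "product_sigma_finite M"
    and hf: "\<And>i. i \<in> I \<Longrightarrow> heat_family (M i) (K i) (\<kappa> i)"
  shows "heat_family (Pi\<^sub>M I M) (\<lambda>t x y. \<Prod>i\<in>I. K i t (x i) (y i)) (\<Sum>i\<in>I. \<kappa> i)"
proof -
  interpret product_sigma_finite M by (rule sf)
  let ?K = "\<lambda>t x y. \<Prod>i\<in>I. K i t (x i) (y i)"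
  note hf' = heat_family.kernel_nonneg[OF hf] heat_family.kernel_sym[OF hf]
    heat_family.kernel_mass[OF hf] heat_family.kernel_semigroup[OF hf] heat_family.kernel_mono[OF hf]
  have sp: "x i \<in> space (M i)" if "x \<in> space (Pi\<^sub>M I M)" "i \<in> I" for x i
    using that by (auto simp: space_PiM)
  have nonneg: "0 \<le> K i t (x i) (y i)" if "t > 0" "x \<in> space (Pi\<^sub>M I M)" "y \<in> space (Pi\<^sub>M I M)" "i \<in> I"
      for t x y i
    using that by (intro hf'(1)) (auto intro: sp)
  show ?thesis
  proof (intro heat_family.intro heat_family_axioms.intro)
    show "finite_measure (Pi\<^sub>M I M)"
    proof
      have "emeasure (Pi\<^sub>M I M) (space (Pi\<^sub>M I M)) = (\<Prod>i\<in>I. emeasure (M i) (space (M i)))"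
        unfolding space_PiM using I by (intro emeasure_PiM) auto
      also have "\<dots> \<noteq> \<infinity>"
        using I finite_measure.emeasure_finite[OF heat_family.axioms(1)[OF hf]]
        by (auto simp: ennreal_prod_eq_top)
      finally show "emeasure (Pi\<^sub>M I M) (space (Pi\<^sub>M I M)) \<noteq> \<infinity>" .
    qed
    show "0 \<le> (\<Sum>i\<in>I. \<kappa> i)" by (intro sum_nonneg heat_family.exponent_nonneg[OF hf])
    fix t :: real assume t: "t > 0"
    show "(\<lambda>z. ?K t (fst z) (snd z)) \<in> borel_measurable (Pi\<^sub>M I M \<Otimes>\<^sub>M Pi\<^sub>M I M)"
      by (intro PiM_kernel_measurable I heat_family.kernel_measurable[OF hf] t)
    have "\<forall>i\<in>I. \<exists>B. \<forall>x\<in>space (M i). \<forall>y\<in>space (M i). K i t x y \<le> B"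
      using heat_family.kernel_bounded[OF hf t] by blast
    then obtain B where B: "\<And>i x y. i \<in> I \<Longrightarrow> x \<in> space (M i) \<Longrightarrow> y \<in> space (M i) \<Longrightarrow> K i t x y \<le> B i"
      by metis
    show "\<exists>B. \<forall>x\<in>space (Pi\<^sub>M I M). \<forall>y\<in>space (Pi\<^sub>M I M). ?K t x y \<le> B"
    proof (intro exI ballI)
      fix x y assume "x \<in> space (Pi\<^sub>M I M)" "y \<in> space (Pi\<^sub>M I M)"
      then show "?K t x y \<le> (\<Prod>i\<in>I. B i)"
        using nonneg[OF t] B sp by (intro prod_mono) auto
    qed
    fix x assume x: "x \<in> space (Pi\<^sub>M I M)"
    have int: "integrable (M i) (K i t (x i))" if "i \<in> I" for i
      by (rule heat_family.integrable_kernel[OF hf[OF that] t sp[OF x that]])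
    have "(\<integral>y. ?K t x y \<partial>Pi\<^sub>M I M) = (\<Prod>i\<in>I. \<integral>y. K i t (x i) y \<partial>M i)"
      by (rule product_integral_prod[OF I int])
    also have "\<dots> \<le> (\<Prod>i\<in>I. 1)"
      using t sp[OF x] by (intro prod_mono conjI integral_nonneg_AE AE_I2 hf') auto
    finally show "(\<integral>y. ?K t x y \<partial>Pi\<^sub>M I M) \<le> 1" by simp
    fix y assume y: "y \<in> space (Pi\<^sub>M I M)"
    show "0 \<le> ?K t x y" by (intro prod_nonneg nonneg t x y)
    show "?K t x y = ?K t y x" by (intro prod.cong refl hf'(2) t sp x y)
    show "(\<integral>z. ?K t x z * ?K s z y \<partial>Pi\<^sub>M I M) = ?K (t + s) x y" if s: "s > 0" for s
    proof -
      have "(\<integral>z. ?K t x z * ?K s z y \<partial>Pi\<^sub>M I M) = (\<integral>z. (\<Prod>i\<in>I. K i t (x i) (z i) * K i s (y i) (z i))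
          \<partial>Pi\<^sub>M I M)"
        unfolding prod.distrib[symmetric]
        by (intro Bochner_Integration.integral_cong refl prod.cong arg_cong2[where f="(*)"] hf'(2) s sp y)
      also have "\<dots> = (\<Prod>i\<in>I. \<integral>z. K i t (x i) z * K i s (y i) z \<partial>M i)"
        by (intro product_integral_prod I heat_family.integrable_kernel_mult[OF hf] t sp x
            heat_family.integrable_kernel[OF hf] s y)
      also have "\<dots> = (\<Prod>i\<in>I. \<integral>z. K i t (x i) z * K i s z (y i) \<partial>M i)"
        by (intro prod.cong Bochner_Integration.integral_cong refl arg_cong2[where f="(*)"] hf'(2) s
            sp[OF y])
      also have "\<dots> = ?K (t + s) x y"
        by (intro prod.cong refl hf' t s sp x y)
      finally show ?thesis .
    qed
    show "t powr (\<Sum>i\<in>I. \<kappa> i) * ?K t x y \<le> s powr (\<Sum>i\<in>I. \<kappa> i) * ?K s x y" if "t \<le> s" for s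
    proof -
      have *: "r powr (\<Sum>i\<in>I. \<kappa> i) * ?K r x y = (\<Prod>i\<in>I. r powr \<kappa> i * K i r (x i) (y i))" if "r > 0" for r
        using that I by (simp add: powr_sum prod.distrib)
      show ?thesis
        unfolding *[OF t] *[OF less_le_trans[OF t that]]
        using nonneg[OF t x y] t that sp x y by (intro prod_mono conjI hf') auto
    qed
  qed
qed

text \<open>Only the coordinates in \<open>I\<close> matter, but the product measure locale wants all factors to be
  \<open>\<sigma>\<close>-finite.\<close>

theorem weak_type_PiM:
  fixes M :: "'i \<Rightarrow> 'a measure" and K k :: "'i \<Rightarrow> real \<Rightarrow> 'a \<Rightarrow> 'a \<Rightarrow> real"
  assumes I: "finite I"
    and hf: "\<And>i. i \<in> I \<Longrightarrow> heat_family (M i) (K i) (\<kappa> i)"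
    and k_meas: "\<And>i t. i \<in> I \<Longrightarrow> t > 0 \<Longrightarrow> (\<lambda>z. k i t (fst z) (snd z)) \<in> borel_measurable (M i \<Otimes>\<^sub>M M i)"
    and k_bounded: "\<And>i t0. i \<in> I \<Longrightarrow> t0 > 0 \<Longrightarrow> \<exists>B. \<forall>t\<ge>t0. \<forall>x\<in>space (M i). \<forall>y\<in>space (M i). \<bar>k i t x y\<bar> \<le> B"
    and k_cont: "\<And>i x y. i \<in> I \<Longrightarrow> x \<in> space (M i) \<Longrightarrow> y \<in> space (M i) \<Longrightarrow> continuous_on {0<..} (\<lambda>t. k i t x y)"
    and k_dom: "\<And>i t x y. i \<in> I \<Longrightarrow> t > 0 \<Longrightarrow> x \<in> space (M i) \<Longrightarrow> y \<in> space (M i) \<Longrightarrow> \<bar>k i t x y\<bar>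
        \<le> C i * K i (c * t) x y"
    and pos: "\<And>i. i \<in> I \<Longrightarrow> C i > 0" "c > 0"
  shows "weak_type_1_1 (Pi\<^sub>M I M)
    (maximal (\<lambda>t f x. LINT y|Pi\<^sub>M I M. complex_of_real (\<Prod>i\<in>I. k i t (x i) (y i)) * f y))"
proof -
  define N where "N = (\<lambda>i. if i \<in> I then M i else count_space {undefined})"
  have "Pi\<^sub>M I M = Pi\<^sub>M I N" by (rule PiM_cong) (auto simp: N_def)
  have N: "N i = M i" if "i \<in> I" for i using that by (simp add: N_def)
  have "product_sigma_finite N"
  proof (rule product_sigma_finite.intro)
    fix i show "sigma_finite_measure (N i)"
      using finite_measure.axioms(1)[OF heat_family.axioms(1)[OF hf]]
      by (auto simp: N_def intro: sigma_finite_measure_count_space_finite)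
  qed
  then interpret heat_family "Pi\<^sub>M I N" "\<lambda>t x y. \<Prod>i\<in>I. K i t (x i) (y i)" "\<Sum>i\<in>I. \<kappa> i"
    using hf by (intro heat_family_PiM I) (auto simp: N_def)
  have sp: "x i \<in> space (M i)" if "x \<in> space (Pi\<^sub>M I N)" "i \<in> I" for x i
    using PiE_mem[of x I "\<lambda>i. space (N i)" i] that by (auto simp: space_PiM N)
  have "weak_type_1_1 (Pi\<^sub>M I N)
    (maximal (\<lambda>t f x. LINT y|Pi\<^sub>M I N. complex_of_real (\<Prod>i\<in>I. k i t (x i) (y i)) * f y))"
  proof (rule weak_type_dominated[where C="\<Prod>i\<in>I. C i" and c=c])
    show "(\<Prod>i\<in>I. C i) > 0" "c > 0" using pos by (auto intro: prod_pos)
    show "(\<lambda>z. \<Prod>i\<in>I. k i t (fst z i) (snd z i)) \<in> borel_measurable (Pi\<^sub>M I N \<Otimes>\<^sub>M Pi\<^sub>M I N)" if "t > 0" for t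
      using k_meas that by (intro PiM_kernel_measurable I) (simp add: N_def)
    show "continuous_on {0<..} (\<lambda>t. \<Prod>i\<in>I. k i t (x i) (y i))"
      if "x \<in> space (Pi\<^sub>M I N)" "y \<in> space (Pi\<^sub>M I N)" for x y
      by (intro continuous_on_prod k_cont sp that)
    show "\<bar>\<Prod>i\<in>I. k i t (x i) (y i)\<bar> \<le> (\<Prod>i\<in>I. C i) * (\<Prod>i\<in>I. K i (c * t) (x i) (y i))"
      if "t > 0" "x \<in> space (Pi\<^sub>M I N)" "y \<in> space (Pi\<^sub>M I N)" for t x y
      unfolding abs_prod prod.distrib[symmetric]
      by (intro prod_mono conjI k_dom that sp) auto
    show "\<exists>B. \<forall>t\<ge>t0. \<forall>x\<in>space (Pi\<^sub>M I N). \<forall>y\<in>space (Pi\<^sub>M I N). \<bar>\<Prod>i\<in>I. k i t (x i) (y i)\<bar>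
        \<le> B" if "t0 > 0" for t0
    proof -
      from k_bounded[OF _ that] have "\<forall>i\<in>I. \<exists>B. \<forall>t\<ge>t0. \<forall>x\<in>space (M i). \<forall>y\<in>space (M i). \<bar>k i t x y\<bar> \<le> B"
        by blast
      then obtain B where B: "\<And>i t x y. i \<in> I \<Longrightarrow> t \<ge> t0 \<Longrightarrow> x \<in> space (M i) \<Longrightarrow> y \<in> space (M i) \<Longrightarrow> \<bar>k i t x y\<bar>
          \<le> B i"
        by metis
      show ?thesis
      proof (intro exI allI impI ballI)
        fix t x y assume "t \<ge> t0" "x \<in> space (Pi\<^sub>M I N)" "y \<in> space (Pi\<^sub>M I N)"
        then show "\<bar>\<Prod>i\<in>I. k i t (x i) (y i)\<bar> \<le> (\<Prod>i\<in>I. B i)"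
          unfolding abs_prod by (intro prod_mono conjI B sp) auto
      qed
    qed
  qed
  then show ?thesis unfolding \<open>Pi\<^sub>M I M = Pi\<^sub>M I N\<close> .
qed

section \<open>Jacobi polynomials\<close>

definition jacobi_eigenvalue :: "real \<Rightarrow> real \<Rightarrow> nat \<Rightarrow> real" where
  "jacobi_eigenvalue a b n = real n * (real n + a + b + 1)"

text \<open>The Jacobi differential operator, kept on polynomials so that no question of domain
  arises. As a generator it is nonpositive: its eigenvalues are the negatives of
  \<open>jacobi_eigenvalue\<close>.\<close>

definition jacobi_op :: "real \<Rightarrow> real \<Rightarrow> real poly \<Rightarrow> real poly" where
  "jacobi_op a b p = [:1, 0, -1:] * pderiv (pderiv p) + [:b - a, - (a + b + 2):] * pderiv p"

text \<open>The polynomial factor in the k-th derivative of (1 - x)^A (1 + x)^B. Here A and B stay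
  fixed while k varies; for Jacobi polynomials they depend on n, which would spoil the inductions on
  k.\<close>

primrec rodrigues_poly :: "real \<Rightarrow> real \<Rightarrow> nat \<Rightarrow> real poly" where
  "rodrigues_poly A B 0 = 1"
| "rodrigues_poly A B (Suc k) =
     [:B - A, 2 * real k - A - B:] * rodrigues_poly A B k + [:1, 0, -1:] * pderiv (rodrigues_poly A B k)"

lemma higher_deriv_rodrigues:
  assumes "x \<in> {-1<..<1}"
  shows "(deriv ^^ k) (\<lambda>u. (1 - u) powr A * (1 + u) powr B) x =
    (1 - x) powr (A - real k) * (1 + x) powr (B - real k) * poly (rodrigues_poly A B k) x"
  using assms
proof (induction k arbitrary: x)
  case (Suc k)
  let ?q = "rodrigues_poly A B k"
  let ?g = "\<lambda>u. (1 - u) powr (A - real k) * (1 + u) powr (B - real k) * poly ?q u"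
  note x = Suc.prems
  have ev: "eventually (\<lambda>u. (deriv ^^ k) (\<lambda>u. (1 - u) powr A * (1 + u) powr B) u = ?g u) (nhds x)"
    using x Suc.IH by (intro eventually_nhds_in_open[THEN eventually_mono, of "{-1<..<1}"]) auto
  have p: "(1 - x) powr (A - real k) = (1 - x) * (1 - x) powr (A - real (Suc k))"
    "(1 + x) powr (B - real k) = (1 + x) * (1 + x) powr (B - real (Suc k))"
    using x powr_mult_base[of "1 - x" "A - real (Suc k)"] powr_mult_base[of "1 + x" "B - real (Suc k)"]
        by auto
  have d: "((\<lambda>u. (1 - u) powr (A - real k)) has_real_derivative
      - (A - real k) * (1 - x) powr (A - real (Suc k))) (at x)"
    "((\<lambda>u. (1 + u) powr (B - real k)) has_real_derivative
      (B - real k) * (1 + x) powr (B - real (Suc k))) (at x)"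
    using x by (auto intro!: derivative_eq_intros simp: algebra_simps)
  have "(?g has_real_derivative (1 - x) powr (A - real (Suc k)) * (1 + x) powr (B - real (Suc k)) *
      poly (rodrigues_poly A B (Suc k)) x) (at x)"
    by (rule DERIV_cong[OF DERIV_mult[OF DERIV_mult[OF d] poly_DERIV]],
        simp only: p, simp add: algebra_simps)
  then show ?case
    using deriv_cong_ev[OF ev refl] by (simp add: DERIV_imp_deriv)
qed simp

lemma jacobi_poly_eq_rodrigues:
  "jacobi_poly a b n = smult ((-1) ^ n / (2 ^ n * fact n)) (rodrigues_poly (a + real n) (b + real n) n)"
proof -
  have "poly (smult ((-1) ^ n / (2 ^ n * fact n)) (rodrigues_poly (a + real n) (b + real n) n)) x
      = jacobi_rodrigues a b n x" if x: "x \<in> {-1<..<1}" for x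
  proof -
    have "(1 - x) powr (- a) * (1 - x) powr a = 1" "(1 + x) powr (- b) * (1 + x) powr b = 1"
      using x by (simp_all flip: powr_add)
    then have "((1 - x) powr (- a) * (1 - x) powr a) * ((1 + x) powr (- b) * (1 + x) powr b) = 1"
      by simp
    then show ?thesis
      unfolding jacobi_rodrigues_def higher_deriv_rodrigues[OF x] by (simp add: mult_ac)
  qed
  then show ?thesis
    using jacobi_poly_ex1[of a b n] poly_jacobi_poly[of _ a b n] by blast
qed

text \<open>At fixed A and B, differentiation only lowers k. For A = a + n, B = b + n and k + 1 = n
  the constant is minus the n-th eigenvalue.\<close>

lemma pderiv_rodrigues_poly:
  "pderiv (rodrigues_poly A B (Suc k)) = smult (- (real (Suc k) * (A + B - real k))) (rodrigues_poly A B k)"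
proof (induction k)
  case 0
  show ?case by (simp add: pderiv_pCons)
next
  case (Suc k)
  define q where "q = rodrigues_poly A B"
  define c where "c = - (real (Suc k) * (A + B - real k))"
  note IH = Suc.IH[folded q_def c_def]
  have r: "[:B - A, 2 * real (Suc k) - A - B:] + [:0, -2:] = [:B - A, 2 * real k - A - B:]" by simp
  have "q (Suc (Suc k)) = [:B - A, 2 * real (Suc k) - A - B:] * q (Suc k)
      + [:1, 0, -1:] * pderiv (q (Suc k))"
    unfolding q_def by (rule rodrigues_poly.simps)
  moreover have "pderiv [:B - A, 2 * real (Suc k) - A - B:] = [:2 * real (Suc k) - A - B:]"
    "pderiv [:1, 0, -1 :: real:] = [:0, -2:]" by (simp_all add: pderiv_pCons)
  ultimately have "pderiv (q (Suc (Suc k))) = [:2 * real (Suc k) - A - B:] * q (Suc k)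
     + ([:B - A, 2 * real (Suc k) - A - B:] + [:0, -2:]) * pderiv (q (Suc k))
         + [:1, 0, -1:] * pderiv (pderiv (q (Suc k)))"
    by (simp only: pderiv_add pderiv_mult distrib_right distrib_left ac_simps)
  also have "\<dots> = [:2 * real (Suc k) - A - B:] * q (Suc k) + smult c ([:B - A, 2 * real k - A - B:] * q k
      + [:1, 0, -1:] * pderiv (q k))"
    unfolding r IH pderiv_smult by (simp add: smult_add_right)
  also have "[:B - A, 2 * real k - A - B:] * q k + [:1, 0, -1:] * pderiv (q k) = q (Suc k)"
    unfolding q_def by simp
  also have "[:2 * real (Suc k) - A - B:] * q (Suc k) + smult c (q (Suc k))
      = smult (2 * real (Suc k) - A - B + c) (q (Suc k))"
    by (simp only: smult_add_left mult_pCons_left mult_zero_left pCons_0_0 add_0_right)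
  also have "2 * real (Suc k) - A - B + c = - (real (Suc (Suc k)) * (A + B - real (Suc k)))"
    unfolding c_def by (simp add: algebra_simps)
  finally show ?case unfolding q_def .
qed

text \<open>The derivative of the n-th polynomial is a multiple of its predecessor, so applying the
  operator reproduces, up to that multiple, the right-hand side of the recursion that defines the
  n-th polynomial.\<close>

lemma jacobi_op_rodrigues_poly:
  "jacobi_op a b (rodrigues_poly (a + real n) (b + real n) n)
    = smult (- jacobi_eigenvalue a b n) (rodrigues_poly (a + real n) (b + real n) n)"
proof (cases n)
  case 0 then show ?thesis by (simp add: jacobi_op_def jacobi_eigenvalue_def)
next
  case (Suc m)
  define q where "q = rodrigues_poly (a + real n) (b + real n)"
  define c where "c = - (real (Suc m) * ((a + real n) + (b + real n) - real m))"
  have d: "pderiv (q (Suc m)) = smult c (q m)" unfolding q_def c_def by (rule pderiv_rodrigues_poly)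
  have "jacobi_op a b (q (Suc m)) = smult c ([:b - a, - (a + b + 2):] * q m + [:1, 0, -1:] * pderiv (q m))"
    unfolding jacobi_op_def d pderiv_smult by (simp add: smult_add_right)
  also have "[:b - a, - (a + b + 2):] = [:(b + real n) - (a + real n), 2 * real m - (a + real n) - (b
      + real n):]"
    using Suc by simp
  also have "\<dots> * q m + [:1, 0, -1:] * pderiv (q m) = q (Suc m)"
    unfolding q_def by simp
  also have "c = - jacobi_eigenvalue a b n"
    unfolding c_def jacobi_eigenvalue_def using Suc by (simp add: algebra_simps)
  finally show ?thesis unfolding q_def Suc by simp
qed

lemma jacobi_op_smult: "jacobi_op a b (smult c p) = smult c (jacobi_op a b p)"
  by (simp add: jacobi_op_def pderiv_smult smult_add_right)

lemma jacobi_op_add: "jacobi_op a b (p + q) = jacobi_op a b p + jacobi_op a b q"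
  unfolding jacobi_op_def pderiv_add distrib_left by (simp only: ac_simps)

lemma jacobi_op_jacobi_poly:
  "jacobi_op a b (jacobi_poly a b n) = smult (- jacobi_eigenvalue a b n) (jacobi_poly a b n)"
  unfolding jacobi_poly_eq_rodrigues jacobi_op_smult jacobi_op_rodrigues_poly by (simp add: mult.commute)

lemma degree_coeff_rodrigues_poly:
  "degree (rodrigues_poly A B k) \<le> k \<and> coeff (rodrigues_poly A B k) k = (\<Prod>j<k. real j - A - B)"
proof (induction k)
  case (Suc k)
  define q where "q = rodrigues_poly A B k"
  note IH = Suc.IH[folded q_def]
  have d: "degree q \<le> k" using IH by simp
  have d1: "degree ([:B - A, 2 * real k - A - B:] * q) \<le> Suc k"
    by (rule order_trans[OF degree_mult_le]) (use d in auto)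
  have d2: "degree ([:1, 0, -1::real:] * pderiv q) \<le> Suc k"
  proof (cases k)
    case 0
    then have "pderiv q = 0" using d by (simp add: pderiv_eq_0_iff)
    then show ?thesis by simp
  next
    case (Suc m)
    have "degree (pderiv q) \<le> m" using d Suc by (simp add: degree_pderiv)
    then show ?thesis using Suc by (intro order_trans[OF degree_mult_le]) auto
  qed
  have c1: "coeff ([:B - A, 2 * real k - A - B:] * q) (Suc k) = (2 * real k - A - B) * coeff q k"
    using d by (simp add: coeff_eq_0)
  have c2: "coeff ([:1, 0, -1::real:] * pderiv q) (Suc k) = - (real k * coeff q k)"
    using d by (cases k) (auto simp: coeff_pderiv coeff_eq_0)
  show ?case
    unfolding rodrigues_poly.simps q_def[symmetric] coeff_add c1 c2
    by (intro conjI degree_add_le d1 d2) (use IH in \<open>simp add: algebra_simps\<close>)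
qed simp

lemma degree_jacobi_poly:
  assumes "a \<ge> - 1 / 2" "b \<ge> - 1 / 2"
  shows "degree (jacobi_poly a b n) = n"
proof -
  let ?q = "rodrigues_poly (a + real n) (b + real n) n"
  have "real j - (a + real n) - (b + real n) \<noteq> 0" if "j < n" for j
  proof -
    have "real j + 1 \<le> real n" using that by simp
    then show ?thesis using assms that by linarith
  qed
  then have "coeff ?q n \<noteq> 0" using degree_coeff_rodrigues_poly[of _ _ n] by auto
  then have "degree ?q = n" using degree_coeff_rodrigues_poly[of _ _ n] le_degree by (metis le_antisym)
  then show ?thesis unfolding jacobi_poly_eq_rodrigues by simp
qed

lemma jacobi_poly_0 [simp]: "jacobi_poly a b 0 = 1"
  by (simp add: jacobi_poly_eq_rodrigues)

text \<open>There is one Jacobi polynomial in each degree, so leading terms can be removed one by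
  one. This makes every polynomial the initial value of a finite heat flow.\<close>

lemma polynomial_jacobi_expansion:
  assumes "a \<ge> - 1 / 2" "b \<ge> - 1 / 2" "degree p \<le> N"
  shows "\<exists>c. p = (\<Sum>n\<le>N. smult (c n) (jacobi_poly a b n))"
  using assms(3)
proof (induction N arbitrary: p)
  case 0
  then obtain c where "p = [:c:]" by (metis degree_eq_zeroE le_zero_eq)
  then show ?case by (intro exI[of _ "\<lambda>_. c"]) simp
next
  case (Suc N)
  define c where "c = coeff p (Suc N) / lead_coeff (jacobi_poly a b (Suc N))"
  let ?P = "jacobi_poly a b (Suc N)"
  have dP: "degree ?P = Suc N" by (rule degree_jacobi_poly[OF assms(1,2)])
  then have lc: "coeff ?P (Suc N) \<noteq> 0" by (metis degree_0 leading_coeff_0_iff nat.distinct(1))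
  have "degree (p - smult c ?P) \<le> N"
  proof (rule degree_le, intro allI impI)
    fix i assume "N < i"
    then consider "i = Suc N" | "Suc N < i" by linarith
    then show "coeff (p - smult c ?P) i = 0"
    proof cases
      case 1 then show ?thesis using lc by (simp add: c_def dP)
    next
      case 2 then show ?thesis using dP Suc.prems by (simp add: coeff_eq_0)
    qed
  qed
  from Suc.IH[OF this] obtain d where d: "p - smult c ?P = (\<Sum>n\<le>N. smult (d n) (jacobi_poly a b n))" by blast
  have "(\<Sum>n\<le>N. smult ((d(Suc N := c)) n) (jacobi_poly a b n)) = (\<Sum>n\<le>N. smult (d n) (jacobi_poly a b n))"
    by (intro sum.cong) auto
  with d have "p = (\<Sum>n\<le>Suc N. smult ((d(Suc N := c)) n) (jacobi_poly a b n))" by (simp add: algebra_simps)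
  then show ?case by blast
qed

section \<open>The measure in the angular variable, integration by parts and orthogonality\<close>

definition jacobi_weight :: "real \<Rightarrow> real \<Rightarrow> real \<Rightarrow> real" where
  "jacobi_weight a b \<theta> = sin (\<theta> / 2) powr (2 * a + 1) * cos (\<theta> / 2) powr (2 * b + 1)"

lemma jacobi_weight_nonneg [simp]: "0 \<le> jacobi_weight a b \<theta>"
  by (simp add: jacobi_weight_def)

lemma jacobi_weight_measurable [measurable]: "jacobi_weight a b \<in> borel_measurable borel"
  unfolding jacobi_weight_def by measurable

lemma sin_cos_half_nonneg:
  assumes "\<theta> \<in> {0..pi}" shows "0 \<le> sin (\<theta> / 2)" "0 \<le> cos (\<theta> / 2)"
  using assms by (auto intro!: sin_ge_zero cos_ge_zero)

lemma jacobi_weight_le_1: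
  assumes "a \<ge> - 1 / 2" "b \<ge> - 1 / 2" "\<theta> \<in> {0..pi}"
  shows "jacobi_weight a b \<theta> \<le> 1"
  unfolding jacobi_weight_def using assms sin_cos_half_nonneg[OF assms(3)]
  by (intro mult_le_one powr_le1) auto

lemma mu1_eq: "mu1 a b = density (restrict_space lborel {0..pi}) (\<lambda>\<theta>. ennreal (jacobi_weight a b \<theta>))"
  by (simp add: mu1_def jacobi_weight_def)

lemma space_mu1 [simp]: "space (mu1 a b) = {0..pi}"
  by (simp add: mu1_def space_restrict_space)

lemma sets_mu1 [measurable_cong]: "sets (mu1 a b) = sets (restrict_space borel {0..pi})"
  by (simp add: mu1_def sets_restrict_space)

lemma borel_measurable_mu1:
  "f \<in> borel_measurable borel \<Longrightarrow> f \<in> borel_measurable (mu1 a b)"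
  by (simp add: measurable_restrict_space1 measurable_cong_sets[OF sets_mu1 refl])

lemma borel_measurable_mu1_continuous:
  fixes f :: "real \<Rightarrow> real"
  shows "continuous_on {0..pi} f \<Longrightarrow> f \<in> borel_measurable (mu1 a b)"
  by (simp add: borel_measurable_continuous_on_restrict measurable_cong_sets[OF sets_mu1 refl])

lemma finite_measure_mu1:
  assumes "a \<ge> - 1 / 2" "b \<ge> - 1 / 2"
  shows "finite_measure (mu1 a b)"
proof
  have "{0..pi} \<in> sets (restrict_space lborel {0..pi})" by (simp add: sets_restrict_space_iff)
  then have "emeasure (mu1 a b) (space (mu1 a b)) = (\<integral>\<^sup>+\<theta>. ennreal (jacobi_weight a b \<theta>) * indicator
      {0..pi} \<theta> \<partial>lborel)"
    unfolding mu1_eq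
    by (subst emeasure_density) (auto simp: nn_integral_restrict_space space_restrict_space
        measurable_restrict_space1
        intro!: nn_integral_cong split: split_indicator)
  also have "\<dots> \<le> (\<integral>\<^sup>+\<theta>. indicator {0..pi} \<theta> \<partial>lborel)"
    using jacobi_weight_le_1[OF assms] by (intro nn_integral_mono) (auto split: split_indicator)
  also have "\<dots> < \<infinity>" by simp
  finally show "emeasure (mu1 a b) (space (mu1 a b)) \<noteq> \<infinity>" by simp
qed

lemma integrable_mu1:
  fixes f :: "real \<Rightarrow> real"
  assumes "a \<ge> - 1 / 2" "b \<ge> - 1 / 2" "continuous_on {0..pi} f"
  shows "integrable (mu1 a b) f"
proof -
  interpret finite_measure "mu1 a b" by (rule finite_measure_mu1[OF assms(1,2)])
  have "compact (f ` {0..pi})" by (intro compact_continuous_image assms) auto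
  then obtain B where "\<And>x. x \<in> {0..pi} \<Longrightarrow> norm (f x) \<le> B"
    using compact_imp_bounded bounded_iff by (metis image_eqI)
  then show ?thesis
    by (intro integrable_const_bound[of _ B] AE_I2 borel_measurable_mu1_continuous assms) auto
qed

lemma integral_mu1:
  fixes f :: "real \<Rightarrow> real"
  assumes "f \<in> borel_measurable (mu1 a b)"
  shows "(\<integral>\<theta>. f \<theta> \<partial>mu1 a b) = (LBINT \<theta>:{0..pi}. jacobi_weight a b \<theta> * f \<theta>)"
    "integrable (mu1 a b) f \<longleftrightarrow> set_integrable lborel {0..pi} (\<lambda>\<theta>. jacobi_weight a b \<theta> * f \<theta>)"
proof -
  have m: "f \<in> borel_measurable (restrict_space lborel {0..pi})"
    using assms by (simp add: measurable_cong_sets[OF sets_mu1 refl] measurable_cong_sets[OF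
        sets_restrict_space_cong[OF sets_lborel] refl])
  have w: "jacobi_weight a b \<in> borel_measurable (restrict_space lborel {0..pi})"
    by (simp add: measurable_restrict_space1)
  show "(\<integral>\<theta>. f \<theta> \<partial>mu1 a b) = (LBINT \<theta>:{0..pi}. jacobi_weight a b \<theta> * f \<theta>)"
    unfolding mu1_eq using m w
    by (subst integral_density) (auto simp: integral_restrict_space set_lebesgue_integral_def)
  show "integrable (mu1 a b) f \<longleftrightarrow> set_integrable lborel {0..pi} (\<lambda>\<theta>. jacobi_weight a b \<theta> * f \<theta>)"
    unfolding mu1_eq using m w
    by (subst integrable_density) (auto simp: integrable_restrict_space set_integrable_def)
qed

text \<open>The second factor g depends on the angle and not just on its cosine: the Gaussian bound
  tests with functions that contain exp (2 l \<theta>).\<close>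

lemma jacobi_integration_by_parts:
  fixes p :: "real poly"
  assumes ab: "a \<ge> - 1 / 2" "b \<ge> - 1 / 2"
    and g: "\<And>\<theta>. \<theta> \<in> {0<..<pi} \<Longrightarrow> (g has_real_derivative g' \<theta>) (at \<theta>)"
    and cont: "continuous_on {0..pi} g" "continuous_on {0..pi} g'"
  shows "(\<integral>\<theta>. poly (jacobi_op a b p) (cos \<theta>) * g \<theta> \<partial>mu1 a b) =
    (\<integral>\<theta>. poly (pderiv p) (cos \<theta>) * sin \<theta> * g' \<theta> \<partial>mu1 a b)"
proof -
  let ?F = "\<lambda>\<theta>. poly (jacobi_op a b p) (cos \<theta>) * g \<theta> - poly (pderiv p) (cos \<theta>) * sin \<theta> * g' \<theta>"
  \<comment> \<open>Minus the weight times sin \<theta> times p'(cos \<theta>) g(\<theta>). The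
    exponents 2 a + 2 and 2 b + 2 are at least 1, so it is continuous and vanishes at both
    endpoints.\<close>
  let ?h = "\<lambda>\<theta>. - 2 * sin (\<theta> / 2) powr (2 * a + 2) * cos (\<theta> / 2) powr (2 * b
      + 2) * poly (pderiv p) (cos \<theta>) * g \<theta>"
  have i: "integrable (mu1 a b) (\<lambda>\<theta>. poly (jacobi_op a b p) (cos \<theta>) * g \<theta>)"
    "integrable (mu1 a b) (\<lambda>\<theta>. poly (pderiv p) (cos \<theta>) * sin \<theta> * g' \<theta>)"
    by (intro integrable_mu1 ab continuous_intros cont)+
  then have iF: "integrable (mu1 a b) ?F" by simp
  have Fm: "?F \<in> borel_measurable (mu1 a b)" using iF by auto
  have "((\<lambda>\<theta>. jacobi_weight a b \<theta> * ?F \<theta>) has_integral (?h pi - ?h 0)) {0..pi}"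
  proof (rule fundamental_theorem_of_calculus_interior)
    show "continuous_on {0..pi} ?h"
      using ab by (intro continuous_on_mult continuous_on_powr' continuous_intros cont)
        (auto intro!: sin_ge_zero cos_ge_zero)
    fix \<theta> assume t: "\<theta> \<in> {0<..<pi}"
    define S C where "S = sin (\<theta> / 2)" and "C = cos (\<theta> / 2)"
    have pos: "S > 0" "C > 0" unfolding S_def C_def using t by (auto intro!: sin_gt_zero cos_gt_zero)
    have sq: "S\<^sup>2 + C\<^sup>2 = 1" unfolding S_def C_def by simp
    have sin: "sin \<theta> = 2 * S * C" and cos: "cos \<theta> = C\<^sup>2 - S\<^sup>2"
      using sin_double[of "\<theta> / 2"] cos_double[of "\<theta> / 2"] unfolding S_def C_def by auto
    have pS: "S powr (2 * a + 2) = S * S powr (2 * a + 1)" "C powr (2 * b + 2) = C * C powr (2 * b + 1)"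
      using pos by (simp_all add: powr_mult_base add.commute)
    have d1: "((\<lambda>\<theta>. sin (\<theta> / 2) powr (2 * a + 2)) has_real_derivative (a + 1) * S powr (2 * a
        + 1) * C) (at \<theta>)"
      using pos unfolding S_def C_def by (auto intro!: derivative_eq_intros simp: algebra_simps)
    have d2: "((\<lambda>\<theta>. cos (\<theta> / 2) powr (2 * b + 2)) has_real_derivative - (b + 1) * C powr (2 * b
        + 1) * S) (at \<theta>)"
      using pos unfolding S_def C_def by (auto intro!: derivative_eq_intros simp: algebra_simps)
    have d3: "((\<lambda>\<theta>. poly (pderiv p) (cos \<theta>)) has_real_derivative - (poly (pderiv (pderiv p)) (cos \<theta>) *
        sin \<theta>)) (at \<theta>)"
      by (rule DERIV_cong[OF DERIV_chain2[OF poly_DERIV DERIV_cos]]) simp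
    have "(?h has_real_derivative (jacobi_weight a b \<theta> * ?F \<theta>)) (at \<theta>)"
    proof (rule DERIV_cong[OF DERIV_mult[OF DERIV_mult[OF DERIV_mult[OF DERIV_mult[OF DERIV_const d1]
        d2] d3] g[OF t]]], fold S_def C_def)
      let ?q1 = "poly (pderiv p) (cos \<theta>)" and ?q2 = "poly (pderiv (pderiv p)) (cos \<theta>)"
      have op: "poly (jacobi_op a b p) (cos \<theta>) = (sin \<theta>)\<^sup>2 * ?q2 + (b - a - (a + b + 2) * cos \<theta>) * ?q1"
        unfolding jacobi_op_def sin_squared_eq by (simp add: power2_eq_square algebra_simps)
      have tau: "b - a - (a + b + 2) * cos \<theta> = 2 * (b + 1) * S\<^sup>2 - 2 * (a + 1) * C\<^sup>2"
        unfolding cos using sq by algebra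
      show "(((0 * S powr (2 * a + 2) + ((a + 1) * S powr (2 * a + 1) * C) * - 2) * C powr (2 * b + 2) +
            (- (b + 1) * C powr (2 * b + 1) * S) * (- 2 * S powr (2 * a + 2))) * ?q1 +
           - (?q2 * sin \<theta>) * (- 2 * S powr (2 * a + 2) * C powr (2 * b + 2))) * g \<theta> +
          g' \<theta> * (- 2 * S powr (2 * a + 2) * C powr (2 * b + 2) * ?q1) = jacobi_weight a b \<theta> * ?F \<theta>"
        unfolding op tau pS jacobi_weight_def S_def[symmetric] C_def[symmetric]
        by (simp add: sin power2_eq_square algebra_simps)
    qed
    then show "(?h has_vector_derivative (jacobi_weight a b \<theta> * ?F \<theta>)) (at \<theta>)"
      by (simp add: has_real_derivative_iff_has_vector_derivative)
  qed simp
  then have "integral {0..pi} (\<lambda>\<theta>. jacobi_weight a b \<theta> * ?F \<theta>) = 0"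
    by (auto dest: integral_unique)
  moreover have "(\<integral>\<theta>. ?F \<theta> \<partial>mu1 a b) = integral {0..pi} (\<lambda>\<theta>. jacobi_weight a b \<theta> * ?F \<theta>)"
    unfolding integral_mu1(1)[OF Fm]
    by (rule set_borel_integral_eq_integral(2)) (use iF integral_mu1(2)[OF Fm] in simp)
  ultimately show ?thesis using i by simp
qed

lemma integrable_mu1_poly:
  assumes "a \<ge> - 1 / 2" "b \<ge> - 1 / 2" "continuous_on {0..pi} g"
  shows "integrable (mu1 a b) (\<lambda>\<theta>. poly p (cos \<theta>) * g \<theta>)"
  by (intro integrable_mu1 assms continuous_intros)

lemma jacobi_op_symmetric:
  assumes ab: "a \<ge> - 1 / 2" "b \<ge> - 1 / 2"
  shows "(\<integral>\<theta>. poly (jacobi_op a b p) (cos \<theta>) * poly q (cos \<theta>) \<partial>mu1 a b) =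
    - (\<integral>\<theta>. (sin \<theta>)\<^sup>2 * poly (pderiv p) (cos \<theta>) * poly (pderiv q) (cos \<theta>) \<partial>mu1 a b)"
proof -
  have "(\<integral>\<theta>. poly (jacobi_op a b p) (cos \<theta>) * poly q (cos \<theta>) \<partial>mu1 a b) =
    (\<integral>\<theta>. poly (pderiv p) (cos \<theta>) * sin \<theta> * (- (poly (pderiv q) (cos \<theta>) * sin \<theta>)) \<partial>mu1 a b)"
  proof (rule jacobi_integration_by_parts[OF ab])
    fix \<theta> show "((\<lambda>\<theta>. poly q (cos \<theta>)) has_real_derivative - (poly (pderiv q) (cos \<theta>) * sin \<theta>)) (at \<theta>)"
      by (rule DERIV_cong[OF DERIV_chain2[OF poly_DERIV DERIV_cos]]) simp
  qed (intro continuous_intros)+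
  then show ?thesis by (simp add: power2_eq_square mult_ac)
qed

lemma jacobi_eigenvalue_strict_mono:
  assumes "a \<ge> - 1 / 2" "b \<ge> - 1 / 2" "m < n"
  shows "jacobi_eigenvalue a b m < jacobi_eigenvalue a b n"
  unfolding jacobi_eigenvalue_def using assms by (intro mult_strict_mono') auto

lemma jacobi_eigenvalue_ge:
  assumes "a \<ge> - 1 / 2" "b \<ge> - 1 / 2"
  shows "(real n)\<^sup>2 \<le> jacobi_eigenvalue a b n"
  unfolding jacobi_eigenvalue_def power2_eq_square using assms by (intro mult_left_mono) auto

lemma jacobi_poly_orthogonal:
  assumes ab: "a \<ge> - 1 / 2" "b \<ge> - 1 / 2" and "m \<noteq> n"
  shows "(\<integral>\<theta>. poly (jacobi_poly a b m) (cos \<theta>) * poly (jacobi_poly a b n) (cos \<theta>) \<partial>mu1 a b) = 0"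
proof -
  let ?P = "\<lambda>n \<theta>. poly (jacobi_poly a b n) (cos \<theta>)"
  have "- jacobi_eigenvalue a b m * (\<integral>\<theta>. ?P m \<theta> * ?P n \<theta> \<partial>mu1 a b)
      = - jacobi_eigenvalue a b n * (\<integral>\<theta>. ?P n \<theta> * ?P m \<theta> \<partial>mu1 a b)"
    using jacobi_op_symmetric[OF ab, of "jacobi_poly a b m" "jacobi_poly a b n"]
      jacobi_op_symmetric[OF ab, of "jacobi_poly a b n" "jacobi_poly a b m"]
    by (simp add: jacobi_op_jacobi_poly mult_ac)
  then have "(jacobi_eigenvalue a b m - jacobi_eigenvalue a b n) * (\<integral>\<theta>. ?P m \<theta> * ?P n \<theta> \<partial>mu1 a b) = 0"
    by (simp add: mult.commute algebra_simps)
  moreover have "jacobi_eigenvalue a b m \<noteq> jacobi_eigenvalue a b n"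
    using jacobi_eigenvalue_strict_mono[OF ab] \<open>m \<noteq> n\<close> by (metis less_irrefl linorder_neqE_nat)
  ultimately show ?thesis by simp
qed

section \<open>Size of the Jacobi polynomials and of their norms\<close>

lemma jacobi_weight_Suc:
  assumes "\<theta> \<in> {0..pi}"
  shows "jacobi_weight a b \<theta> * (sin \<theta>)\<^sup>2 = 4 * jacobi_weight (a + 1) (b + 1) \<theta>"
proof -
  have *: "x powr (2 * c + 1) * x\<^sup>2 = x powr (2 * (c + 1) + 1)" if "x \<ge> 0" for x c :: real
  proof (cases "x = 0")
    case False
    then have "x powr (2 * c + 1) * x\<^sup>2 = x powr (2 * c + 1) * x powr 2" using that by simp
    also have "\<dots> = x powr (2 * c + 1 + 2)" by (rule powr_add[symmetric])
    also have "2 * c + 1 + 2 = 2 * (c + 1) + 1" by simp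
    finally show ?thesis .
  qed simp
  have "sin \<theta> = 2 * sin (\<theta> / 2) * cos (\<theta> / 2)" using sin_double[of "\<theta> / 2"] by simp
  then have "jacobi_weight a b \<theta> * (sin \<theta>)\<^sup>2 =
      4 * ((sin (\<theta> / 2) powr (2 * a + 1) * (sin (\<theta> / 2))\<^sup>2) * (cos (\<theta> / 2) powr (2 * b
          + 1) * (cos (\<theta> / 2))\<^sup>2))"
    by (simp add: jacobi_weight_def power_mult_distrib mult_ac)
  then show ?thesis
    unfolding jacobi_weight_def using *[OF sin_cos_half_nonneg(1)[OF assms]] *[OF
        sin_cos_half_nonneg(2)[OF assms]] by simp
qed

text \<open>The squared sine produced by integration by parts raises both parameters by one, which
  permits induction on the degree with moving parameters.\<close>

lemma integral_mu1_Suc: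
  fixes f :: "real \<Rightarrow> real"
  assumes "continuous_on {0..pi} f"
  shows "(\<integral>\<theta>. (sin \<theta>)\<^sup>2 * f \<theta> \<partial>mu1 a b) = 4 * (\<integral>\<theta>. f \<theta> \<partial>mu1 (a + 1) (b + 1))"
proof -
  have "(\<integral>\<theta>. (sin \<theta>)\<^sup>2 * f \<theta> \<partial>mu1 a b) = (LBINT \<theta>:{0..pi}. jacobi_weight a b \<theta> * ((sin \<theta>)\<^sup>2 * f \<theta>))"
    by (intro integral_mu1 borel_measurable_mu1_continuous continuous_intros assms)
  also have "\<dots> = (LBINT \<theta>:{0..pi}. 4 * (jacobi_weight (a + 1) (b + 1) \<theta> * f \<theta>))"
    by (intro set_lebesgue_integral_cong) (auto simp: jacobi_weight_Suc mult.assoc[symmetric])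
  also have "\<dots> = 4 * (\<integral>\<theta>. f \<theta> \<partial>mu1 (a + 1) (b + 1))"
    by (subst integral_mu1(1)) (auto intro!: borel_measurable_mu1_continuous assms)
  finally show ?thesis .
qed

text \<open>Integration by parts equates the norm at degree n + 1 with 4 c times the norm at degree
  n for parameters a + 1, b + 1, where c is the eigenvalue; A and B are unchanged. Dropping the
  factors 4 c >= 1 down to degree 0 leaves a total mass. This is crude, but exp (- t n^2) absorbs
  the loss.\<close>

lemma rodrigues_poly_norm_ge:
  assumes "a \<ge> - 1 / 2" "b \<ge> - 1 / 2"
  shows "(\<integral>\<theta>. (poly (rodrigues_poly (a + real n) (b + real n) n) (cos \<theta>))\<^sup>2 \<partial>mu1 a b) \<ge>
    measure (mu1 (a + real n) (b + real n)) {0..pi}"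
  using assms
proof (induction n arbitrary: a b)
  case 0 then show ?case by simp
next
  case (Suc n)
  let ?A = "a + real (Suc n)" and ?B = "b + real (Suc n)"
  define q where "q = rodrigues_poly ?A ?B"
  define c where "c = jacobi_eigenvalue a b (Suc n)"
  have c: "c \<ge> 1" using jacobi_eigenvalue_ge[OF Suc.prems, of "Suc n"] unfolding c_def
    by (rule order_trans[rotated]) (rule one_le_power, simp)
  have d: "pderiv (q (Suc n)) = smult (- c) (q n)"
    unfolding q_def c_def pderiv_rodrigues_poly by (simp add: jacobi_eigenvalue_def algebra_simps)
  have op: "jacobi_op a b (q (Suc n)) = smult (- c) (q (Suc n))"
    unfolding q_def c_def by (rule jacobi_op_rodrigues_poly)
  have "- c * (\<integral>\<theta>. (poly (q (Suc n)) (cos \<theta>))\<^sup>2 \<partial>mu1 a b)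
      = - (c\<^sup>2 * (\<integral>\<theta>. (sin \<theta>)\<^sup>2 * (poly (q n) (cos \<theta>))\<^sup>2 \<partial>mu1 a b))"
    using jacobi_op_symmetric[OF Suc.prems, of "q (Suc n)" "q (Suc n)"]
    unfolding d op by (simp add: power2_eq_square mult_ac)
  then have "(\<integral>\<theta>. (poly (q (Suc n)) (cos \<theta>))\<^sup>2 \<partial>mu1 a b)
      = c * (\<integral>\<theta>. (sin \<theta>)\<^sup>2 * (poly (q n) (cos \<theta>))\<^sup>2 \<partial>mu1 a b)"
    using c by (simp add: power2_eq_square)
  also have "\<dots> = (4 * c) * (\<integral>\<theta>. (poly (q n) (cos \<theta>))\<^sup>2 \<partial>mu1 (a + 1) (b + 1))"
    by (subst integral_mu1_Suc) (auto intro!: continuous_intros)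
  finally have "(\<integral>\<theta>. (poly (q (Suc n)) (cos \<theta>))\<^sup>2 \<partial>mu1 a b)
      = (4 * c) * (\<integral>\<theta>. (poly (q n) (cos \<theta>))\<^sup>2 \<partial>mu1 (a + 1) (b + 1))" .
  moreover have "1 * (\<integral>\<theta>. (poly (q n) (cos \<theta>))\<^sup>2 \<partial>mu1 (a + 1) (b + 1))
      \<le> (4 * c) * (\<integral>\<theta>. (poly (q n) (cos \<theta>))\<^sup>2 \<partial>mu1 (a + 1) (b + 1))"
    using c by (intro mult_right_mono) auto
  moreover have "measure (mu1 ?A ?B) {0..pi} \<le> (\<integral>\<theta>. (poly (q n) (cos \<theta>))\<^sup>2 \<partial>mu1 (a + 1) (b + 1))"
    using Suc.IH[of "a + 1" "b + 1"] Suc.prems unfolding q_def by (simp add: algebra_simps)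
  ultimately show ?case unfolding q_def by linarith
qed

text \<open>On the middle third of [0, pi] both sin (\<theta> / 2) and cos (\<theta> / 2) are at
  least 1 / 2.\<close>

lemma measure_mu1_ge:
  assumes ab: "a \<ge> - 1 / 2" "b \<ge> - 1 / 2"
  shows "measure (mu1 a b) {0..pi} \<ge> pi / 3 * (1 / 2) powr (2 * a + 2 * b + 2)"
proof -
  interpret finite_measure "mu1 a b" by (rule finite_measure_mu1[OF ab])
  let ?w = "(1 / 2 :: real) powr (2 * a + 2 * b + 2)"
  have "{0..pi} \<in> sets (mu1 a b)" using sets.top[of "mu1 a b"] by simp
  then have "measure (mu1 a b) {0..pi} = (\<integral>\<theta>. 1 \<partial>mu1 a b)" by simp
  also have "\<dots> = (LBINT \<theta>:{0..pi}. jacobi_weight a b \<theta> * 1)" by (rule integral_mu1) simp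
  finally have eq: "measure (mu1 a b) {0..pi} = (LBINT \<theta>:{0..pi}. jacobi_weight a b \<theta> * 1)" .
  have le: "(LBINT \<theta>:{0..pi}. jacobi_weight a b \<theta> * 1) \<ge> (LBINT \<theta>:{0..pi}. ?w * indicator {pi/3..2*pi/3} \<theta>)"
  proof (rule set_integral_mono)
    have "integrable lborel (\<lambda>\<theta>. ?w * indicator ({0..pi} \<inter> {pi/3..2*pi/3}) \<theta> :: real)"
      by (intro integrable_mult_right) simp
    then show "set_integrable lborel {0..pi} (\<lambda>\<theta>. ?w * indicator {pi/3..2*pi/3} \<theta>)"
      unfolding set_integrable_def indicator_inter_arith by (simp only: real_scaleR_def mult.left_commute)
    show "set_integrable lborel {0..pi} (\<lambda>\<theta>. jacobi_weight a b \<theta> * 1)"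
      using integral_mu1(2)[of "\<lambda>_. 1" a b] by simp
    fix \<theta> assume t: "\<theta> \<in> {0..pi}"
    show "?w * indicator {pi/3..2*pi/3} \<theta> \<le> jacobi_weight a b \<theta> * 1"
    proof (cases "\<theta> \<in> {pi/3..2*pi/3}")
      case True
      have "sin (pi / 6) \<le> sin (\<theta> / 2)" using True pi_gt_zero by (intro sin_monotone_2pi_le) auto
      moreover have "cos (pi / 3) \<le> cos (\<theta> / 2)" using True pi_gt_zero by (intro cos_monotone_0_pi_le) auto
      ultimately have "1 / 2 \<le> sin (\<theta> / 2)" "1 / 2 \<le> cos (\<theta> / 2)" by (simp_all add: sin_30 cos_60)
      then have "(1 / 2) powr (2 * a + 1) * (1 / 2) powr (2 * b + 1) \<le> jacobi_weight a b \<theta>"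
        unfolding jacobi_weight_def using ab by (intro mult_mono powr_mono2) auto
      then show ?thesis using True by (simp flip: powr_add add: algebra_simps)
    qed auto
  qed
  have "(LBINT \<theta>:{0..pi}. ?w * indicator {pi/3..2*pi/3} \<theta>)
      = (\<integral>\<theta>. ?w * indicator ({0..pi} \<inter> {pi/3..2*pi/3}) \<theta> \<partial>lborel)"
    unfolding set_lebesgue_integral_def indicator_inter_arith
        by (simp only: real_scaleR_def mult.left_commute)
  also have "\<dots> = ?w * (\<integral>\<theta>. indicator ({0..pi} \<inter> {pi/3..2*pi/3}) \<theta> \<partial>lborel)"
    by (rule integral_mult_right_zero)
  also have "{0..pi} \<inter> {pi/3..2*pi/3} = {pi/3..2*pi/3}" using pi_gt_zero by auto
  also have "(\<integral>\<theta>. indicator {pi/3..2*pi/3} \<theta> \<partial>lborel) = pi / 3" using pi_gt_zero by (simp add: field_simps)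
  finally have v: "(LBINT \<theta>:{0..pi}. ?w * indicator {pi/3..2*pi/3} \<theta>) = ?w * (pi / 3)" .
  show ?thesis using le unfolding eq v by (simp only: mult.commute)
qed

text \<open>The derivative in the recursion is a multiple of the polynomial of index k - 2, so
  values alone suffice. R is such that the linear factor is at most R / 2 and that multiple at most
  R^2 / 8; the sum 1 / 2 + 1 / 8 stays below 1.\<close>

lemma rodrigues_poly_bound:
  fixes a b :: real
  assumes x: "x \<in> {-1..1}" and k: "k \<le> n"
  defines "R \<equiv> 4 * (real n + \<bar>a\<bar> + \<bar>b\<bar> + 1)"
  shows "\<bar>poly (rodrigues_poly (a + real n) (b + real n) k) x\<bar> \<le> R ^ k"
  using k
proof (induction k rule: less_induct)
  case (less k)
  let ?q = "\<lambda>k. poly (rodrigues_poly (a + real n) (b + real n) k) x"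
  have lin: "\<bar>poly [:(b + real n) - (a + real n), 2 * real j - (a + real n) - (b + real n):] x\<bar>
      \<le> R / 2" if "j \<le> n" for j
  proof -
    have "poly [:(b + real n) - (a + real n), 2 * real j - (a + real n) - (b + real n):] x
        = (b + real n - real j) * (1 - x) - (a + real n - real j) * (1 + x)"
      by (simp add: algebra_simps)
    also have "\<bar>\<dots>\<bar> \<le> \<bar>b + real n - real j\<bar> * (1 - x) + \<bar>a + real n - real j\<bar> * (1 + x)"
      using x by (intro order_trans[OF abs_triangle_ineq4]) (auto simp: abs_mult)
    also have "\<dots> \<le> (real n + \<bar>a\<bar> + \<bar>b\<bar> + 1) * (1 - x) + (real n + \<bar>a\<bar> + \<bar>b\<bar> + 1) * (1 + x)"
      using x that by (intro add_mono mult_right_mono) auto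
    also have "\<dots> = R / 2" unfolding R_def by (simp add: algebra_simps)
    finally show ?thesis .
  qed
  have R: "R \<ge> 4" unfolding R_def by simp
  show ?case
  proof (cases k)
    case 0 then show ?thesis by simp
  next
    case (Suc m)
    show ?thesis
    proof (cases m)
      case 0
      then show ?thesis using Suc lin[of 0] less.prems R by simp
    next
      case (Suc j)
      note k = \<open>k = Suc m\<close> Suc
      have d: "\<bar>poly (pderiv (rodrigues_poly (a + real n) (b + real n) m)) x\<bar> \<le> R\<^sup>2 / 8 * R ^ j"
      proof -
        have "\<bar>- (real (Suc j) * (a + real n + (b + real n) - real j))\<bar> \<le> (real n + \<bar>a\<bar> + \<bar>b\<bar>
            + 1) * (2 * (real n + \<bar>a\<bar> + \<bar>b\<bar> + 1))"
          unfolding abs_minus_cancel abs_mult using k less.prems by (intro mult_mono) auto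
        also have "\<dots> = R\<^sup>2 / 8" unfolding R_def by (simp add: power2_eq_square algebra_simps)
        finally have *: "\<bar>- (real (Suc j) * (a + real n + (b + real n) - real j))\<bar> \<le> R\<^sup>2 / 8" .
        have "\<bar>?q j\<bar> \<le> R ^ j" using less k by simp
        then show ?thesis unfolding k(2) pderiv_rodrigues_poly poly_smult abs_mult
          using * by (intro mult_mono) auto
      qed
      have "?q k = poly [:(b + real n) - (a + real n), 2 * real m - (a + real n) - (b + real n):] x * ?q m
          + (1 - x\<^sup>2) * poly (pderiv (rodrigues_poly (a + real n) (b + real n) m)) x"
        unfolding k(1) by (simp add: power2_eq_square algebra_simps)
      also have "\<bar>\<dots>\<bar> \<le> R / 2 * R ^ m + 1 * (R\<^sup>2 / 8 * R ^ j)"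
      proof (intro order_trans[OF abs_triangle_ineq] add_mono, unfold abs_mult)
        show "\<bar>poly [:(b + real n) - (a + real n), 2 * real m - (a + real n) - (b
            + real n):] x\<bar> * \<bar>?q m\<bar> \<le> R / 2 * R ^ m"
          using R less.prems k by (intro mult_mono lin less.IH) (auto simp del: rodrigues_poly.simps)
        have "x\<^sup>2 \<le> 1" using x by (intro abs_square_le_1[THEN iffD2]) auto
        then show "\<bar>1 - x\<^sup>2\<bar> * \<bar>poly (pderiv (rodrigues_poly (a + real n) (b + real n) m)) x\<bar>
            \<le> 1 * (R\<^sup>2 / 8 * R ^ j)"
          by (intro mult_mono d) auto
      qed
      also have "\<dots> = R ^ k * (5 / 8)" unfolding k by (simp add: power2_eq_square)
      also have "\<dots> \<le> R ^ k * 1" using R by (intro mult_left_mono) auto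
      finally show ?thesis by simp
    qed
  qed
qed

definition jacobi_norm :: "real \<Rightarrow> real \<Rightarrow> nat \<Rightarrow> real" where
  "jacobi_norm a b n = (\<integral>\<theta>. (poly (jacobi_poly a b n) (cos \<theta>))\<^sup>2 \<partial>mu1 a b)"

text \<open>The factors 2^n n! cancel between the product of two values and the norm, leaving the
  square of the bound on values over the lower bound on the norm. 16 is the 4 in R times the 4 from
  (1 / 4)^n.\<close>

definition jacobi_bound :: "real \<Rightarrow> real \<Rightarrow> nat \<Rightarrow> real" where
  "jacobi_bound a b n = 3 / pi * 2 powr (2 * a + 2 * b + 2) * ((16 * (real n + \<bar>a\<bar> + \<bar>b\<bar> + 1)) ^ n)\<^sup>2"

lemma jacobi_norm_eq:
  "jacobi_norm a b n = (1 / (2 ^ n * fact n))\<^sup>2 *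
     (\<integral>\<theta>. (poly (rodrigues_poly (a + real n) (b + real n) n) (cos \<theta>))\<^sup>2 \<partial>mu1 a b)"
  unfolding jacobi_norm_def jacobi_poly_eq_rodrigues
  by (simp add: power_mult_distrib power_divide power_even_eq[symmetric])

lemma rodrigues_poly_norm_ge':
  assumes ab: "a \<ge> - 1 / 2" "b \<ge> - 1 / 2"
  shows "(\<integral>\<theta>. (poly (rodrigues_poly (a + real n) (b + real n) n) (cos \<theta>))\<^sup>2 \<partial>mu1 a b) \<ge>
    pi / 3 * (1 / 2) powr (2 * a + 2 * b + 2) * ((1 / 4) ^ n)\<^sup>2"
proof -
  have "pi / 3 * (1 / 2) powr (2 * a + 2 * b + 2) * ((1 / 4) ^ n)\<^sup>2
      = pi / 3 * (1 / 2) powr (2 * (a + real n) + 2 * (b + real n) + 2)"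
  proof -
    have "(1 / 2) powr (2 * (a + real n) + 2 * (b + real n) + 2) = (1 / 2) powr (2 * a + 2 * b
        + 2) * (1 / 2) powr (real (4 * n))"
      by (simp flip: powr_add add: algebra_simps)
    also have "(1 / 2 :: real) powr (real (4 * n)) = (1 / 2) ^ (4 * n)" by (rule powr_realpow) simp
    also have "(1 / 2 :: real) ^ (4 * n) = ((1 / 2) ^ 4) ^ n" by (rule power_mult)
    also have "(1 / 2 :: real) ^ 4 = 1 / 4 * (1 / 4)" by (simp add: power_divide)
    also have "\<dots> ^ n = ((1 / 4) ^ n)\<^sup>2" by (simp only: power2_eq_square power_mult_distrib)
    finally show ?thesis by simp
  qed
  also have "\<dots> \<le> measure (mu1 (a + real n) (b + real n)) {0..pi}"
    using ab by (intro measure_mu1_ge) auto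
  also note rodrigues_poly_norm_ge[OF ab, of n]
  finally show ?thesis .
qed

lemma jacobi_norm_pos:
  assumes "a \<ge> - 1 / 2" "b \<ge> - 1 / 2"
  shows "jacobi_norm a b n > 0"
  unfolding jacobi_norm_eq
  by (intro mult_pos_pos less_le_trans[OF _ rodrigues_poly_norm_ge'] assms) auto

lemma jacobi_poly_product_bound:
  assumes ab: "a \<ge> - 1 / 2" "b \<ge> - 1 / 2" and "x \<in> {-1..1}" "y \<in> {-1..1}"
  shows "\<bar>poly (jacobi_poly a b n) x * poly (jacobi_poly a b n) y / jacobi_norm a b n\<bar> \<le> jacobi_bound a b n"
proof -
  let ?q = "poly (rodrigues_poly (a + real n) (b + real n) n)"
  let ?N = "\<integral>\<theta>. (?q (cos \<theta>))\<^sup>2 \<partial>mu1 a b"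
  let ?R = "4 * (real n + \<bar>a\<bar> + \<bar>b\<bar> + 1)"
  let ?c = "pi / 3 * (1 / 2) powr (2 * a + 2 * b + 2) * ((1 / 4) ^ n)\<^sup>2 :: real"
  have sq: "((- 1) ^ n / (2 ^ n * fact n)) * ((- 1) ^ n / (2 ^ n * fact n))
      = (1 / (2 ^ n * fact n) :: real)\<^sup>2"
    by (simp only: power2_eq_square times_divide_times_eq power_mult_distrib[symmetric]) simp
  have "poly (jacobi_poly a b n) x * poly (jacobi_poly a b n) y / jacobi_norm a b n
     = (((- 1) ^ n / (2 ^ n * fact n)) * ((- 1) ^ n / (2 ^ n * fact n)) * (?q x * ?q y)) / ((1 / (2 ^ n
         * fact n))\<^sup>2 * ?N)"
    unfolding jacobi_norm_eq by (simp add: jacobi_poly_eq_rodrigues)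
  also have "\<dots> = ?q x * ?q y / ?N" unfolding sq by simp
  also have "\<bar>\<dots>\<bar> = \<bar>?q x\<bar> * \<bar>?q y\<bar> / ?N" by (simp add: abs_mult)
  also have "\<dots> \<le> ?R ^ n * ?R ^ n / ?c"
    using rodrigues_poly_bound[of x n n a b] rodrigues_poly_bound[of y n n a b]
        rodrigues_poly_norm_ge'[OF ab, of n] assms(3,4)
    by (intro frac_le mult_mono) auto
  also have "\<dots> = jacobi_bound a b n"
  proof -
    have "(16 * (real n + \<bar>a\<bar> + \<bar>b\<bar> + 1)) ^ n = (?R / (1 / 4)) ^ n" by simp
    also have "\<dots> = ?R ^ n / (1 / 4) ^ n" by (rule power_divide)
    finally have e: "(16 * (real n + \<bar>a\<bar> + \<bar>b\<bar> + 1)) ^ n = ?R ^ n / (1 / 4) ^ n" .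
    have h: "(1 / 2 :: real) powr (2 * a + 2 * b + 2) = 1 / 2 powr (2 * a + 2 * b + 2)"
      by (subst powr_divide) auto
    show ?thesis unfolding jacobi_bound_def e h power_divide[of "?R ^ n"] by (simp add: power2_eq_square)
  qed
  finally show ?thesis .
qed

text \<open>The bound grows like a constant to the n times n^(2 n), which loses to exp (t n^2): once
  16 (n + D) is below exp (t n / 4), its power 2 n is below exp (t n^2 / 2).\<close>

lemma summable_jacobi_bound:
  assumes "t > 0"
  shows "summable (\<lambda>n. exp (- t * (real n)\<^sup>2) * jacobi_bound a b n)"
proof -
  define D where "D = \<bar>a\<bar> + \<bar>b\<bar> + 1"
  define c where "c = 3 / pi * 2 powr (2 * a + 2 * b + 2)"
  have D: "D \<ge> 1" unfolding D_def by simp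
  \<comment> \<open>Makes 16 (1 + D) n at most (t n / 4)^2 / 2 for n >= N; the latter is a term of
    the exponential series at t n / 4.\<close>
  obtain N where N: "real N \<ge> 16 * (1 + D) * 32 / t\<^sup>2" "N \<ge> 1"
    using real_arch_simple[of "max 1 (16 * (1 + D) * 32 / t\<^sup>2)"] by auto
  show ?thesis
  proof (rule summable_comparison_test_ev)
    show "summable (\<lambda>n. c * exp (- t / 2) ^ n)"
      using assms by (intro summable_mult summable_geometric) auto
    show "eventually (\<lambda>n. norm (exp (- t * (real n)\<^sup>2) * jacobi_bound a b n)
        \<le> c * exp (- t / 2) ^ n) sequentially"
    proof (rule eventually_sequentiallyI)
      fix n assume n: "n \<ge> N"
      have n1: "real n \<ge> 1" "real n \<ge> 16 * (1 + D) * 32 / t\<^sup>2" using n N by auto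
      have "16 * (real n + D) \<le> 16 * (1 + D) * real n"
        using mult_left_mono[OF n1(1), of D] D by (simp add: algebra_simps)
      also have "\<dots> \<le> (real n * t\<^sup>2 / 32) * real n"
        using n1 assms by (intro mult_right_mono) (auto simp: field_simps)
      also have "\<dots> = (t * real n / 4)\<^sup>2 / 2" by (simp add: power2_eq_square)
      also have "\<dots> \<le> exp (t * real n / 4)"
      proof -
        have y: "0 \<le> t * real n / 4" using assms by simp
        show ?thesis using exp_lower_Taylor_quadratic[OF y] y by linarith
      qed
      finally have "(16 * (real n + D)) ^ n \<le> exp (t * real n / 4) ^ n"
        using D by (intro power_mono) auto
      also have "\<dots> = exp (t * (real n)\<^sup>2 / 4)"
        unfolding exp_of_nat_mult[symmetric] by (simp add: power2_eq_square)
      finally have "((16 * (real n + D)) ^ n)\<^sup>2 \<le> (exp (t * (real n)\<^sup>2 / 4))\<^sup>2"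
        using D by (intro power_mono) auto
      also have "\<dots> = exp (t * (real n)\<^sup>2 / 2)"
        unfolding exp_double[symmetric] by simp
      finally have "exp (- t * (real n)\<^sup>2) * jacobi_bound a b n
          \<le> exp (- t * (real n)\<^sup>2) * (c * exp (t * (real n)\<^sup>2 / 2))"
        unfolding jacobi_bound_def c_def D_def
        by (intro mult_left_mono) (auto simp: add.assoc)
      also have "\<dots> = c * exp (- t / 2 * (real n)\<^sup>2)"
      proof -
        have "exp (- t * (real n)\<^sup>2) * exp (t * (real n)\<^sup>2 / 2) = exp (- t / 2 * (real n)\<^sup>2)"
          unfolding exp_add[symmetric] by (simp add: field_simps)
        then show ?thesis by (metis mult.left_commute)
      qed
      also have "\<dots> \<le> c * exp (- t / 2 * real n)"
        using n1 assms unfolding c_def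
        by (intro mult_left_mono) (auto simp: power2_eq_square intro!: mult_left_mono)
      also have "\<dots> = c * exp (- t / 2) ^ n"
        unfolding exp_of_nat_mult[symmetric] by (simp add: mult.commute)
      finally show "norm (exp (- t * (real n)\<^sup>2) * jacobi_bound a b n) \<le> c * exp (- t / 2) ^ n"
        by (simp add: jacobi_bound_def)
    qed
  qed
qed

section \<open>The Jacobi heat kernel\<close>

locale jacobi =
  fixes a b :: real
  assumes a_ge: "a \<ge> - 1 / 2" and b_ge: "b \<ge> - 1 / 2"
begin

abbreviation "\<mu> \<equiv> mu1 a b"
abbreviation "P n \<equiv> jacobi_poly a b n"
abbreviation "ev n \<equiv> jacobi_eigenvalue a b n"
abbreviation "nrm n \<equiv> jacobi_norm a b n"

sublocale finite_measure \<mu>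
  by (rule finite_measure_mu1[OF a_ge b_ge])

text \<open>The heat kernel with respect to \<open>mu1\<close>, with cosines as arguments. The three
  kernels of the theorem differ from it by explicit factors only, so the analysis is done here
  once.\<close>

definition kernel :: "real \<Rightarrow> real \<Rightarrow> real \<Rightarrow> real" where
  "kernel t x y = (\<Sum>n. exp (- t * ev n) * (poly (P n) x * poly (P n) y / nrm n))"

definition kernel_bound :: "real \<Rightarrow> real" where
  "kernel_bound t = (\<Sum>n. exp (- t * (real n)\<^sup>2) * jacobi_bound a b n)"

lemma jacobi_bound_nonneg: "0 \<le> jacobi_bound a b n"
  by (simp add: jacobi_bound_def)

lemma kernel_term_bound:
  assumes "t \<ge> t0" "t0 > 0" "x \<in> {-1..1}" "y \<in> {-1..1}"
  shows "\<bar>exp (- t * ev n) * (poly (P n) x * poly (P n) y / nrm n)\<bar>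
      \<le> exp (- t0 * (real n)\<^sup>2) * jacobi_bound a b n"
proof -
  have "t0 * (real n)\<^sup>2 \<le> t * ev n"
    using assms jacobi_eigenvalue_ge[OF a_ge b_ge, of n] by (intro mult_mono) auto
  then have "exp (- t * ev n) \<le> exp (- t0 * (real n)\<^sup>2)" by simp
  then show ?thesis
    unfolding abs_mult[of "exp _"] using jacobi_poly_product_bound[OF a_ge b_ge assms(3,4), of n]
    by (intro mult_mono) auto
qed

lemma summable_kernel_abs:
  assumes "t > 0" "x \<in> {-1..1}" "y \<in> {-1..1}"
  shows "summable (\<lambda>n. \<bar>exp (- t * ev n) * (poly (P n) x * poly (P n) y / nrm n)\<bar>)"
  by (rule summable_comparison_test'[OF summable_jacobi_bound[OF assms(1), of a b], of 0])
     (use kernel_term_bound[of t t x y] assms in auto)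

lemma summable_kernel:
  assumes "t > 0" "x \<in> {-1..1}" "y \<in> {-1..1}"
  shows "summable (\<lambda>n. exp (- t * ev n) * (poly (P n) x * poly (P n) y / nrm n))"
  by (rule summable_rabs_cancel[OF summable_kernel_abs[OF assms]])

lemma abs_kernel_le:
  assumes "t \<ge> t0" "t0 > 0" "x \<in> {-1..1}" "y \<in> {-1..1}"
  shows "\<bar>kernel t x y\<bar> \<le> kernel_bound t0"
proof -
  have "t > 0" using assms by simp
  have "\<bar>kernel t x y\<bar> \<le> (\<Sum>n. \<bar>exp (- t * ev n) * (poly (P n) x * poly (P n) y / nrm n)\<bar>)"
    unfolding kernel_def by (rule summable_rabs[OF summable_kernel_abs[OF \<open>t > 0\<close> assms(3,4)]])
  also have "\<dots> \<le> kernel_bound t0"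
    unfolding kernel_bound_def
    by (intro suminf_le kernel_term_bound assms summable_kernel_abs summable_jacobi_bound \<open>t > 0\<close>)
  finally show ?thesis .
qed

lemma kernel_sym: "kernel t x y = kernel t y x"
  unfolding kernel_def by (simp add: mult.commute)

lemma kernel_measurable_borel [measurable]:
  "(\<lambda>z. kernel t (fst z) (snd z)) \<in> borel_measurable (borel \<Otimes>\<^sub>M borel)"
proof -
  have [measurable]: "poly (P n) \<in> borel_measurable borel" for n
    by (intro borel_measurable_continuous_onI continuous_intros)
  show ?thesis unfolding kernel_def by measurable
qed

lemma continuous_on_kernel:
  assumes "t0 > 0"
  shows "continuous_on ({t0..} \<times> {-1..1} \<times> {-1..1}) (\<lambda>z. kernel (fst z) (fst (snd z)) (snd (snd z)))"
proof -
  let ?f = "\<lambda>n z. exp (- fst z * ev n) * (poly (P n) (fst (snd z)) * poly (P n) (snd (snd z)) / nrm n)"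
  have "uniform_limit ({t0..} \<times> {-1..1} \<times> {-1..1}) (\<lambda>n z. \<Sum>i<n. ?f i z) (\<lambda>z. \<Sum>i. ?f i z) sequentially"
  proof (rule Weierstrass_m_test[OF _ summable_jacobi_bound[OF assms]])
    fix n z assume "z \<in> {t0..} \<times> {-1..1::real} \<times> {-1..1::real}"
    then show "norm (?f n z) \<le> exp (- t0 * (real n)\<^sup>2) * jacobi_bound a b n"
      unfolding real_norm_def by (intro kernel_term_bound assms) auto
  qed
  moreover have "continuous_on ({t0..} \<times> {-1..1} \<times> {-1..1}) (\<lambda>z. \<Sum>i<n. ?f i z)" for n
    using jacobi_norm_pos[OF a_ge b_ge]
    by (intro continuous_intros) (auto simp: less_imp_neq[THEN not_sym])
  ultimately show ?thesis
    unfolding kernel_def by (intro uniform_limit_theorem[where F=sequentially]) auto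
qed

lemma continuous_on_kernel_time:
  assumes "x \<in> {-1..1}" "y \<in> {-1..1}"
  shows "continuous_on {0<..} (\<lambda>t. kernel t x y)"
proof (rule continuous_at_imp_continuous_on, rule ballI)
  fix t :: real assume t: "t \<in> {0<..}"
  then have "t / 2 > 0" by simp
  have c: "continuous_on {t/2..} (\<lambda>t. (t, x, y))" by (intro continuous_intros)
  have "(\<lambda>t. (t, x, y)) ` {t/2..} \<subseteq> {t/2..} \<times> {-1..1} \<times> {-1..1}" using assms by auto
  then have "continuous_on {t/2..} (\<lambda>t. kernel t x y)"
    using continuous_on_compose2[OF continuous_on_kernel[OF \<open>t / 2 > 0\<close>] c] by simp
  then show "isCont (\<lambda>t. kernel t x y) t"
    using t by (intro continuous_on_interior) auto
qed

lemma continuous_on_kernel_space: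
  assumes "t > 0" "x \<in> {-1..1}"
  shows "continuous_on {-1..1} (kernel t x)"
proof -
  have "continuous_on {-1..1} (\<lambda>y. (t, x, y))" by (intro continuous_intros)
  moreover have "(\<lambda>y. (t, x, y)) ` {-1..1} \<subseteq> {t..} \<times> {-1..1} \<times> {-1..1}" using assms by auto
  ultimately show ?thesis using continuous_on_compose2[OF continuous_on_kernel[OF assms(1)]] by fastforce
qed

lemma continuous_on_kernel_cos:
  assumes "t > 0" "x \<in> {-1..1}"
  shows "continuous_on A (\<lambda>\<theta>. kernel t x (cos \<theta>))"
  by (rule continuous_on_compose2[OF continuous_on_kernel_space[OF assms]])
     (auto intro!: continuous_intros)

lemma integral_kernel_mult:
  assumes "t > 0" "x \<in> {-1..1}" "continuous_on {0..pi} g"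
  shows "(\<integral>\<theta>. kernel t x (cos \<theta>) * g \<theta> \<partial>\<mu>) =
    (\<Sum>n. exp (- t * ev n) * (poly (P n) x / nrm n) * (\<integral>\<theta>. poly (P n) (cos \<theta>) * g \<theta> \<partial>\<mu>))"
proof -
  let ?f = "\<lambda>n \<theta>. exp (- t * ev n) * (poly (P n) x / nrm n) * (poly (P n) (cos \<theta>) * g \<theta>)"
  have "compact (g ` {0..pi})" by (intro compact_continuous_image assms) auto
  then obtain B where B: "\<And>x. x \<in> {0..pi} \<Longrightarrow> \<bar>g x\<bar> \<le> B"
    using compact_imp_bounded bounded_iff by (metis image_eqI real_norm_def)
  have fe: "?f n \<theta> = exp (- t * ev n) * (poly (P n) x * poly (P n) (cos \<theta>) / nrm n) * g \<theta>" for n \<theta> by simp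
  have int: "integrable \<mu> (?f n)" for n
    by (intro integrable_mult_right integrable_mu1_poly a_ge b_ge assms)
  have sm: "summable (\<lambda>n. \<bar>?f n \<theta>\<bar>)" for \<theta>
    unfolding fe abs_mult[of _ "g \<theta>"] using assms by (intro summable_mult2 summable_kernel_abs) auto
  have "kernel t x (cos \<theta>) * g \<theta> = (\<Sum>n. ?f n \<theta>)" for \<theta>
    unfolding kernel_def fe using assms by (intro suminf_mult2 summable_kernel) auto
  then have "(\<integral>\<theta>. kernel t x (cos \<theta>) * g \<theta> \<partial>\<mu>) = (\<integral>\<theta>. (\<Sum>n. ?f n \<theta>) \<partial>\<mu>)" by simp
  also have "\<dots> = (\<Sum>n. \<integral>\<theta>. ?f n \<theta> \<partial>\<mu>)"
  proof (rule integral_suminf[OF int])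
    show "AE \<theta> in \<mu>. summable (\<lambda>n. norm (?f n \<theta>))" using sm by simp
    show "summable (\<lambda>n. \<integral>\<theta>. norm (?f n \<theta>) \<partial>\<mu>)"
    proof (rule summable_comparison_test'[where N=0])
      show "summable (\<lambda>n. exp (- t * (real n)\<^sup>2) * jacobi_bound a b n * (B * measure \<mu> {0..pi}))"
        by (intro summable_mult2 summable_jacobi_bound assms)
      fix n
      have "(\<integral>\<theta>. norm (?f n \<theta>) \<partial>\<mu>) \<le> (\<integral>\<theta>. exp (- t * (real n)\<^sup>2) * jacobi_bound a b n * B \<partial>\<mu>)"
      proof (rule integral_mono)
        show "integrable \<mu> (\<lambda>\<theta>. norm (?f n \<theta>))" by (intro integrable_norm int)
        fix \<theta> assume "\<theta> \<in> space \<mu>"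
        then show "norm (?f n \<theta>) \<le> exp (- t * (real n)\<^sup>2) * jacobi_bound a b n * B"
          unfolding fe real_norm_def abs_mult[of _ "g \<theta>"]
          using assms B jacobi_bound_nonneg by (intro mult_mono kernel_term_bound) auto
      qed simp
      then show "norm (\<integral>\<theta>. norm (?f n \<theta>) \<partial>\<mu>) \<le> exp (- t * (real n)\<^sup>2) * jacobi_bound a b n * (B *
          measure \<mu> {0..pi})"
        by (simp add: mult_ac)
    qed
  qed
  also have "\<dots> = (\<Sum>n. exp (- t * ev n) * (poly (P n) x / nrm n) * (\<integral>\<theta>. poly (P n) (cos \<theta>) * g \<theta> \<partial>\<mu>))"
    by simp
  finally show ?thesis .
qed

lemma integral_kernel_jacobi_poly:
  assumes "t > 0" "x \<in> {-1..1}"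
  shows "(\<integral>\<theta>. kernel t x (cos \<theta>) * poly (P n) (cos \<theta>) \<partial>\<mu>) = exp (- t * ev n) * poly (P n) x"
proof -
  have "(\<integral>\<theta>. kernel t x (cos \<theta>) * poly (P n) (cos \<theta>) \<partial>\<mu>) =
    (\<Sum>m. exp (- t * ev m) * (poly (P m) x / nrm m) * (\<integral>\<theta>. poly (P m) (cos \<theta>) * poly (P n) (cos \<theta>) \<partial>\<mu>))"
    by (intro integral_kernel_mult assms continuous_intros)
  also have "\<dots> = (\<Sum>m\<in>{n}. exp (- t * ev m) * (poly (P m) x / nrm m) * (\<integral>\<theta>. poly (P m) (cos \<theta>) * poly (P
      n) (cos \<theta>) \<partial>\<mu>))"
    by (rule suminf_finite) (auto simp: jacobi_poly_orthogonal[OF a_ge b_ge])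
  finally show ?thesis using jacobi_norm_pos[OF a_ge b_ge, of n]
    by (simp add: jacobi_norm_def power2_eq_square)
qed

lemma kernel_semigroup:
  assumes "t > 0" "s > 0" "x \<in> {-1..1}" "y \<in> {-1..1}"
  shows "(\<integral>\<theta>. kernel t x (cos \<theta>) * kernel s (cos \<theta>) y \<partial>\<mu>) = kernel (t + s) x y"
proof -
  have "(\<integral>\<theta>. kernel t x (cos \<theta>) * kernel s y (cos \<theta>) \<partial>\<mu>) =
    (\<Sum>n. exp (- t * ev n) * (poly (P n) x / nrm n) * (\<integral>\<theta>. poly (P n) (cos \<theta>) * kernel s y (cos \<theta>) \<partial>\<mu>))"
    by (intro integral_kernel_mult continuous_on_kernel_cos assms)
  also have "\<dots> = kernel (t + s) x y"
    unfolding kernel_def[of "t + s"]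
  proof (rule suminf_cong)
    fix n
    have i: "(\<integral>\<theta>. poly (P n) (cos \<theta>) * kernel s y (cos \<theta>) \<partial>\<mu>) = exp (- s * ev n) * poly (P n) y"
      using integral_kernel_jacobi_poly[OF assms(2,4), of n] by (simp add: mult.commute)
    have e: "exp (- (t + s) * ev n) = exp (- t * ev n) * exp (- s * ev n)"
      unfolding exp_add[symmetric] by (simp add: algebra_simps)
    show "exp (- t * ev n) * (poly (P n) x / nrm n) * (\<integral>\<theta>. poly (P n) (cos \<theta>) * kernel s y (cos \<theta>) \<partial>\<mu>)
        = exp (- (t + s) * ev n) * (poly (P n) x * poly (P n) y / nrm n)"
      unfolding i e by (simp only: times_divide_eq_left times_divide_eq_right mult_ac)
  qed
  finally show ?thesis by (simp add: kernel_sym[of s _ y])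
qed

lemma kernel_mass:
  assumes "t > 0" "x \<in> {-1..1}"
  shows "(\<integral>\<theta>. kernel t x (cos \<theta>) \<partial>\<mu>) = 1"
  using integral_kernel_jacobi_poly[OF assms, of 0] by (simp add: jacobi_eigenvalue_def)

text \<open>Solutions of the heat equation with polynomial initial data: polynomials in x at every
  time and smooth in t, also at t = 0, so that the maximum principle applies without regularity
  questions.\<close>

definition flow :: "(nat \<Rightarrow> real) \<Rightarrow> nat \<Rightarrow> real \<Rightarrow> real poly" where
  "flow c N t = (\<Sum>n\<le>N. smult (c n * exp (- t * ev n)) (P n))"

lemma exists_flow: "\<exists>c N. p = flow c N 0"
  using polynomial_jacobi_expansion[OF a_ge b_ge order_refl, of p] by (auto simp: flow_def)

lemma integral_kernel_flow:
  assumes "t > 0" "x \<in> {-1..1}"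
  shows "(\<integral>\<theta>. kernel t x (cos \<theta>) * poly (flow c N s) (cos \<theta>) \<partial>\<mu>) = poly (flow c N (s + t)) x"
proof -
  have int: "integrable \<mu> (\<lambda>\<theta>. kernel t x (cos \<theta>) * poly (P n) (cos \<theta>))" for n
    by (intro integrable_mu1 a_ge b_ge continuous_on_mult continuous_on_kernel_cos assms continuous_intros)
  have "(\<integral>\<theta>. kernel t x (cos \<theta>) * poly (flow c N s) (cos \<theta>) \<partial>\<mu>) =
    (\<integral>\<theta>. (\<Sum>n\<le>N. (c n * exp (- s * ev n)) * (kernel t x (cos \<theta>) * poly (P n) (cos \<theta>))) \<partial>\<mu>)"
    unfolding flow_def poly_sum by (simp add: sum_distrib_left mult_ac)
  also have "\<dots> = (\<Sum>n\<le>N. (c n * exp (- s * ev n)) * (\<integral>\<theta>. kernel t x (cos \<theta>) * poly (P n) (cos \<theta>) \<partial>\<mu>))"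
    by (subst Bochner_Integration.integral_sum) (auto intro!: int)
  also have "\<dots> = poly (flow c N (s + t)) x"
    unfolding flow_def poly_sum integral_kernel_jacobi_poly[OF assms]
    by (intro sum.cong refl) (simp add: distrib_right exp_diff exp_minus field_simps exp_add)
  finally show ?thesis .
qed

lemma jacobi_op_sum: "finite A \<Longrightarrow> jacobi_op a b (sum f A) = (\<Sum>i\<in>A. jacobi_op a b (f i))"
  by (induction A rule: finite_induct) (auto simp: jacobi_op_add, simp add: jacobi_op_def)

lemma jacobi_op_flow: "jacobi_op a b (flow c N t) = (\<Sum>n\<le>N. smult (c n * (- ev n * exp (- t * ev n))) (P n))"
  by (simp add: flow_def jacobi_op_sum jacobi_op_smult jacobi_op_jacobi_poly mult_ac)

lemma flow_has_time_derivative: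
  "((\<lambda>t. poly ((pderiv ^^ k) (flow c N t)) x) has_real_derivative poly ((pderiv ^^ k) (jacobi_op a b
      (flow c N t))) x) (at t)"
  unfolding jacobi_op_flow unfolding flow_def higher_pderiv_sum higher_pderiv_smult poly_sum poly_smult
  by (auto intro!: derivative_eq_intros sum.cong simp: mult_ac)

lemma continuous_on_flow: "continuous_on A (\<lambda>z. poly ((pderiv ^^ k) (flow c N (fst z))) (snd z))"
  unfolding flow_def higher_pderiv_sum higher_pderiv_smult poly_sum poly_smult
  by (intro continuous_intros)

end

section \<open>The Li--Yau inequality\<close>

lemma interior_min_second_derivative:
  fixes f f' :: "real \<Rightarrow> real"
  assumes f: "\<And>x. x \<in> {l<..<u} \<Longrightarrow> (f has_real_derivative f' x) (at x)"
    and f': "(f' has_real_derivative d) (at x0)"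
    and x0: "x0 \<in> {l<..<u}" and min: "\<And>x. x \<in> {l<..<u} \<Longrightarrow> f x0 \<le> f x"
  shows "f' x0 = 0" "d \<ge> 0"
proof -
  show zero: "f' x0 = 0"
  proof (rule DERIV_local_min[OF f[OF x0]])
    show "0 < min (x0 - l) (u - x0)" using x0 by auto
    show "\<forall>y. \<bar>x0 - y\<bar> < min (x0 - l) (u - x0) \<longrightarrow> f x0 \<le> f y" by (auto intro!: min)
  qed
  show "d \<ge> 0"
  proof (rule ccontr)
    assume "\<not> d \<ge> 0"
    then obtain e where e: "e > 0" "\<And>h. h > 0 \<Longrightarrow> h < e \<Longrightarrow> f' (x0 + h) < f' x0"
      using DERIV_neg_dec_right[OF f'] by auto
    define h where "h = min e (u - x0) / 2"
    have h: "h > 0" "h < e" "x0 + h < u" using e(1) x0 unfolding h_def by (auto simp: min_def field_simps)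
    obtain z where z: "z > x0" "z < x0 + h" "f (x0 + h) - f x0 = (x0 + h - x0) * f' z"
      using MVT2[of x0 "x0 + h" f f'] h x0 f by auto
    have "f' z < 0" using e(2)[of "z - x0"] z h zero by auto
    then have "h * f' z < 0" using h(1) by (simp add: mult_pos_neg)
    then show False using z min[of "x0 + h"] h x0 by auto
  qed
qed

text \<open>Bochner's formula q_t - L q - 2 Gamma(v, q) = 2 Gamma_2(v) for v = ln u and q = L v. The
  letters r1, r2, ... stand for the quotients u^(k) / u, the x- and xx-letters for their space
  derivatives, the t-letters for their time derivatives. Stated for plain reals, it is a polynomial
  identity.\<close>

lemma bochner_identity:
  fixes a b y r1 r2 r3 r4 :: real
  assumes "x1 = r2 - r1 * r1" "x2 = r3 - r2 * r1" "x3 = r4 - r3 * r1"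
  "xx1 = x2 - (x1 * r1 + r1 * x1)" "xx2 = x3 - (x2 * r1 + r2 * x1)"
  "qx = (- 2 * y) * r2 + (1 - y\<^sup>2) * x2 + (- (a + b + 2)) * r1
    + (b - a - (a + b + 2) * y) * x1 - ((- 2 * y) * r1\<^sup>2 + (1 - y\<^sup>2) * (2 * r1 * x1))"
  "qxx = - 2 * r2 + 2 * ((- 2 * y) * x2) + (1 - y\<^sup>2) * xx2
    + 2 * ((- (a + b + 2)) * x1) + (b - a - (a + b + 2) * y) * xx1
    - (- 2 * r1\<^sup>2 + 2 * ((- 2 * y) * (2 * r1 * x1))
       + (1 - y\<^sup>2) * (2 * x1\<^sup>2 + 2 * r1 * xx1))"
  "L = (1 - y\<^sup>2) * r2 + (b - a - (a + b + 2) * y) * r1"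
  "t1 = (1 - y\<^sup>2) * r3 + (b - a - (a + b + 4) * y) * r2 - (a + b + 2) * r1 - r1 * L"
  "t2 = (1 - y\<^sup>2) * r4 + (b - a - (a + b + 6) * y) * r3 - (2 * (a + b + 2) + 2) * r2 - r2 * L"
  "qt = (1 - y\<^sup>2) * t2 + (b - a - (a + b + 2) * y) * t1 - (1 - y\<^sup>2) * (2 * r1 * t1)"
  shows "qt - ((1 - y\<^sup>2) * qxx + (b - a - (a + b + 2) * y) * qx) - 2 * r1 * ((1 - y\<^sup>2) * qx)
      = 2 * ((1 - y\<^sup>2) * (r2 - r1\<^sup>2) - y * r1)\<^sup>2
          + ((2 * a + 1) * (1 + y) + (2 * b + 1) * (1 - y)) * r1\<^sup>2"
  unfolding assms by algebra

context jacobi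
begin

text \<open>At a negative minimum over the cylinder z would be strictly increasing in time, hence
  smaller just before. No boundary condition is imposed: at 1 and -1 the second-order coefficient
  vanishes and the drift points inward, so L z >= 0 holds there too. The hypothesis on
  \<open>zx\<close> carries the factor 1 - x^2 to cover these points.\<close>

lemma parabolic_min_principle:
  fixes z zt zx zxx :: "real \<Rightarrow> real \<Rightarrow> real"
  assumes cont: "continuous_on ({0..tmax} \<times> {-1..1}) (\<lambda>p. z (fst p) (snd p))"
    and init: "\<And>x. x \<in> {-1..1} \<Longrightarrow> z 0 x \<ge> 0"
    and dt: "\<And>t x. t \<in> {0<..tmax} \<Longrightarrow> x \<in> {-1..1} \<Longrightarrow> ((\<lambda>s. z s x) has_real_derivative zt t x) (at t)"
    and dx: "\<And>t x. t \<in> {0<..tmax} \<Longrightarrow> x \<in> {-1..1} \<Longrightarrow> (z t has_real_derivative zx t x) (at x)"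
    and dxx: "\<And>t x. t \<in> {0<..tmax} \<Longrightarrow> x \<in> {-1<..<1} \<Longrightarrow> (zx t has_real_derivative zxx t x) (at x)"
    and step: "\<And>t x. t \<in> {0<..tmax} \<Longrightarrow> x \<in> {-1..1} \<Longrightarrow> z t x < 0 \<Longrightarrow> (1 - x\<^sup>2) * zx t x = 0 \<Longrightarrow>
      (1 - x\<^sup>2) * zxx t x + (b - a - (a + b + 2) * x) * zx t x \<ge> 0 \<Longrightarrow> zt t x > 0"
    and tx: "t \<in> {0..tmax}" "x \<in> {-1..1}"
  shows "z t x \<ge> 0"
proof (rule ccontr)
  assume neg: "\<not> z t x \<ge> 0"
  have "compact ({0..tmax} \<times> {-1..1::real})" by (intro compact_Times) auto
  moreover have "{0..tmax} \<times> {-1..1::real} \<noteq> {}" using tx by auto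
  ultimately obtain p where p: "p \<in> {0..tmax} \<times> {-1..1}" "\<And>p'. p' \<in> {0..tmax} \<times> {-1..1}
      \<Longrightarrow> z (fst p) (snd p) \<le> z (fst p') (snd p')"
    using continuous_attains_inf[OF _ _ cont] by blast
  obtain s y where sy: "p = (s, y)" by (cases p)
  have s: "s \<in> {0..tmax}" and y: "y \<in> {-1..1}" using p sy by auto
  have min: "z s y \<le> z s' y'" if "s' \<in> {0..tmax}" "y' \<in> {-1..1}" for s' y'
    using p(2)[of "(s', y')"] that sy by simp
  have zneg: "z s y < 0" using min[OF tx] neg by simp
  with init[OF y] have "s \<noteq> 0" by auto
  with s have s': "s \<in> {0<..tmax}" by simp
  have "(1 - y\<^sup>2) * zx s y = 0 \<and> (1 - y\<^sup>2) * zxx s y + (b - a - (a + b + 2) * y) * zx s y \<ge> 0"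
  proof -
    consider "y = 1" | "y = -1" | "y \<in> {-1<..<1}" using y by fastforce
    then show ?thesis
    proof cases
      case 1
      have "\<not> zx s y > 0"
      proof
        assume "zx s y > 0"
        then obtain d where d: "d > 0" "\<And>h. h > 0 \<Longrightarrow> h < d \<Longrightarrow> z s (y - h) < z s y"
          using DERIV_pos_inc_left[OF dx[OF s' y]] by auto
        have "0 < min d 1 / 2" "min d 1 / 2 < d" "min d 1 / 2 \<le> 1" using d(1) by (auto simp: min_def)
        then show False using d(2)[of "min d 1 / 2"] min[OF s, of "y - min d 1 / 2"] 1 by force
      qed
      then have "(- 2 * (a + 1)) * zx s y \<ge> 0" using a_ge by (intro mult_nonpos_nonpos) auto
      moreover have "b - a - (a + b + 2) * y = - 2 * (a + 1)" unfolding 1 by simp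
      ultimately show ?thesis unfolding 1 by simp
    next
      case 2
      have "\<not> zx s y < 0"
      proof
        assume "zx s y < 0"
        then obtain d where d: "d > 0" "\<And>h. h > 0 \<Longrightarrow> h < d \<Longrightarrow> z s (y + h) < z s y"
          using DERIV_neg_dec_right[OF dx[OF s' y]] by auto
        have "0 < min d 1 / 2" "min d 1 / 2 < d" "min d 1 / 2 \<le> 1" using d(1) by (auto simp: min_def)
        then show False using d(2)[of "min d 1 / 2"] min[OF s, of "y + min d 1 / 2"] 2 by force
      qed
      then have "(2 * (b + 1)) * zx s y \<ge> 0" using b_ge by (intro mult_nonneg_nonneg) auto
      moreover have "b - a - (a + b + 2) * y = 2 * (b + 1)" unfolding 2 by simp
      ultimately show ?thesis unfolding 2 by simp
    next
      case 3
      have "zx s y = 0" "zxx s y \<ge> 0"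
        using interior_min_second_derivative[of "-1" 1 "z s" "zx s", OF dx[OF s'] dxx[OF s' 3] 3 min[OF
            s]] by auto
      moreover have "y\<^sup>2 \<le> 1" using y by (intro abs_square_le_1[THEN iffD2]) auto
      ultimately show ?thesis by simp
    qed
  qed
  then have "zt s y > 0" using step[OF s' y zneg] by blast
  then obtain d where d: "d > 0" "\<And>h. h > 0 \<Longrightarrow> h < d \<Longrightarrow> z (s - h) y < z s y"
    using DERIV_pos_inc_left[OF dt[OF s' y]] by auto
  have "0 < min d s / 2" "min d s / 2 < d" "s - min d s / 2 \<in> {0..tmax}" using d(1) s'
      by (auto simp: min_def)
  then show False using d(2)[of "min d s / 2"] min[OF _ y, of "s - min d s / 2"] by force
qed

section \<open>Positivity of flows and the Li--Yau estimate\<close>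

lemma poly_jacobi_op:
  "poly (jacobi_op a b p) x = (1 - x\<^sup>2) * poly (pderiv (pderiv p)) x + (b - a - (a + b
      + 2) * x) * poly (pderiv p) x"
  by (simp add: jacobi_op_def power2_eq_square algebra_simps)

text \<open>The minimum principle wants a strictly positive time derivative; the perturbation e (1 +
  t) provides it and disappears as e tends to 0.\<close>

lemma flow_lower_bound:
  assumes m: "\<And>x. x \<in> {-1..1} \<Longrightarrow> poly (flow c N 0) x \<ge> m" and "t \<ge> 0" "x \<in> {-1..1}"
  shows "poly (flow c N t) x \<ge> m"
proof -
  let ?U = "flow c N"
  have "poly (?U t) x - m + e * (1 + t) \<ge> 0" if "e > 0" for e
  proof (rule parabolic_min_principle[where z="\<lambda>t x. poly (?U t) x - m + e * (1 + t)" and tmax=t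
        and zt="\<lambda>t x. poly (jacobi_op a b (?U t)) x + e"
        and zx="\<lambda>t x. poly (pderiv (?U t)) x" and zxx="\<lambda>t x. poly (pderiv (pderiv (?U t))) x"])
    show "continuous_on ({0..t} \<times> {- 1..1}) (\<lambda>p. poly (?U (fst p)) (snd p) - m + e * (1 + fst p))"
      using continuous_on_flow[where k=0] by (intro continuous_intros) simp
    show "((\<lambda>s. poly (?U s) y - m + e * (1 + s)) has_real_derivative poly (jacobi_op a b (?U s)) y
        + e) (at s)" for s y
      using flow_has_time_derivative[where k=0, of c N y s] by (auto intro!: derivative_eq_intros)
    show "((\<lambda>y. poly (?U s) y - m + e * (1 + s)) has_real_derivative poly (pderiv (?U s)) y) (at y)" for s y
      by (auto intro!: derivative_eq_intros)
    show "(poly (pderiv (?U s)) has_real_derivative poly (pderiv (pderiv (?U s))) y) (at y)" for s y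
      by (rule poly_DERIV)
    show "poly (jacobi_op a b (?U s)) y + e > 0"
      if "(1 - y\<^sup>2) * poly (pderiv (pderiv (?U s))) y + (b - a - (a + b
          + 2) * y) * poly (pderiv (?U s)) y \<ge> 0" for s y
      using that \<open>e > 0\<close> unfolding poly_jacobi_op by simp
  qed (use assms that in \<open>auto intro: order_trans[of 0]\<close>)
  then have *: "m \<le> poly (?U t) x + e * (1 + t)" if "e > 0" for e using that by force
  show ?thesis
  proof (rule field_le_epsilon)
    fix e :: real assume "e > 0"
    then show "m \<le> poly (?U t) x + e" using *[of "e / (1 + t)"] \<open>t \<ge> 0\<close> by simp
  qed
qed

lemma flow_positive:
  assumes pos: "\<And>x. x \<in> {-1..1} \<Longrightarrow> poly (flow c N 0) x > 0" and "t \<ge> 0" "x \<in> {-1..1}"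
  shows "poly (flow c N t) x > 0"
proof -
  have "continuous_on {-1..1} (poly (flow c N 0))" by (intro continuous_intros)
  then obtain y where "y \<in> {-1..1}" "\<And>x. x \<in> {-1..1} \<Longrightarrow> poly (flow c N 0) y \<le> poly (flow c N 0) x"
    using continuous_attains_inf[of "{-1..1::real}" "poly (flow c N 0)"] by auto
  then show ?thesis
    using flow_lower_bound[where m="poly (flow c N 0) y" and c=c and N=N, OF _ assms(2,3)] pos by fastforce
qed

text \<open>The N of CD(0, N), equal to 2 a + 2 b + 4, in the form 2 + 2 A + 2 B in which
  \<open>curvature_dimension\<close> delivers it for A = a + 1/2 and B = b + 1/2.\<close>

definition dim :: real where
  "dim = 2 + 2 * (a + 1 / 2) + 2 * (b + 1 / 2)"

lemma dim_ge: "dim \<ge> 2"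
  using a_ge b_ge by (simp add: dim_def)

text \<open>Derivatives of ln u are polynomials in the quotients u^(k) / u, and the space derivative
  of such a quotient is again a polynomial in them. The Bochner computation thus becomes
  algebra.\<close>

definition flow_ratio :: "(nat \<Rightarrow> real) \<Rightarrow> nat \<Rightarrow> nat \<Rightarrow> real \<Rightarrow> real \<Rightarrow> real" where
  "flow_ratio c N k t x = poly ((pderiv ^^ k) (flow c N t)) x / poly (flow c N t) x"

lemma flow_ratio_space_derivative:
  assumes "poly (flow c N t) x \<noteq> 0"
  shows "(flow_ratio c N k t has_real_derivative
    flow_ratio c N (Suc k) t x - flow_ratio c N k t x * flow_ratio c N 1 t x) (at x)"
  unfolding flow_ratio_def[abs_def]
  by (rule DERIV_cong[OF DERIV_divide[OF poly_DERIV poly_DERIV assms]])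
     (use assms in \<open>simp add: field_simps\<close>)

lemma flow_ratio_time_derivative:
  assumes "poly (flow c N t) x \<noteq> 0"
  shows "((\<lambda>t. flow_ratio c N k t x) has_real_derivative
    poly ((pderiv ^^ k) (jacobi_op a b (flow c N t))) x / poly (flow c N t) x
      - flow_ratio c N k t x * (poly (jacobi_op a b (flow c N t)) x / poly (flow c N t) x)) (at t)"
  unfolding flow_ratio_def[abs_def]
  by (rule DERIV_cong[OF DERIV_divide[OF flow_has_time_derivative flow_has_time_derivative[where k=0,
      simplified] assms]])
     (use assms in \<open>simp add: field_simps\<close>)

text \<open>With \<open>v = ln u\<close>, \<open>v1 = v'\<close>, \<open>X = (1 - x\<^sup>2) v'' - x v'\<close> one has \<open>L v = X + (B (1 - x) - A (1
    + x)) v1\<close> and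
  \<open>\<Gamma>\<^sub>2(v) = X\<^sup>2 + (A (1 + x) + B (1 - x)) v1\<^sup>2\<close>, where \<open>A = a + 1/2\<close>, \<open>B = b + 1/2\<close>; this is the
  curvature-dimension inequality \<open>\<Gamma>\<^sub>2(v) \<ge> (L v)\<^sup>2 / dim\<close>.\<close>

lemma curvature_dimension:
  fixes A B x X v :: real
  assumes "A \<ge> 0" "B \<ge> 0" "x \<in> {-1..1}"
  shows "(X + (B * (1 - x) - A * (1 + x)) * v)\<^sup>2 \<le>
    (2 + 2 * A + 2 * B) * (X\<^sup>2 + (A * (1 + x) + B * (1 - x)) * v\<^sup>2)"
proof -
  define Y W where "Y = (B * (1 - x) - A * (1 + x))" and "W = A * (1 + x) + B * (1 - x)"
  \<comment> \<open>Y^2 <= M W because |Y| <= W <= M. Young's inequality with weight M then gives 2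
    X Y v <= M X^2 + W v^2, and 1 + M is the constant of the claim.\<close>
  define M where "M = 1 + 2 * A + 2 * B"
  have M: "M \<ge> 1" unfolding M_def using assms by simp
  have W: "0 \<le> W" "W \<le> 2 * A + 2 * B"
  proof -
    show "0 \<le> W" unfolding W_def using assms by auto
    have "A * (1 + x) \<le> A * 2" "B * (1 - x) \<le> B * 2" using assms by (auto intro!: mult_left_mono)
    then show "W \<le> 2 * A + 2 * B" unfolding W_def by simp
  qed
  have "\<bar>Y\<bar> \<le> W" unfolding Y_def W_def using assms
    by (intro order_trans[OF abs_triangle_ineq4]) (auto simp: abs_mult)
  then have "\<bar>Y\<bar>\<^sup>2 \<le> W\<^sup>2" by (intro power_mono) auto
  also have "W\<^sup>2 \<le> M * W" unfolding power2_eq_square M_def using W by (intro mult_right_mono) auto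
  finally have YW: "Y\<^sup>2 \<le> M * W" by simp
  have "0 \<le> (M * X - Y * v)\<^sup>2" by simp
  then have "2 * M * (X * (Y * v)) \<le> M\<^sup>2 * X\<^sup>2 + Y\<^sup>2 * v\<^sup>2"
    by (simp add: power2_eq_square algebra_simps)
  also have "\<dots> \<le> M\<^sup>2 * X\<^sup>2 + (M * W) * v\<^sup>2" using YW by (intro add_left_mono mult_right_mono) auto
  finally have "M * (2 * (X * (Y * v))) \<le> M * (M * X\<^sup>2 + W * v\<^sup>2)"
      by (simp add: power2_eq_square algebra_simps)
  then have c: "2 * (X * (Y * v)) \<le> M * X\<^sup>2 + W * v\<^sup>2" using M by simp
  have "Y\<^sup>2 * v\<^sup>2 \<le> M * W * v\<^sup>2" using YW by (intro mult_right_mono) auto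
  moreover have "(X + Y * v)\<^sup>2 = X\<^sup>2 + 2 * (X * (Y * v)) + Y\<^sup>2 * v\<^sup>2"
      by (simp add: power2_eq_square algebra_simps)
  ultimately have "(X + Y * v)\<^sup>2 \<le> (1 + M) * (X\<^sup>2 + W * v\<^sup>2)" using c by (simp add: algebra_simps)
  then show ?thesis unfolding Y_def W_def M_def by (simp add: algebra_simps)
qed

text \<open>The left-hand side is q = L (ln u). Where (1 - x^2) q_x = 0 and L q >= 0, Bochner's
  formula and the curvature-dimension inequality give q_t >= (2 / dim) q^2, and comparison with the
  solution - dim / (2 t) of the corresponding ODE gives the bound.\<close>

lemma li_yau:
  assumes pos: "\<And>x. x \<in> {-1..1} \<Longrightarrow> poly (flow c N 0) x > 0" and t: "t > 0" and x: "x \<in> {-1..1}"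
  defines "r \<equiv> \<lambda>k. flow_ratio c N k t x"
  shows "(1 - x\<^sup>2) * r 2 + (b - a - (a + b + 2) * x) * r 1 - (1 - x\<^sup>2) * (r 1)\<^sup>2 \<ge> - dim / (2 * t)"
proof -
  let ?U = "flow c N"
  define R where "R = flow_ratio c N"
  have upos: "poly (?U s) y > 0" if "s \<ge> 0" "y \<in> {-1..1}" for s y
    by (rule flow_positive[OF pos that])
  define q where "q = (\<lambda>s y. (1 - y\<^sup>2) * R 2 s y + (b - a - (a + b
      + 2) * y) * R 1 s y - (1 - y\<^sup>2) * (R 1 s y)\<^sup>2)"
  define Rx where "Rx = (\<lambda>k s y. R (Suc k) s y - R k s y * R 1 s y)"
  define qx where "qx = (\<lambda>s y. (- 2 * y) * R 2 s y + (1 - y\<^sup>2) * Rx 2 s y + (- (a + b + 2)) * R 1 s y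
    + (b - a - (a + b + 2) * y) * Rx 1 s y - ((- 2 * y) * (R 1 s y)\<^sup>2
        + (1 - y\<^sup>2) * (2 * R 1 s y * Rx 1 s y)))"
  define Rxx where "Rxx = (\<lambda>k s y. Rx (Suc k) s y - (Rx k s y * R 1 s y + R k s y * Rx 1 s y))"
  define qxx where "qxx = (\<lambda>s y. - 2 * R 2 s y + 2 * ((- 2 * y) * Rx 2 s y) + (1 - y\<^sup>2) * Rxx 2 s y
    + 2 * ((- (a + b + 2)) * Rx 1 s y) + (b - a - (a + b + 2) * y) * Rxx 1 s y
    - (- 2 * (R 1 s y)\<^sup>2 + 2 * ((- 2 * y) * (2 * R 1 s y * Rx 1 s y))
       + (1 - y\<^sup>2) * (2 * (Rx 1 s y)\<^sup>2 + 2 * R 1 s y * Rxx 1 s y)))"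
  define L where "L = (\<lambda>s y. (1 - y\<^sup>2) * R 2 s y + (b - a - (a + b + 2) * y) * R 1 s y)"
  define Rt1 where "Rt1 = (\<lambda>s y. (1 - y\<^sup>2) * R 3 s y + (b - a - (a + b + 4) * y) * R 2 s y - (a + b
      + 2) * R 1 s y - R 1 s y * L s y)"
  define Rt2 where "Rt2 = (\<lambda>s y. (1 - y\<^sup>2) * R 4 s y + (b - a - (a + b + 6) * y) * R 3 s y - (2 * (a + b
      + 2) + 2) * R 2 s y - R 2 s y * L s y)"
  define qt where "qt = (\<lambda>s y. (1 - y\<^sup>2) * Rt2 s y + (b - a - (a + b
      + 2) * y) * Rt1 s y - (1 - y\<^sup>2) * (2 * R 1 s y * Rt1 s y))"
  have Rdx: "(R k s has_real_derivative Rx k s y) (at y)" if "s \<ge> 0" "y \<in> {-1..1}" for k s y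
    unfolding R_def Rx_def using upos[OF that] by (intro flow_ratio_space_derivative) auto
  have Rdxx: "(Rx k s has_real_derivative Rxx k s y) (at y)" if "s \<ge> 0" "y \<in> {-1..1}" for k s y
    unfolding Rx_def[abs_def] Rxx_def
    by (rule DERIV_cong[OF DERIV_diff[OF Rdx[OF that] DERIV_mult[OF Rdx[OF that] Rdx[OF that]]]])
       (simp add: Rx_def mult.commute)
  have sq: "((\<lambda>y. 1 - y\<^sup>2) has_real_derivative - 2 * y) (at y)"
    "((\<lambda>y. b - a - (a + b + 2) * y) has_real_derivative - (a + b + 2)) (at y)"
    "((\<lambda>y. - 2 * y) has_real_derivative - 2) (at y)" for y :: real
    by (auto intro!: derivative_eq_intros)
  have Rsq: "((\<lambda>y. (R 1 s y)\<^sup>2) has_real_derivative 2 * R 1 s y * Rx 1 s y) (at y)" if "s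
      \<ge> 0" "y \<in> {-1..1}" for s y
    unfolding power2_eq_square by (rule DERIV_cong[OF DERIV_mult[OF Rdx[OF that] Rdx[OF that]]]) algebra
  have RRx: "((\<lambda>y. 2 * R 1 s y * Rx 1 s y) has_real_derivative 2 * (Rx 1 s y)\<^sup>2
      + 2 * R 1 s y * Rxx 1 s y) (at y)"
    if "s \<ge> 0" "y \<in> {-1..1}" for s y
    by (rule DERIV_cong[OF DERIV_mult[OF DERIV_cmult[OF Rdx[OF that]] Rdxx[OF that]]]) algebra
  have qdx: "(q s has_real_derivative qx s y) (at y)" if "s \<ge> 0" "y \<in> {-1..1}" for s y
    unfolding q_def[abs_def] qx_def
    by (rule DERIV_cong[OF DERIV_diff[OF DERIV_add[OF DERIV_mult[OF sq(1) Rdx[OF that]] DERIV_mult[OF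
        sq(2) Rdx[OF that]]]
          DERIV_mult[OF sq(1) Rsq[OF that]]]]) algebra
  have qdxx: "(qx s has_real_derivative qxx s y) (at y)" if "s \<ge> 0" "y \<in> {-1..1}" for s y
    unfolding qx_def[abs_def] qxx_def
    by (rule DERIV_cong[OF DERIV_diff[OF DERIV_add[OF DERIV_add[OF DERIV_add[OF DERIV_mult[OF sq(3)
        Rdx[OF that]]
          DERIV_mult[OF sq(1) Rdxx[OF that]]] DERIV_cmult[OF Rdx[OF that]]] DERIV_mult[OF sq(2) Rdxx[OF
              that]]]
          DERIV_add[OF DERIV_mult[OF sq(3) Rsq[OF that]] DERIV_mult[OF sq(1) RRx[OF that]]]]]) algebra
  have sig: "pderiv [:1, 0, -1::real:] = [:0, -2:]" "pderiv [:0, -2::real:]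
      = [:-2:]" "pderiv [:-2::real:] = 0"
    "pderiv [:b - a, - (a + b + 2):] = [:- (a + b + 2):]" "pderiv [:- (a + b + 2):] = 0"
    by (simp_all add: pderiv_pCons)
  have op1: "poly (pderiv (jacobi_op a b p)) y = (1 - y\<^sup>2) * poly ((pderiv ^^ 3) p) y
      + (b - a - (a + b + 4) * y) * poly ((pderiv ^^ 2) p) y - (a + b + 2) * poly (pderiv p) y" for p y
    unfolding jacobi_op_def pderiv_add pderiv_mult sig
    by (simp add: numeral_eq_Suc algebra_simps)
  have op2: "poly (pderiv (pderiv (jacobi_op a b p))) y = (1 - y\<^sup>2) * poly ((pderiv ^^ 4) p) y
      + (b - a - (a + b + 6) * y) * poly ((pderiv ^^ 3) p) y - (2 * (a + b + 2)
          + 2) * poly ((pderiv ^^ 2) p) y" for p y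
    unfolding jacobi_op_def pderiv_add pderiv_mult sig
    by (simp add: numeral_eq_Suc algebra_simps)
  have L_eq: "poly (jacobi_op a b (?U s)) y / poly (?U s) y = L s y" for s y
    unfolding L_def R_def flow_ratio_def poly_jacobi_op by (simp add: add_divide_distrib numeral_2_eq_2)
  have Rdt1: "((\<lambda>s. R 1 s y) has_real_derivative Rt1 s y) (at s)" if "s \<ge> 0" "y \<in> {-1..1}" for s y
    using flow_ratio_time_derivative[of c N s y 1] upos[OF that]
    unfolding L_eq unfolding R_def[symmetric]
    by (simp add: op1 Rt1_def R_def flow_ratio_def add_divide_distrib diff_divide_distrib)
  have Rdt2: "((\<lambda>s. R 2 s y) has_real_derivative Rt2 s y) (at s)" if "s \<ge> 0" "y \<in> {-1..1}" for s y
  proof -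
    have 2: "(pderiv ^^ 2) p = pderiv (pderiv p)" for p :: "real poly" by (simp add: numeral_2_eq_2)
    show ?thesis
      using flow_ratio_time_derivative[of c N s y 2] upos[OF that]
      unfolding L_eq unfolding R_def[symmetric] 2[of "jacobi_op _ _ _"] op2
      by (simp add: Rt2_def R_def flow_ratio_def add_divide_distrib diff_divide_distrib)
  qed
  have qdt: "((\<lambda>s. q s y) has_real_derivative qt s y) (at s)" if "s \<ge> 0" "y \<in> {-1..1}" for s y
    unfolding q_def qt_def power2_eq_square[of "R _ _ _"]
    by (rule DERIV_cong[OF DERIV_diff[OF DERIV_add[OF DERIV_cmult[OF Rdt2[OF that]] DERIV_cmult[OF
        Rdt1[OF that]]]
          DERIV_cmult[OF DERIV_mult[OF Rdt1[OF that] Rdt1[OF that]]]]]) algebra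
  have bochner: "qt s y - ((1 - y\<^sup>2) * qxx s y + (b - a - (a + b
      + 2) * y) * qx s y) - 2 * R 1 s y * ((1 - y\<^sup>2) * qx s y)
      = 2 * ((1 - y\<^sup>2) * (R 2 s y - (R 1 s y)\<^sup>2) - y * R 1 s y)\<^sup>2
          + ((2 * a + 1) * (1 + y) + (2 * b + 1) * (1 - y)) * (R 1 s y)\<^sup>2" for s y
  proof -
    have n: "Suc 1 = 2" "Suc 2 = 3" "Suc 3 = 4" by simp_all
    show ?thesis
      by (rule bochner_identity[where ?x1.0="Rx 1 s y" and ?x2.0="Rx 2 s y" and ?x3.0="Rx 3 s y"
          and ?r3.0="R 3 s y"
            and ?r4.0="R 4 s y" and ?xx1.0="Rxx 1 s y" and ?xx2.0="Rxx 2 s y" and L="L s y"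
                and ?t1.0="Rt1 s y" and ?t2.0="Rt2 s y"])
        (simp_all only: n Rx_def Rxx_def L_def Rt1_def Rt2_def qx_def qxx_def qt_def)
  qed
  have q_split: "q s y = ((1 - y\<^sup>2) * (R 2 s y - (R 1 s y)\<^sup>2) - y * R 1 s y)
      + ((b + 1 / 2) * (1 - y) - (a + 1 / 2) * (1 + y)) * R 1 s y" for s y
    unfolding q_def by (simp add: power2_eq_square field_simps)
  have ineq: "(2 / dim) * (q s y)\<^sup>2 \<le> qt s y"
    if "y \<in> {-1..1}" "(1 - y\<^sup>2) * qx s y = 0" "(1 - y\<^sup>2) * qxx s y + (b - a - (a + b + 2) * y) * qx s y
        \<ge> 0" for s y
  proof -
    have "(q s y)\<^sup>2 \<le> dim * (((1 - y\<^sup>2) * (R 2 s y - (R 1 s y)\<^sup>2) - y * R 1 s y)\<^sup>2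
          + ((a + 1 / 2) * (1 + y) + (b + 1 / 2) * (1 - y)) * (R 1 s y)\<^sup>2)"
      unfolding q_split dim_def using a_ge b_ge that(1) by (intro curvature_dimension) auto
    also have "((1 - y\<^sup>2) * (R 2 s y - (R 1 s y)\<^sup>2) - y * R 1 s y)\<^sup>2
          + ((a + 1 / 2) * (1 + y) + (b + 1 / 2) * (1 - y)) * (R 1 s y)\<^sup>2
        = (2 * ((1 - y\<^sup>2) * (R 2 s y - (R 1 s y)\<^sup>2) - y * R 1 s y)\<^sup>2
          + ((2 * a + 1) * (1 + y) + (2 * b + 1) * (1 - y)) * (R 1 s y)\<^sup>2) / 2"
      by (simp add: add_divide_distrib) (simp add: field_simps)
    also have "dim * \<dots> \<le> dim * (qt s y / 2)"
      using bochner[of s y] that(2,3) dim_ge by (intro mult_left_mono divide_right_mono) auto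
    finally show ?thesis using dim_ge by (simp add: field_simps)
  qed
  \<comment> \<open>Multiplying by the time removes the singular comparison function: the quantity
    starts at dim / 2 > 0.\<close>
  have "t * q t x + dim / 2 \<ge> 0"
  proof (rule parabolic_min_principle[where z="\<lambda>s y. s * q s y + dim / 2" and tmax=t
        and zt="\<lambda>s y. q s y + s * qt s y" and zx="\<lambda>s y. s * qx s y" and zxx="\<lambda>s y. s * qxx s y"])
    have "continuous_on ({0..t} \<times> {-1..1}) (\<lambda>p. R k (fst p) (snd p))" for k
    proof -
      have "poly (?U (fst p)) (snd p) \<noteq> 0" if "p \<in> {0..t} \<times> {-1..1}" for p
        using upos[of "fst p" "snd p"] that by auto
      then show ?thesis unfolding R_def flow_ratio_def
        using continuous_on_flow[where k=0] by (intro continuous_on_divide continuous_on_flow) auto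
    qed
    then show "continuous_on ({0..t} \<times> {- 1..1}) (\<lambda>p. fst p * q (fst p) (snd p) + dim / 2)"
      unfolding q_def by (intro continuous_intros) auto
    show "0 * q 0 y + dim / 2 \<ge> 0" for y using dim_ge by simp
    fix s y assume s: "s \<in> {0<..t}" 
    show "((\<lambda>s. s * q s y + dim / 2) has_real_derivative q s y + s * qt s y) (at s)" if "y \<in> {-1..1}"
      using qdt[of s y] s that by (auto intro!: derivative_eq_intros)
    show "((\<lambda>y. s * q s y + dim / 2) has_real_derivative s * qx s y) (at y)" if "y \<in> {-1..1}"
      using qdx[of s y] s that by (auto intro!: derivative_eq_intros)
    show "((\<lambda>y. s * qx s y) has_real_derivative s * qxx s y) (at y)" if "y \<in> {-1<..<1}"
      using qdxx[of s y] s that by (auto intro!: derivative_eq_intros)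
    assume y: "y \<in> {-1..1}" and neg: "s * q s y + dim / 2 < 0"
      and g: "(1 - y\<^sup>2) * (s * qx s y) = 0"
      and l: "0 \<le> (1 - y\<^sup>2) * (s * qxx s y) + (b - a - (a + b + 2) * y) * (s * qx s y)"
    have s0: "s > 0" using s by simp
    have "(1 - y\<^sup>2) * qx s y = 0" using g s0 by simp
    moreover have "s * ((1 - y\<^sup>2) * qxx s y + (b - a - (a + b + 2) * y) * qx s y) \<ge> 0"
      using l by (simp add: algebra_simps)
    then have "(1 - y\<^sup>2) * qxx s y + (b - a - (a + b + 2) * y) * qx s y \<ge> 0" using s0
        by (simp add: zero_le_mult_iff)
    ultimately have "s * ((2 / dim) * (q s y)\<^sup>2) \<le> s * qt s y" using ineq[OF y] s0
        by (intro mult_left_mono) auto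
    \<comment> \<open>Where s q + dim / 2 is negative, so is q; the product is positive and bounds
      the time derivative from below.\<close>
    moreover have "q s y + s * ((2 / dim) * (q s y)\<^sup>2) = (2 / dim) * (q s y * (s * q s y + dim / 2))"
      using dim_ge by (simp add: field_simps power2_eq_square)
    moreover have "q s y < 0"
    proof -
      have "s * q s y < 0" using neg dim_ge by simp
      then show ?thesis using s0 by (simp add: mult_less_0_iff)
    qed
    then have "(2 / dim) * (q s y * (s * q s y + dim / 2)) > 0"
      using neg dim_ge by (intro mult_pos_pos mult_neg_neg) auto
    ultimately show "q s y + s * qt s y > 0" by linarith
  qed (use t x in auto)
  then have "q t x \<ge> - dim / (2 * t)" using t by (simp add: field_simps)
  then show ?thesis unfolding q_def R_def r_def .
qed

end

section \<open>Positivity and the Harnack inequality\<close>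

lemma weierstrass_positive_polynomials:
  fixes f :: "real \<Rightarrow> real"
  assumes f: "continuous_on {-1..1} f" "\<And>x. x \<in> {-1..1} \<Longrightarrow> f x \<ge> 0"
  obtains p :: "nat \<Rightarrow> real poly" where "\<And>k x. x \<in> {-1..1} \<Longrightarrow> poly (p k) x > 0"
    "\<And>k x. x \<in> {-1..1} \<Longrightarrow> \<bar>poly (p k) x - f x\<bar> \<le> 3 / real (Suc k)"
proof -
  have "\<exists>p :: real poly. \<forall>x\<in>{-1..1}. poly p x > 0 \<and> \<bar>poly p x - f x\<bar> \<le> 3 / real (Suc k)" for k
  proof -
    let ?e = "1 / real (Suc k)"
    \<comment> \<open>Approximating f + 2 e within e keeps the polynomial strictly positive and
      within 3 e of f.\<close>
    have "continuous_on {-1..1} (\<lambda>x. f x + 2 * ?e)" by (intro continuous_intros f)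
    then obtain g where g: "real_polynomial_function g" "\<And>x. x \<in> {-1..1} \<Longrightarrow> \<bar>f x + 2 * ?e - g x\<bar> < ?e"
      by (rule Stone_Weierstrass_real_polynomial_function[OF compact_Icc, where e="?e"]) auto
    then obtain a n where a: "g = (\<lambda>x. \<Sum>i\<le>n. a i * x ^ i)" using real_polynomial_function_iff_sum by auto
    show ?thesis
    proof (intro exI[of _ "\<Sum>i\<le>n. monom (a i) i"] ballI)
      fix x :: real assume x: "x \<in> {-1..1}"
      have p: "poly (\<Sum>i\<le>n. monom (a i) i) x = g x" unfolding a by (simp add: poly_sum poly_monom)
      have e: "?e > 0" by simp
      have "3 / real (Suc k) = 3 * ?e" by simp
      then show "poly (\<Sum>i\<le>n. monom (a i) i) x > 0 \<and> \<bar>poly (\<Sum>i\<le>n. monom (a i) i) x - f x\<bar> \<le> 3 / real (Suc k)"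
        unfolding p using g(2)[OF x] f(2)[OF x] e by (simp only:) linarith
    qed
  qed
  then show ?thesis using that by metis
qed

context jacobi
begin

section \<open>The Harnack inequality for polynomial flows\<close>

lemma flow_along_path_derivative:
  "((\<lambda>s. poly (flow c N s) (cos (\<theta> + D * s))) has_real_derivative
    poly (jacobi_op a b (flow c N s)) (cos (\<theta> + D * s)) - D * (sin (\<theta>
        + D * s) * poly (pderiv (flow c N s)) (cos (\<theta> + D * s)))) (at s)"
proof -
  have P: "((\<lambda>s. poly (P n) (cos (\<theta> + D * s))) has_real_derivative
      poly (pderiv (P n)) (cos (\<theta> + D * s)) * (- sin (\<theta> + D * s) * D)) (at s)" for n
    by (rule DERIV_chain2[OF poly_DERIV]) (auto intro!: derivative_eq_intros)
  have E: "((\<lambda>s. c n * exp (- s * ev n)) has_real_derivative c n * (- ev n * exp (- s * ev n))) (at s)"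
      for n
    by (auto intro!: derivative_eq_intros)
  have "((\<lambda>s. poly (flow c N s) (cos (\<theta> + D * s))) has_real_derivative
      (\<Sum>n\<le>N. c n * (- ev n * exp (- s * ev n)) * poly (P n) (cos (\<theta> + D * s))
        + poly (pderiv (P n)) (cos (\<theta> + D * s)) * (- sin (\<theta>
            + D * s) * D) * (c n * exp (- s * ev n)))) (at s)"
    unfolding flow_def poly_sum poly_smult by (intro DERIV_sum DERIV_mult E P)
  moreover have "(\<Sum>n\<le>N. c n * (- ev n * exp (- s * ev n)) * poly (P n) (cos (\<theta> + D * s))
        + poly (pderiv (P n)) (cos (\<theta> + D * s)) * (- sin (\<theta> + D * s) * D) * (c n * exp (- s * ev n)))
      = poly (jacobi_op a b (flow c N s)) (cos (\<theta> + D * s)) - D * (sin (\<theta>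
          + D * s) * poly (pderiv (flow c N s)) (cos (\<theta> + D * s)))"
  proof -
    have "pderiv (flow c N s) = (\<Sum>n\<le>N. smult (c n * exp (- s * ev n)) (pderiv (P n)))"
      using higher_pderiv_sum[of 1 "\<lambda>n. smult (c n * exp (- s * ev n)) (P n)" "{..N}"]
      by (simp add: flow_def pderiv_smult)
    then show ?thesis
      unfolding jacobi_op_flow by (simp add: poly_sum sum_distrib_left sum.distrib sum_negf
          sum_subtractf mult_ac)
  qed
  ultimately show ?thesis by simp
qed

text \<open>Li--Yau reads L u / u >= (1 - x^2) (u_x / u)^2 - dim / (2 s). Along an angular path of
  speed D the drift term D sin(.) u_x / u is absorbed by this square at the cost D^2 / 4, so ln u +
  D^2 s / 4 + (dim / 2) ln s is nondecreasing.\<close>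

lemma flow_harnack:
  assumes pos: "\<And>x. x \<in> {-1..1} \<Longrightarrow> poly (flow c N 0) x > 0" and t: "0 < t1" "t1 < t2"
  shows "poly (flow c N t1) (cos \<theta>1) \<le>
    (t2 / t1) powr (dim / 2) * exp ((\<theta>2 - \<theta>1)\<^sup>2 / (4 * (t2 - t1))) * poly (flow c N t2) (cos \<theta>2)"
proof -
  define D where "D = (\<theta>2 - \<theta>1) / (t2 - t1)"
  define \<theta> where "\<theta> = \<theta>1 - D * t1"
  define u where "u = (\<lambda>s. poly (flow c N s) (cos (\<theta> + D * s)))"
  have end1: "\<theta> + D * t1 = \<theta>1" unfolding \<theta>_def by simp
  have "D * (t2 - t1) = \<theta>2 - \<theta>1" unfolding D_def using t by simp
  then have end2: "\<theta> + D * t2 = \<theta>2" unfolding \<theta>_def by (simp add: algebra_simps)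
  have upos: "u s > 0" if "s \<ge> 0" for s unfolding u_def using that by (intro flow_positive[OF pos]) auto
  define f where "f = (\<lambda>s. ln (u s) + D\<^sup>2 / 4 * s + dim / 2 * ln s)"
  have "f t1 \<le> f t2"
  proof (rule DERIV_nonneg_imp_nondecreasing[where f=f and a=t1 and b=t2])
    show "t1 \<le> t2" using t by simp
    fix s assume s: "t1 \<le> s" "s \<le> t2"
    define x where "x = cos (\<theta> + D * s)"
    define r where "r = (\<lambda>k. flow_ratio c N k s x)"
    define S where "S = sin (\<theta> + D * s)"
    have x: "x \<in> {-1..1}" unfolding x_def by auto
    have s0: "s > 0" using s t by simp
    have S2: "S\<^sup>2 = 1 - x\<^sup>2" unfolding S_def x_def by (simp add: sin_squared_eq)
    have us: "u s > 0" "u s = poly (flow c N s) x" using upos s0 unfolding u_def x_def by auto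
    have du: "(u has_real_derivative poly (jacobi_op a b (flow c N s)) x - D * (S * poly (pderiv (flow c
        N s)) x)) (at s)"
      unfolding u_def x_def S_def by (rule flow_along_path_derivative)
    have op: "poly (jacobi_op a b (flow c N s)) x / u s = (1 - x\<^sup>2) * r 2 + (b - a - (a + b + 2) * x) * r 1"
      unfolding r_def flow_ratio_def poly_jacobi_op us(2) by (simp add: add_divide_distrib numeral_2_eq_2)
    have r1: "poly (pderiv (flow c N s)) x / u s = r 1" unfolding r_def flow_ratio_def us(2) by simp
    have "(f has_real_derivative (poly (jacobi_op a b (flow c N s)) x - D * (S * poly (pderiv (flow c N
        s)) x)) / u s
        + D\<^sup>2 / 4 + dim / 2 * (1 / s)) (at s)"
      unfolding f_def using us(1) s0 by (auto intro!: derivative_eq_intros du)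
    moreover have "(poly (jacobi_op a b (flow c N s)) x - D * (S * poly (pderiv (flow c N s)) x)) / u s
        + D\<^sup>2 / 4 + dim / 2 * (1 / s) \<ge> 0"
    proof -
      have "(poly (jacobi_op a b (flow c N s)) x - D * (S * poly (pderiv (flow c N s)) x)) / u s
          = (1 - x\<^sup>2) * r 2 + (b - a - (a + b + 2) * x) * r 1 - D * (S * r 1)"
        unfolding diff_divide_distrib op times_divide_eq_right[symmetric] r1 ..
      moreover have "(1 - x\<^sup>2) * r 2 + (b - a - (a + b + 2) * x) * r 1 - (1 - x\<^sup>2) * (r 1)\<^sup>2
          \<ge> - dim / (2 * s)"
        unfolding r_def by (rule li_yau[OF pos s0 x])
      moreover have "0 \<le> (S * r 1 - D / 2)\<^sup>2" by simp
      then have "0 \<le> (1 - x\<^sup>2) * (r 1)\<^sup>2 - D * (S * r 1) + D\<^sup>2 / 4"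
        unfolding S2[symmetric] by (simp add: power2_eq_square algebra_simps)
      moreover have "dim / 2 * (1 / s) = - (- dim / (2 * s))" by simp
      ultimately show ?thesis by linarith
    qed
    ultimately show "\<exists>y. (f has_real_derivative y) (at s) \<and> 0 \<le> y" by blast
  qed
  then have "ln (u t1) \<le> ln (u t2) + D\<^sup>2 / 4 * (t2 - t1) + dim / 2 * (ln t2 - ln t1)"
    unfolding f_def right_diff_distrib by linarith
  also have "D\<^sup>2 / 4 * (t2 - t1) = (\<theta>2 - \<theta>1)\<^sup>2 / (4 * (t2 - t1))"
    unfolding D_def using t by (simp add: power2_eq_square)
  also have "ln t2 - ln t1 = ln (t2 / t1)" using t by (simp add: ln_div)
  finally have "exp (ln (u t1)) \<le> exp (ln (u t2) + (\<theta>2 - \<theta>1)\<^sup>2 / (4 * (t2 - t1))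
      + dim / 2 * ln (t2 / t1))" by simp
  also have "\<dots> = u t2 * exp ((\<theta>2 - \<theta>1)\<^sup>2 / (4 * (t2 - t1))) * (t2 / t1) powr (dim / 2)"
    using upos[of t2] t by (simp add: exp_add powr_def)
  finally show ?thesis using upos[of t1] t unfolding u_def end1 end2 by (simp add: mult_ac)
qed

section \<open>From polynomial data to the heat kernel\<close>

definition heat :: "real \<Rightarrow> (real \<Rightarrow> real) \<Rightarrow> real \<Rightarrow> real" where
  "heat t f x = (\<integral>\<theta>. kernel t x (cos \<theta>) * f (cos \<theta>) \<partial>\<mu>)"

lemma continuous_on_cos_comp:
  assumes "continuous_on {-1..1} f" shows "continuous_on A (\<lambda>\<theta>. f (cos \<theta> :: real))"
  by (rule continuous_on_compose2[OF assms]) (auto intro!: continuous_intros)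

lemma integral_tendsto_uniform:
  fixes g :: "real \<Rightarrow> real" and f :: "nat \<Rightarrow> real \<Rightarrow> real"
  assumes g: "continuous_on {0..pi} g"
    and f: "\<And>k. continuous_on {0..pi} (f k)" "continuous_on {0..pi} l"
    and conv: "\<And>k \<theta>. \<theta> \<in> {0..pi} \<Longrightarrow> \<bar>f k \<theta> - l \<theta>\<bar> \<le> C / real (Suc k)"
  shows "(\<lambda>k. \<integral>\<theta>. g \<theta> * f k \<theta> \<partial>\<mu>) \<longlonglongrightarrow> (\<integral>\<theta>. g \<theta> * l \<theta> \<partial>\<mu>)"
proof (rule Lim_null_comparison[THEN Lim_null[THEN iffD2]])
  note int = integrable_mu1[OF a_ge b_ge]
  let ?B = "\<integral>\<theta>. \<bar>g \<theta>\<bar> \<partial>\<mu>"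
  show "\<forall>\<^sub>F k in sequentially. norm ((\<integral>\<theta>. g \<theta> * f k \<theta> \<partial>\<mu>) - (\<integral>\<theta>. g \<theta> * l \<theta> \<partial>\<mu>)) \<le> ?B * (C / real (Suc k))"
  proof (rule always_eventually, rule allI)
    fix k
    have "(\<integral>\<theta>. g \<theta> * f k \<theta> \<partial>\<mu>) - (\<integral>\<theta>. g \<theta> * l \<theta> \<partial>\<mu>) = (\<integral>\<theta>. g \<theta> * f k \<theta> - g \<theta> * l \<theta> \<partial>\<mu>)"
      by (intro Bochner_Integration.integral_diff[symmetric] int continuous_on_mult g f)
    also have "norm \<dots> \<le> (\<integral>\<theta>. norm (g \<theta> * f k \<theta> - g \<theta> * l \<theta>) \<partial>\<mu>)" by (rule integral_norm_bound)
    also have "\<dots> \<le> (\<integral>\<theta>. \<bar>g \<theta>\<bar> * (C / real (Suc k)) \<partial>\<mu>)"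
    proof (rule integral_mono)
      show "integrable \<mu> (\<lambda>\<theta>. norm (g \<theta> * f k \<theta> - g \<theta> * l \<theta>))"
        by (intro int continuous_intros g f)
      show "integrable \<mu> (\<lambda>\<theta>. \<bar>g \<theta>\<bar> * (C / real (Suc k)))"
        by (intro int continuous_on_mult continuous_on_rabs g continuous_on_const)
      fix \<theta> assume "\<theta> \<in> space \<mu>"
      then show "norm (g \<theta> * f k \<theta> - g \<theta> * l \<theta>) \<le> \<bar>g \<theta>\<bar> * (C / real (Suc k))"
        using conv[of \<theta> k] unfolding right_diff_distrib[symmetric] real_norm_def abs_mult
        by (intro mult_left_mono) auto
    qed
    finally show "norm ((\<integral>\<theta>. g \<theta> * f k \<theta> \<partial>\<mu>) - (\<integral>\<theta>. g \<theta> * l \<theta> \<partial>\<mu>)) \<le> ?B * (C / real (Suc k))" by simp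
  qed
  have "(\<lambda>k. C * inverse (real (Suc k))) \<longlonglongrightarrow> C * 0"
    by (intro tendsto_mult tendsto_const LIMSEQ_inverse_real_of_nat)
  then show "(\<lambda>k. ?B * (C / real (Suc k))) \<longlonglongrightarrow> 0"
    using tendsto_mult[OF tendsto_const, of _ "0::real" sequentially ?B] by (simp add: divide_inverse)
qed

text \<open>Li--Yau and its consequences need strictly positive polynomial data. This carries their
  inequalities to nonnegative continuous data, since uniform convergence passes through the kernel
  integral.\<close>

lemma heat_approximation:
  assumes f: "continuous_on {-1..1} f" "\<And>x. x \<in> {-1..1} \<Longrightarrow> f x \<ge> 0"
  obtains c N where "\<And>k x. x \<in> {-1..1} \<Longrightarrow> poly (flow (c k) (N k) 0) x > 0"
    "\<And>t x. t > 0 \<Longrightarrow> x \<in> {-1..1} \<Longrightarrow> (\<lambda>k. poly (flow (c k) (N k) t) x) \<longlonglongrightarrow> heat t f x"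
    "\<And>k x. x \<in> {-1..1} \<Longrightarrow> \<bar>poly (flow (c k) (N k) 0) x - f x\<bar> \<le> 3 / real (Suc k)"
proof -
  obtain p where p: "\<And>k x. x \<in> {-1..1} \<Longrightarrow> poly (p k) x > 0"
    "\<And>k x. x \<in> {-1..1} \<Longrightarrow> \<bar>poly (p k) x - f x\<bar> \<le> 3 / real (Suc k)"
    using weierstrass_positive_polynomials[OF f] by blast
  have "\<forall>k. \<exists>c N. p k = flow c N 0" using exists_flow by blast
  then obtain c N where cN: "\<And>k. p k = flow (c k) (N k) 0" by metis
  show ?thesis
  proof (rule that[of c N])
    show "poly (flow (c k) (N k) 0) x > 0" if "x \<in> {-1..1}" for k x
      using p(1)[OF that] cN by simp
    show "\<bar>poly (flow (c k) (N k) 0) x - f x\<bar> \<le> 3 / real (Suc k)" if "x \<in> {-1..1}" for k x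
      using p(2)[OF that] cN by simp
    fix t x :: real assume tx: "t > 0" "x \<in> {-1..1}"
    have "(\<lambda>k. \<integral>\<theta>. kernel t x (cos \<theta>) * poly (p k) (cos \<theta>) \<partial>\<mu>) \<longlonglongrightarrow> (\<integral>\<theta>. kernel t x (cos \<theta>) * f (cos \<theta>) \<partial>\<mu>)"
    proof (rule integral_tendsto_uniform)
      show "continuous_on {0..pi} (\<lambda>\<theta>. kernel t x (cos \<theta>))" by (rule continuous_on_kernel_cos[OF tx])
      show "continuous_on {0..pi} (\<lambda>\<theta>. poly (p k) (cos \<theta>))" for k by (intro continuous_intros)
      show "continuous_on {0..pi} (\<lambda>\<theta>. f (cos \<theta>))" by (rule continuous_on_cos_comp[OF f(1)])
      show "\<bar>poly (p k) (cos \<theta>) - f (cos \<theta>)\<bar> \<le> 3 / real (Suc k)" for k \<theta> by (rule p(2)) auto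
    qed
    then show "(\<lambda>k. poly (flow (c k) (N k) t) x) \<longlonglongrightarrow> heat t f x"
      unfolding heat_def cN integral_kernel_flow[OF tx] by simp
  qed
qed

lemma heat_nonneg:
  assumes f: "continuous_on {-1..1} f" "\<And>x. x \<in> {-1..1} \<Longrightarrow> f x \<ge> 0" and "t > 0" "x \<in> {-1..1}"
  shows "heat t f x \<ge> 0"
proof -
  obtain c N where cN: "\<And>k x. x \<in> {-1..1} \<Longrightarrow> poly (flow (c k) (N k) 0) x > 0"
    "\<And>t x. t > 0 \<Longrightarrow> x \<in> {-1..1} \<Longrightarrow> (\<lambda>k. poly (flow (c k) (N k) t) x) \<longlonglongrightarrow> heat t f x"
    "\<And>k x. x \<in> {-1..1} \<Longrightarrow> \<bar>poly (flow (c k) (N k) 0) x - f x\<bar> \<le> 3 / real (Suc k)"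
    by (rule heat_approximation[OF f], assumption) (rule that)
  show ?thesis
    by (rule LIMSEQ_le_const[OF cN(2)[OF assms(3,4)]])
       (use less_imp_le[OF flow_positive[OF cN(1)]] assms in auto)
qed

text \<open>Testing \<open>heat_nonneg\<close> against the negative part of \<open>kernel t x\<close> shows that the kernel is nonnegative
  almost everywhere; the semigroup law removes the exceptional set.\<close>

lemma kernel_nonneg_AE:
  assumes "t > 0" "x \<in> {-1..1}"
  shows "AE \<theta> in \<mu>. kernel t x (cos \<theta>) \<ge> 0"
proof -
  define f where "f = (\<lambda>y. max 0 (- kernel t x y))"
  have f: "continuous_on {-1..1} f"
    unfolding f_def by (intro continuous_on_max continuous_on_const continuous_on_minus
        continuous_on_kernel_space assms)
  have int: "integrable \<mu> (\<lambda>\<theta>. (f (cos \<theta>))\<^sup>2)"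
    by (rule integrable_mu1[OF a_ge b_ge continuous_on_power[OF continuous_on_cos_comp[OF f]]])
  have "0 \<le> heat t f x" by (rule heat_nonneg[OF f _ assms]) (simp add: f_def)
  also have "heat t f x = (\<integral>\<theta>. - (f (cos \<theta>))\<^sup>2 \<partial>\<mu>)"
    unfolding heat_def by (intro Bochner_Integration.integral_cong) (auto simp: f_def max_def
        power2_eq_square)
  also have "\<dots> = - (\<integral>\<theta>. (f (cos \<theta>))\<^sup>2 \<partial>\<mu>)" by simp
  finally have "(\<integral>\<theta>. (f (cos \<theta>))\<^sup>2 \<partial>\<mu>) \<le> 0" by simp
  moreover have "0 \<le> (\<integral>\<theta>. (f (cos \<theta>))\<^sup>2 \<partial>\<mu>)" by (rule integral_nonneg_AE) simp
  ultimately have "(\<integral>\<theta>. (f (cos \<theta>))\<^sup>2 \<partial>\<mu>) = 0" by simp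
  then have "AE \<theta> in \<mu>. (f (cos \<theta>))\<^sup>2 = 0"
    using integral_nonneg_eq_0_iff_AE[OF int] by simp
  then show ?thesis by eventually_elim (auto simp: f_def max_def split: if_splits)
qed

lemma kernel_nonneg:
  assumes "t > 0" "x \<in> {-1..1}" "y \<in> {-1..1}"
  shows "kernel t x y \<ge> 0"
proof -
  have "0 \<le> (\<integral>\<theta>. kernel (t/2) x (cos \<theta>) * kernel (t/2) (cos \<theta>) y \<partial>\<mu>)"
  proof (rule integral_nonneg_AE)
    have h: "t / 2 > 0" using assms by simp
    show "AE \<theta> in \<mu>. 0 \<le> kernel (t/2) x (cos \<theta>) * kernel (t/2) (cos \<theta>) y"
      using kernel_nonneg_AE[OF h assms(2)] kernel_nonneg_AE[OF h assms(3)]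
      by eventually_elim (simp add: kernel_sym[of _ _ y])
  qed
  then show ?thesis using kernel_semigroup[of "t/2" "t/2" x y] assms by simp
qed

lemma heat_harnack:
  assumes f: "continuous_on {-1..1} f" "\<And>x. x \<in> {-1..1} \<Longrightarrow> f x \<ge> 0" and t: "0 < t1" "t1 < t2"
  shows "heat t1 f (cos \<theta>1) \<le>
    (t2 / t1) powr (dim / 2) * exp ((\<theta>2 - \<theta>1)\<^sup>2 / (4 * (t2 - t1))) * heat t2 f (cos \<theta>2)"
proof -
  obtain c N where cN: "\<And>k x. x \<in> {-1..1} \<Longrightarrow> poly (flow (c k) (N k) 0) x > 0"
    "\<And>t x. t > 0 \<Longrightarrow> x \<in> {-1..1} \<Longrightarrow> (\<lambda>k. poly (flow (c k) (N k) t) x) \<longlonglongrightarrow> heat t f x"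
    "\<And>k x. x \<in> {-1..1} \<Longrightarrow> \<bar>poly (flow (c k) (N k) 0) x - f x\<bar> \<le> 3 / real (Suc k)"
    by (rule heat_approximation[OF f], assumption) (rule that)
  have cos_in: "cos \<theta> \<in> {-1..1}" for \<theta> :: real by simp
  have t2: "t2 > 0" using t by simp
  show ?thesis
  proof (rule LIMSEQ_le)
    show "(\<lambda>k. poly (flow (c k) (N k) t1) (cos \<theta>1)) \<longlonglongrightarrow> heat t1 f (cos \<theta>1)"
      by (rule cN(2)[OF t(1) cos_in])
    show "(\<lambda>k. (t2 / t1) powr (dim / 2) * exp ((\<theta>2 - \<theta>1)\<^sup>2 / (4 * (t2 - t1))) * poly (flow (c k) (N k)
        t2) (cos \<theta>2))
      \<longlonglongrightarrow> (t2 / t1) powr (dim / 2) * exp ((\<theta>2 - \<theta>1)\<^sup>2 / (4 * (t2 - t1))) * heat t2 f (cos \<theta>2)"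
      by (rule tendsto_mult[OF tendsto_const cN(2)[OF t2 cos_in]])
    show "\<exists>n. \<forall>k\<ge>n. poly (flow (c k) (N k) t1) (cos \<theta>1) \<le>
        (t2 / t1) powr (dim / 2) * exp ((\<theta>2 - \<theta>1)\<^sup>2 / (4 * (t2 - t1))) * poly (flow (c k) (N k) t2) (cos
            \<theta>2)"
      using flow_harnack[OF cN(1) t] by blast
  qed
qed

text \<open>For s > 0 the kernel at time t + s is the evolution over time t of the continuous
  function \<open>kernel s z y\<close> of z. The Harnack constant does not depend on s, so s may
  tend to 0.\<close>

lemma kernel_harnack:
  assumes t: "0 < t1" "t1 < t2" and y: "y \<in> {-1..1}"
  shows "kernel t1 (cos \<theta>1) y \<le>
    (t2 / t1) powr (dim / 2) * exp ((\<theta>2 - \<theta>1)\<^sup>2 / (4 * (t2 - t1))) * kernel t2 (cos \<theta>2) y"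
proof (rule LIMSEQ_le)
  let ?s = "\<lambda>n. inverse (real (Suc n))"
  have lim: "(\<lambda>n. kernel (t + ?s n) x y) \<longlonglongrightarrow> kernel t x y" if "t > 0" "x \<in> {-1..1}" for t x
  proof (rule continuous_on_tendsto_compose[OF continuous_on_kernel_time[OF that(2) y]])
    show "(\<lambda>n. t + ?s n) \<longlonglongrightarrow> t"
      using tendsto_add[OF tendsto_const LIMSEQ_inverse_real_of_nat, of t] by simp
    show "t \<in> {0<..}" "\<forall>\<^sub>F n in sequentially. t + ?s n \<in> {0<..}"
      using that by (auto intro!: always_eventually add_pos_pos)
  qed
  show "(\<lambda>n. kernel (t1 + ?s n) (cos \<theta>1) y) \<longlonglongrightarrow> kernel t1 (cos \<theta>1) y" using t by (intro lim) auto
  show "(\<lambda>n. (t2 / t1) powr (dim / 2) * exp ((\<theta>2 - \<theta>1)\<^sup>2 / (4 * (t2 - t1))) * kernel (t2 + ?s n) (cos \<theta>2) y)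
      \<longlonglongrightarrow> (t2 / t1) powr (dim / 2) * exp ((\<theta>2 - \<theta>1)\<^sup>2 / (4 * (t2 - t1))) * kernel t2 (cos \<theta>2) y"
    using t by (intro tendsto_mult tendsto_const lim) auto
  have heat: "heat t (\<lambda>z. kernel s z y) x = kernel (t + s) x y" if "t > 0" "s > 0" "x \<in> {-1..1}" for t s x
    unfolding heat_def by (rule kernel_semigroup[OF that y])
  show "\<exists>M. \<forall>n\<ge>M. kernel (t1 + ?s n) (cos \<theta>1) y \<le>
      (t2 / t1) powr (dim / 2) * exp ((\<theta>2 - \<theta>1)\<^sup>2 / (4 * (t2 - t1))) * kernel (t2 + ?s n) (cos \<theta>2) y"
  proof (intro exI allI impI)
    fix n
    have s: "?s n > 0" by simp
    have c: "continuous_on {-1..1} (\<lambda>z. kernel (?s n) z y)"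
      using continuous_on_kernel_space[OF s y] by (simp add: kernel_sym[of _ _ y])
    show "kernel (t1 + ?s n) (cos \<theta>1) y \<le>
      (t2 / t1) powr (dim / 2) * exp ((\<theta>2 - \<theta>1)\<^sup>2 / (4 * (t2 - t1))) * kernel (t2 + ?s n) (cos \<theta>2) y"
      using heat_harnack[OF c kernel_nonneg[OF s _ y] t, of \<theta>1 \<theta>2] t s
      by (simp add: heat)
  qed
qed

text \<open>Harnack at equal angles, where the exponential factor is 1.\<close>

lemma kernel_mono:
  assumes "0 < t" "t \<le> s" "x \<in> {-1..1}" "y \<in> {-1..1}"
  shows "t powr (dim / 2) * kernel t x y \<le> s powr (dim / 2) * kernel s x y"
proof (cases "t = s")
  case False
  have "cos (arccos x) = x" using assms by simp
  then have "kernel t x y \<le> (s / t) powr (dim / 2) * kernel s x y"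
    using kernel_harnack[of t s y "arccos x" "arccos x"] assms False by simp
  then have "t powr (dim / 2) * kernel t x y \<le> t powr (dim / 2) * ((s / t) powr (dim / 2) * kernel s x y)"
    by (intro mult_left_mono) auto
  also have "\<dots> = s powr (dim / 2) * kernel s x y" using assms by (simp add: powr_divide)
  finally show ?thesis .
qed simp

lemma heat_family_trig: "heat_family \<mu> (\<lambda>t \<theta> \<phi>. kernel t (cos \<theta>) (cos \<phi>)) (dim / 2)"
proof (intro heat_family.intro heat_family_axioms.intro)
  show "finite_measure \<mu>" by unfold_locales
  show "dim / 2 \<ge> 0" using dim_ge by simp
  fix t :: real assume t: "t > 0"
  have id: "(\<lambda>x. x) \<in> \<mu> \<rightarrow>\<^sub>M borel" by (rule borel_measurable_mu1) simp
  have [measurable]: "(\<lambda>z. (cos (fst z), cos (snd z))) \<in> (\<mu> \<Otimes>\<^sub>M \<mu>) \<rightarrow>\<^sub>M (borel \<Otimes>\<^sub>M borel)"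
    using measurable_compose[OF measurable_fst id] measurable_compose[OF measurable_snd id] by measurable
  show "(\<lambda>z. kernel t (cos (fst z)) (cos (snd z))) \<in> borel_measurable (\<mu> \<Otimes>\<^sub>M \<mu>)"
    using measurable_compose[OF _ kernel_measurable_borel[of t], of "\<lambda>z. (cos (fst z), cos (snd z))"]
        by simp
  show "\<exists>B. \<forall>\<theta>\<in>space \<mu>. \<forall>\<phi>\<in>space \<mu>. kernel t (cos \<theta>) (cos \<phi>) \<le> B"
    using abs_kernel_le[OF order_refl t] by (intro exI[of _ "kernel_bound t"]) (auto simp: abs_le_iff)
  fix \<theta> \<phi> :: real
  show "0 \<le> kernel t (cos \<theta>) (cos \<phi>)" by (rule kernel_nonneg[OF t]) auto
  show "kernel t (cos \<theta>) (cos \<phi>) = kernel t (cos \<phi>) (cos \<theta>)" by (rule kernel_sym)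
  show "(\<integral>\<phi>. kernel t (cos \<theta>) (cos \<phi>) \<partial>\<mu>) \<le> 1" using kernel_mass[OF t] by simp
  show "(\<integral>z. kernel t (cos \<theta>) (cos z) * kernel s (cos z) (cos \<phi>) \<partial>\<mu>) = kernel (t
      + s) (cos \<theta>) (cos \<phi>)" if "s > 0" for s
    by (rule kernel_semigroup[OF t that]) auto
  show "t powr (dim / 2) * kernel t (cos \<theta>) (cos \<phi>) \<le> s powr (dim / 2) * kernel s (cos \<theta>) (cos \<phi>)" if "t
      \<le> s" for s
    by (rule kernel_mono[OF t that]) auto
qed

end

section \<open>Change of variables between the three settings\<close>

lemma space_rho1 [simp]: "space (rho1 a b) = {-1..1}"
  by (simp add: rho1_def space_restrict_space)

lemma sets_rho1 [measurable_cong]: "sets (rho1 a b) = sets (restrict_space borel {-1..1})"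
  by (simp add: rho1_def sets_restrict_space)

lemma jacobi_weight_substitution:
  assumes "\<theta> \<in> {0..pi}"
  shows "(1 - cos \<theta>) powr a * (1 + cos \<theta>) powr b * sin \<theta> = 2 powr (a + b + 1) * jacobi_weight a b \<theta>"
proof -
  define S C where "S = sin (\<theta> / 2)" and "C = cos (\<theta> / 2)"
  have nn: "S \<ge> 0" "C \<ge> 0" unfolding S_def C_def using sin_cos_half_nonneg[OF assms] by auto
  have "cos \<theta> = 2 * C\<^sup>2 - 1" "cos \<theta> = 1 - 2 * S\<^sup>2" and sin: "sin \<theta> = 2 * S * C"
    using cos_double_cos[of "\<theta> / 2"] cos_double_sin[of "\<theta> / 2"] sin_double[of "\<theta> / 2"]
    unfolding S_def C_def by auto
  then have cos: "1 + cos \<theta> = 2 * C\<^sup>2" "1 - cos \<theta> = 2 * S\<^sup>2" by linarith+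
  show ?thesis
  proof (cases "S = 0 \<or> C = 0")
    case True
    then show ?thesis unfolding jacobi_weight_def sin S_def[symmetric] C_def[symmetric] by auto
  next
    case False
    then have pos: "S > 0" "C > 0" using nn by auto
    have p: "(2 * x\<^sup>2) powr c * x = 2 powr c * x powr (2 * c + 1)" if "x > 0" for x c :: real
    proof -
      have "(x\<^sup>2) powr c = (x powr 2) powr c" using that by simp
      also have "\<dots> = x powr (2 * c)" by (rule powr_powr)
      finally have "(2 * x\<^sup>2) powr c = 2 powr c * x powr (2 * c)" using that by (simp add: powr_mult)
      moreover have "x powr (2 * c + 1) = x powr (2 * c) * x" using that by (simp add: powr_add)
      ultimately show ?thesis by simp
    qed
    have "(1 - cos \<theta>) powr a * (1 + cos \<theta>) powr b * sin \<theta>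
        = 2 * (((2 * S\<^sup>2) powr a * S) * ((2 * C\<^sup>2) powr b * C))"
      unfolding cos sin by simp
    also have "\<dots> = (2 powr a * 2 powr b * 2) * (S powr (2 * a + 1) * C powr (2 * b + 1))"
      unfolding p[OF pos(1)] p[OF pos(2)] by simp
    also have "2 powr a * 2 powr b * 2 = 2 powr (a + b + 1)" by (simp add: powr_add)
    finally show ?thesis unfolding jacobi_weight_def S_def C_def .
  qed
qed

lemma emeasure_rho1:
  assumes A: "A \<in> sets (rho1 a b)"
  shows "emeasure (rho1 a b) A = ennreal (2 powr (a + b + 1)) * emeasure (mu1 a b) (cos -` A \<inter> {0..pi})"
proof -
  have A': "A \<in> sets borel" "A \<subseteq> {-1..1}"
    using A by (auto simp: sets_rho1 sets_restrict_space)
  have Ar: "A \<in> sets (restrict_space lborel {-1..1})" using A by (simp add: sets_rho1 sets_restrict_space)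
  have [measurable]: "A \<in> sets borel" by (rule A')
  let ?w = "\<lambda>x. (1 - x) powr a * (1 + x) powr b"
  \<comment> \<open>The substitution rule asks for an increasing map. Reflecting x to - x first
    allows the use of - cos on [0, pi].\<close>
  let ?f = "\<lambda>x. ?w (- x) * indicator A (- x)"
  have meas: "cos -` A \<inter> {0..pi} \<in> sets borel"
  proof -
    have "cos -` A \<inter> space borel \<in> sets borel" by (rule measurable_sets[of cos borel borel]) auto
    then show ?thesis by auto
  qed
  have Br: "cos -` A \<inter> {0..pi} \<in> sets (restrict_space lborel {0..pi})"
    using meas by (auto simp: sets_restrict_space intro!: image_eqI[of _ _ "cos -` A \<inter> {0..pi}"])
  have "emeasure (rho1 a b) A = (\<integral>\<^sup>+x. ennreal (?w x * indicator A x) * indicator {-1..1} x \<partial>lborel)"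
    unfolding rho1_def using Ar
    by (subst emeasure_density) (auto simp: nn_integral_restrict_space measurable_restrict_space1
        intro!: nn_integral_cong split: split_indicator)
  also have "\<dots> = (\<integral>\<^sup>+x. ennreal (?f x) * indicator {-1..1} x \<partial>lborel)"
    by (subst nn_integral_real_affine[where c="-1" and t=0])
       (auto intro!: nn_integral_cong split: split_indicator)
  also have "\<dots> = (\<integral>\<^sup>+x. ennreal (?f x * indicator {(- cos 0)..(- cos pi)} x) \<partial>lborel)"
    by (intro nn_integral_cong) (auto split: split_indicator)
  also have "\<dots> = (\<integral>\<^sup>+\<theta>. ennreal (?f (- cos \<theta>) * sin \<theta> * indicator {0..pi} \<theta>) \<partial>lborel)"
  proof (rule nn_integral_substitution[where f="?f" and g="\<lambda>\<theta>. - cos \<theta>" and g'=sin and a=0 and b=pi])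
    show "set_borel_measurable borel {- cos 0..- cos pi} ?f"
      unfolding set_borel_measurable_def by measurable
  qed (auto intro!: derivative_eq_intros continuous_intros sin_ge_zero)
  also have "\<dots> = (\<integral>\<^sup>+\<theta>. ennreal (2 powr (a + b + 1)) * (ennreal (jacobi_weight a b \<theta> * indicator (cos -`
      A \<inter> {0..pi}) \<theta>) * indicator {0..pi} \<theta>) \<partial>lborel)"
  proof (intro nn_integral_cong)
    fix \<theta> :: real
    show "ennreal (?f (- cos \<theta>) * sin \<theta> * indicator {0..pi} \<theta>) =
        ennreal (2 powr (a + b + 1)) * (ennreal (jacobi_weight a b \<theta> * indicator (cos -` A \<inter> {0..pi}) \<theta>)
            * indicator {0..pi} \<theta>)"
      using jacobi_weight_substitution[of \<theta> a b]
      by (cases "\<theta> \<in> {0..pi}"; cases "cos \<theta> \<in> A") (auto simp: ennreal_mult[symmetric])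
  qed
  also have "\<dots> = ennreal (2 powr (a + b + 1)) * (\<integral>\<^sup>+\<theta>. ennreal (jacobi_weight a b \<theta> * indicator (cos -`
      A \<inter> {0..pi}) \<theta>) * indicator {0..pi} \<theta> \<partial>lborel)"
    using meas by (intro nn_integral_cmult) measurable
  also have "(\<integral>\<^sup>+\<theta>. ennreal (jacobi_weight a b \<theta> * indicator (cos -` A \<inter> {0..pi}) \<theta>) * indicator {0..pi}
      \<theta> \<partial>lborel)
      = emeasure (mu1 a b) (cos -` A \<inter> {0..pi})"
    unfolding mu1_eq using Br
    by (subst emeasure_density) (auto simp: nn_integral_restrict_space measurable_restrict_space1
        intro!: nn_integral_cong split: split_indicator)
  finally show ?thesis .
qed

lemma cos_measurable_mu1: "cos \<in> mu1 a b \<rightarrow>\<^sub>M restrict_space borel {-1..1}"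
  by (intro measurable_restrict_space2 borel_measurable_mu1) auto

lemma rho1_eq_distr:
  "rho1 a b = density (distr (mu1 a b) (restrict_space borel {-1..1}) cos) (\<lambda>_. ennreal (2 powr (a + b
      + 1)))"
proof (rule measure_eqI)
  show "sets (rho1 a b) = sets (density (distr (mu1 a b) (restrict_space borel {-1..1}) cos) (\<lambda>_.
      ennreal (2 powr (a + b + 1))))"
    by (simp add: sets_rho1)
  fix A assume A: "A \<in> sets (rho1 a b)"
  then have A': "A \<in> sets (restrict_space borel {-1..1})" by (simp add: sets_rho1)
  then show "emeasure (rho1 a b) A = emeasure (density (distr (mu1 a b) (restrict_space borel {-1..1})
      cos) (\<lambda>_. ennreal (2 powr (a + b + 1)))) A"
    unfolding emeasure_rho1[OF A]
    by (simp add: emeasure_density nn_integral_cmult_indicator emeasure_distr[OF cos_measurable_mu1])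
qed

lemma integral_rho1:
  fixes f :: "real \<Rightarrow> real"
  assumes "f \<in> borel_measurable (rho1 a b)"
  shows "(\<integral>x. f x \<partial>rho1 a b) = 2 powr (a + b + 1) * (\<integral>\<theta>. f (cos \<theta>) \<partial>mu1 a b)"
proof -
  have f: "f \<in> borel_measurable (restrict_space borel {-1..1})"
    using assms by (simp add: measurable_cong_sets[OF sets_rho1 refl])
  have "(\<integral>x. f x \<partial>rho1 a b) = 2 powr (a + b + 1) * (\<integral>x. f x \<partial>distr (mu1 a b) (restrict_space borel
      {-1..1}) cos)"
    unfolding rho1_eq_distr using f by (subst integral_density) auto
  also have "\<dots> = 2 powr (a + b + 1) * (\<integral>\<theta>. f (cos \<theta>) \<partial>mu1 a b)"
    by (subst integral_distr[OF cos_measurable_mu1 f]) simp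
  finally show ?thesis .
qed

lemma borel_measurable_rho1_continuous:
  fixes f :: "real \<Rightarrow> real"
  shows "continuous_on {-1..1} f \<Longrightarrow> f \<in> borel_measurable (rho1 a b)"
  by (simp add: borel_measurable_continuous_on_restrict measurable_cong_sets[OF sets_rho1 refl])

lemma jacobi_h_eq: "jacobi_h a b n = 2 powr (a + b + 1) * jacobi_norm a b n"
proof -
  have m: "(\<lambda>x. (poly (jacobi_poly a b n) x)\<^sup>2) \<in> borel_measurable (rho1 a b)"
    by (intro borel_measurable_rho1_continuous continuous_intros)
  have "jacobi_h a b n = (\<integral>x. (poly (jacobi_poly a b n) x)\<^sup>2 \<partial>rho1 a b)"
    unfolding jacobi_h_def rho1_def
    using m by (subst integral_density)
      (auto simp: rho1_def integral_restrict_space set_lebesgue_integral_def measurable_restrict_space1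
          mult_ac)
  also have "\<dots> = 2 powr (a + b + 1) * jacobi_norm a b n"
    unfolding jacobi_norm_def by (rule integral_rho1[OF m])
  finally show ?thesis .
qed

context jacobi
begin

lemma G1_eq: "x \<in> {-1..1} \<Longrightarrow> y \<in> {-1..1} \<Longrightarrow> t > 0 \<Longrightarrow> G1 a b t x y = kernel t x y / 2 powr (a + b + 1)"
  unfolding G1_def kernel_def jacobi_h_eq
  by (subst suminf_divide[symmetric, OF summable_kernel])
     (auto simp: jacobi_eigenvalue_def algebra_simps)

lemma jacobi_trig_mult:
  "jacobi_trig a b n \<theta> * jacobi_trig a b n \<phi> = poly (P n) (cos \<theta>) * poly (P n) (cos \<phi>) / nrm n"
proof -
  have n: "nrm n > 0" by (rule jacobi_norm_pos[OF a_ge b_ge])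
  let ?c = "2 powr (a + b + 1) :: real"
  have h: "jacobi_h a b n > 0" unfolding jacobi_h_eq using n by simp
  have 1: "2 powr ((a + b + 1) / 2) * 2 powr ((a + b + 1) / 2) = ?c"
    unfolding powr_add[symmetric] by simp
  have "jacobi_h a b n powr (- 1 / 2) * jacobi_h a b n powr (- 1 / 2) = jacobi_h a b n powr - 1"
    unfolding powr_add[symmetric] by simp
  then have 2: "jacobi_h a b n powr (- 1 / 2) * jacobi_h a b n powr (- 1 / 2) = 1 / jacobi_h a b n"
    using h by (simp add: powr_minus_divide)
  have "jacobi_trig a b n \<theta> * jacobi_trig a b n \<phi> = (2 powr ((a + b + 1) / 2) * 2 powr ((a + b + 1) / 2)) *
      (jacobi_h a b n powr (- 1 / 2) * jacobi_h a b n powr (- 1 / 2)) * (poly (P n) (cos \<theta>) * poly (P n)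
          (cos \<phi>))"
    unfolding jacobi_trig_def by (simp only: mult_ac)
  also have "\<dots> = poly (P n) (cos \<theta>) * poly (P n) (cos \<phi>) / nrm n"
    unfolding 1 2 by (simp add: jacobi_h_eq)
  finally show ?thesis .
qed

lemma G1_trig_eq:
  assumes "t > 0"
  shows "G1_trig a b t \<theta> \<phi> = exp (- t * ((a + b + 1) / 2)\<^sup>2) * kernel t (cos \<theta>) (cos \<phi>)"
proof -
  \<comment> \<open>The square of n + (a + b + 1) / 2 is the eigenvalue plus ((a + b + 1) /
    2)^2.\<close>
  have e: "exp (- t * (real n + (a + b + 1) / 2)\<^sup>2) = exp (- t * ((a + b
      + 1) / 2)\<^sup>2) * exp (- t * ev n)" for n
    unfolding exp_add[symmetric] jacobi_eigenvalue_def by (simp add: power2_eq_square algebra_simps)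
  have "G1_trig a b t \<theta> \<phi> = (\<Sum>n. exp (- t * ((a + b
      + 1) / 2)\<^sup>2) * (exp (- t * ev n) * (poly (P n) (cos \<theta>) * poly (P n) (cos \<phi>) / nrm n)))"
    unfolding G1_trig_def mult.assoc jacobi_trig_mult e by (simp only: mult.assoc)
  also have "\<dots> = exp (- t * ((a + b + 1) / 2)\<^sup>2) * kernel t (cos \<theta>) (cos \<phi>)"
    unfolding kernel_def using assms by (intro suminf_mult summable_kernel) auto
  finally show ?thesis .
qed

text \<open>The square root of the density of \<open>mu1\<close> on [0, pi]; multiplying by it
  passes from L^2 of that measure to L^2(d\<theta>).\<close>

definition root_weight :: "real \<Rightarrow> real" where
  "root_weight \<theta> = sin (\<theta> / 2) powr (a + 1 / 2) * cos (\<theta> / 2) powr (b + 1 / 2)"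

lemma G1_phi_eq:
  assumes "t > 0"
  shows "G1_phi a b t \<theta> \<phi> = exp (- t * ((a + b + 1) / 2)\<^sup>2) * (root_weight \<theta> * root_weight \<phi> * kernel t
      (cos \<theta>) (cos \<phi>))"
proof -
  have e: "exp (- t * (real n + (a + b + 1) / 2)\<^sup>2) = exp (- t * ((a + b
      + 1) / 2)\<^sup>2) * exp (- t * ev n)" for n
    unfolding exp_add[symmetric] jacobi_eigenvalue_def by (simp add: power2_eq_square algebra_simps)
  have p: "jacobi_phi a b n \<theta> * jacobi_phi a b n \<phi>
      = root_weight \<theta> * root_weight \<phi> * (poly (P n) (cos \<theta>) * poly (P n) (cos \<phi>) / nrm n)" for n
    unfolding jacobi_trig_mult[symmetric] jacobi_phi_def root_weight_def by (simp only: mult_ac)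
  have "G1_phi a b t \<theta> \<phi> = (\<Sum>n. exp (- t * ((a + b
      + 1) / 2)\<^sup>2) * (root_weight \<theta> * root_weight \<phi>) * (exp (- t * ev n) * (poly (P n) (cos \<theta>) * poly (P
      n) (cos \<phi>) / nrm n)))"
    unfolding G1_phi_def
  proof (rule suminf_cong)
    fix n
    have "exp (- t * (real n + (a + b + 1) / 2)\<^sup>2) * jacobi_phi a b n \<theta> * jacobi_phi a b n \<phi>
        = exp (- t * (real n + (a + b + 1) / 2)\<^sup>2) * (jacobi_phi a b n \<theta> * jacobi_phi a b n \<phi>)"
      by (rule mult.assoc)
    then show "exp (- t * (real n + (a + b + 1) / 2)\<^sup>2) * jacobi_phi a b n \<theta> * jacobi_phi a b n \<phi>
        = exp (- t * ((a + b + 1) / 2)\<^sup>2) * (root_weight \<theta> * root_weight \<phi>) * (exp (- t * ev n) * (poly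
            (P n) (cos \<theta>) * poly (P n) (cos \<phi>) / nrm n))"
      unfolding p e by (simp only: mult_ac)
  qed
  also have "\<dots> = exp (- t * ((a + b + 1) / 2)\<^sup>2) * (root_weight \<theta> * root_weight \<phi>) * kernel t (cos \<theta>)
      (cos \<phi>)"
    unfolding kernel_def using assms by (intro suminf_mult summable_kernel) auto
  finally show ?thesis by (simp only: mult.assoc)
qed

lemma heat_family_rho1: "heat_family (rho1 a b) (G1 a b) (dim / 2)"
proof (intro heat_family.intro heat_family_axioms.intro)
  let ?c = "2 powr (a + b + 1) :: real"
  show "finite_measure (rho1 a b)"
  proof
    have "{-1..1} \<in> sets (rho1 a b)" using sets.top[of "rho1 a b"] by simp
    then show "emeasure (rho1 a b) (space (rho1 a b)) \<noteq> \<infinity>"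
      by (simp add: emeasure_rho1 ennreal_mult_eq_top_iff)
  qed
  show "dim / 2 \<ge> 0" using dim_ge by simp
  fix t :: real assume t: "t > 0"
  have id: "(\<lambda>x. x) \<in> rho1 a b \<rightarrow>\<^sub>M borel"
    by (simp add: measurable_cong_sets[OF sets_rho1 refl] measurable_restrict_space1)
  have [measurable]: "poly (P n) \<in> borel_measurable borel" for n
    by (intro borel_measurable_continuous_onI continuous_intros)
  have [measurable]: "fst \<in> (rho1 a b \<Otimes>\<^sub>M rho1 a b) \<rightarrow>\<^sub>M borel" "snd \<in> (rho1 a b \<Otimes>\<^sub>M rho1 a b) \<rightarrow>\<^sub>M borel"
    using measurable_compose[OF measurable_fst id] measurable_compose[OF measurable_snd id] by auto
  show "(\<lambda>z. G1 a b t (fst z) (snd z)) \<in> borel_measurable (rho1 a b \<Otimes>\<^sub>M rho1 a b)"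
    unfolding G1_def by measurable
  show "\<exists>B. \<forall>x\<in>space (rho1 a b). \<forall>y\<in>space (rho1 a b). G1 a b t x y \<le> B"
  proof (intro exI ballI)
    fix x y assume "x \<in> space (rho1 a b)" "y \<in> space (rho1 a b)"
    then show "G1 a b t x y \<le> kernel_bound t / ?c"
      using abs_kernel_le[OF order_refl t, of x y] t
          by (auto simp: G1_eq abs_le_iff intro!: divide_right_mono)
  qed
  fix x assume "x \<in> space (rho1 a b)"
  then have x: "x \<in> {-1..1}" by simp
  have m: "G1 a b t x \<in> borel_measurable (rho1 a b)" if "t > 0" "x \<in> {-1..1}" for t x
  proof -
    have "continuous_on {-1..1} (\<lambda>y. kernel t x y / ?c)"
        by (intro continuous_intros continuous_on_kernel_space that) auto
    moreover have "continuous_on {-1..1} (G1 a b t x) \<longleftrightarrow> continuous_on {-1..1} (\<lambda>y. kernel t x y / ?c)"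
      using that by (intro continuous_on_cong refl G1_eq) auto
    ultimately have "continuous_on {-1..1} (G1 a b t x)" by simp
    then show ?thesis by (rule borel_measurable_rho1_continuous)
  qed
  have "(\<integral>y. G1 a b t x y \<partial>rho1 a b) = ?c * (\<integral>\<theta>. G1 a b t x (cos \<theta>) \<partial>\<mu>)"
      by (rule integral_rho1[OF m[OF t x]])
  also have "\<dots> = 1" using kernel_mass[OF t x] x t by (simp add: G1_eq)
  finally show "(\<integral>y. G1 a b t x y \<partial>rho1 a b) \<le> 1" by simp
  fix y assume "y \<in> space (rho1 a b)"
  then have y: "y \<in> {-1..1}" by simp
  show "0 \<le> G1 a b t x y" using kernel_nonneg[OF t x y] t x y by (simp add: G1_eq)
  show "G1 a b t x y = G1 a b t y x" using t x y by (simp add: G1_eq kernel_sym)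
  show "t powr (dim / 2) * G1 a b t x y \<le> s powr (dim / 2) * G1 a b s x y" if "t \<le> s" for s
    using kernel_mono[OF t that x y] t that x y by (simp add: G1_eq divide_right_mono)
  show "(\<integral>z. G1 a b t x z * G1 a b s z y \<partial>rho1 a b) = G1 a b (t + s) x y" if s: "s > 0" for s
  proof -
    have "(\<integral>z. G1 a b t x z * G1 a b s z y \<partial>rho1 a b) = (\<integral>z. G1 a b t x z * G1 a b s y z \<partial>rho1 a b)"
      using s y by (intro Bochner_Integration.integral_cong refl) (simp add: G1_eq kernel_sym)
    also have "\<dots> = ?c * (\<integral>\<theta>. G1 a b t x (cos \<theta>) * G1 a b s y (cos \<theta>) \<partial>\<mu>)"
      using m[OF t x] m[OF s y] by (intro integral_rho1) simp
    also have "\<dots> = ?c * (\<integral>\<theta>. (kernel t x (cos \<theta>) * kernel s (cos \<theta>) y) * (1 / (?c * ?c)) \<partial>\<mu>)"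
      using s t x y by (simp add: G1_eq kernel_sym[of s _ y])
    also have "\<dots> = ?c * ((\<integral>\<theta>. kernel t x (cos \<theta>) * kernel s (cos \<theta>) y \<partial>\<mu>) * (1 / (?c * ?c)))"
      by (subst integral_mult_left_zero) simp
    also have "\<dots> = G1 a b (t + s) x y"
      unfolding kernel_semigroup[OF t s x y] using s t x y by (simp add: G1_eq)
    finally show ?thesis .
  qed
qed

end

section \<open>Gaussian upper bound\<close>

context jacobi
begin

text \<open>Davies' exponential perturbation: an L^2 pairing with weight exp (2 l \<theta>), whose
  free parameter l is optimised in \<open>kernel_gaussian_bound\<close>. The grouping matches the g
  of \<open>jacobi_integration_by_parts\<close>.\<close>

definition weighted_form :: "real \<Rightarrow> real poly \<Rightarrow> real poly \<Rightarrow> real" where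
  "weighted_form l p q = (\<integral>\<theta>. poly p (cos \<theta>) * (poly q (cos \<theta>) * exp (2 * l * \<theta>)) \<partial>\<mu>)"

lemma weighted_form_integrable:
  "integrable \<mu> (\<lambda>\<theta>. poly p (cos \<theta>) * (poly q (cos \<theta>) * exp (2 * l * \<theta>)))"
  by (intro integrable_mu1 a_ge b_ge continuous_intros)

lemma weighted_form_sym: "weighted_form l p q = weighted_form l q p"
  unfolding weighted_form_def by (simp add: mult_ac)

lemma weighted_form_sum:
  "weighted_form l (\<Sum>n\<le>N. smult (c n) (P n)) q = (\<Sum>n\<le>N. c n * weighted_form l (P n) q)"
proof -
  have "weighted_form l (\<Sum>n\<le>N. smult (c n) (P n)) q =
    (\<integral>\<theta>. (\<Sum>n\<le>N. c n * (poly (P n) (cos \<theta>) * (poly q (cos \<theta>) * exp (2 * l * \<theta>)))) \<partial>\<mu>)"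
    unfolding weighted_form_def by (simp add: poly_sum sum_distrib_right mult.assoc)
  also have "\<dots> = (\<Sum>n\<le>N. c n * weighted_form l (P n) q)"
    unfolding weighted_form_def
    by (subst Bochner_Integration.integral_sum) (auto intro!: integrable_mult_right
        weighted_form_integrable)
  finally show ?thesis .
qed

lemma weighted_form_sum2:
  "weighted_form l (\<Sum>n\<le>N. smult (c n) (P n)) (\<Sum>n\<le>N. smult (d n) (P n)) =
    (\<Sum>n\<le>N. \<Sum>m\<le>N. c n * d m * weighted_form l (P n) (P m))"
proof -
  have "weighted_form l (P n) (\<Sum>m\<le>N. smult (d m) (P m)) = (\<Sum>m\<le>N. d m * weighted_form l (P n) (P m))" for n
    unfolding weighted_form_sym[of l "P n"] by (rule weighted_form_sum)
  then show ?thesis unfolding weighted_form_sum by (simp only: sum_distrib_left mult.assoc)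
qed

text \<open>In the Jacobi basis the energy is a finite double sum of exponentials in t, so no
  derivative passes under an integral. The factor 2 comes from the symmetry of the pairing.\<close>

lemma weighted_energy_derivative:
  "((\<lambda>t. weighted_form l (flow c N t) (flow c N t)) has_real_derivative
    2 * weighted_form l (jacobi_op a b (flow c N t)) (flow c N t)) (at t)"
proof -
  let ?e = "\<lambda>t n. c n * exp (- t * ev n)"
  let ?d = "\<lambda>t n. c n * (- ev n * exp (- t * ev n))"
  have E: "((\<lambda>t. ?e t n) has_real_derivative ?d t n) (at t)" for t n
    by (auto intro!: derivative_eq_intros)
  have "((\<lambda>t. weighted_form l (flow c N t) (flow c N t)) has_real_derivative
      (\<Sum>n\<le>N. \<Sum>m\<le>N. (?d t n * ?e t m + ?d t m * ?e t n) * weighted_form l (P n) (P m))) (at t)"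
    unfolding flow_def weighted_form_sum2 by (intro DERIV_sum DERIV_cmult_right DERIV_mult E)
  moreover have "(\<Sum>n\<le>N. \<Sum>m\<le>N. (?d t n * ?e t m + ?d t m * ?e t n) * weighted_form l (P n) (P m)) =
      weighted_form l (jacobi_op a b (flow c N t)) (flow c N t)
          + weighted_form l (jacobi_op a b (flow c N t)) (flow c N t)"
  proof -
    have "(\<Sum>n\<le>N. \<Sum>m\<le>N. ?d t n * ?e t m * weighted_form l (P n) (P m)) =
        weighted_form l (jacobi_op a b (flow c N t)) (flow c N t)"
      unfolding jacobi_op_flow unfolding flow_def weighted_form_sum2 ..
    moreover have "(\<Sum>n\<le>N. \<Sum>m\<le>N. ?e t n * ?d t m * weighted_form l (P n) (P m)) =
        weighted_form l (flow c N t) (jacobi_op a b (flow c N t))"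
      unfolding jacobi_op_flow unfolding flow_def weighted_form_sum2 ..
    moreover have "(\<Sum>n\<le>N. \<Sum>m\<le>N. (?d t n * ?e t m + ?d t m * ?e t n) * weighted_form l (P n) (P m)) =
      (\<Sum>n\<le>N. \<Sum>m\<le>N. ?d t n * ?e t m * weighted_form l (P n) (P m)) +
      (\<Sum>n\<le>N. \<Sum>m\<le>N. ?e t n * ?d t m * weighted_form l (P n) (P m))"
      unfolding sum.distrib[symmetric] by (intro sum.cong refl) algebra
    ultimately show ?thesis using weighted_form_sym by simp
  qed
  ultimately show ?thesis by simp
qed

text \<open>With w = p'(cos \<theta>) sin \<theta> and u = p(cos \<theta>), integration by parts
  leaves - w^2 + 2 l u w under the weight, and completing the square bounds this by l^2 u^2.\<close>

lemma weighted_dissipation: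
  "weighted_form l (jacobi_op a b p) p \<le> l\<^sup>2 * weighted_form l p p"
proof -
  let ?u = "\<lambda>\<theta>. poly p (cos \<theta>)" and ?v = "\<lambda>\<theta>. poly (pderiv p) (cos \<theta>)" and ?e = "\<lambda>\<theta>. exp (2 * l * \<theta>)"
  have "weighted_form l (jacobi_op a b p) p = (\<integral>\<theta>. ?v \<theta> * sin \<theta> * ((- (?v \<theta> * sin \<theta>)
      + 2 * l * ?u \<theta>) * ?e \<theta>) \<partial>\<mu>)"
    unfolding weighted_form_def
  proof (rule jacobi_integration_by_parts[OF a_ge b_ge])
    fix \<theta>
    have u: "(?u has_real_derivative - (?v \<theta> * sin \<theta>)) (at \<theta>)"
      by (rule DERIV_cong[OF DERIV_chain2[OF poly_DERIV DERIV_cos]]) simp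
    have e: "(?e has_real_derivative 2 * l * ?e \<theta>) (at \<theta>)" by (auto intro!: derivative_eq_intros)
    show "((\<lambda>\<theta>. ?u \<theta> * ?e \<theta>) has_real_derivative (- (?v \<theta> * sin \<theta>) + 2 * l * ?u \<theta>) * ?e \<theta>) (at \<theta>)"
      by (rule DERIV_cong[OF DERIV_mult[OF u e]]) (simp add: algebra_simps)
  qed (intro continuous_intros)+
  also have "\<dots> \<le> (\<integral>\<theta>. l\<^sup>2 * (?u \<theta> * (?u \<theta> * ?e \<theta>)) \<partial>\<mu>)"
  proof (rule integral_mono)
    show "integrable \<mu> (\<lambda>\<theta>. ?v \<theta> * sin \<theta> * ((- (?v \<theta> * sin \<theta>) + 2 * l * ?u \<theta>) * ?e \<theta>))"
      by (intro integrable_mu1 a_ge b_ge continuous_intros)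
    show "integrable \<mu> (\<lambda>\<theta>. l\<^sup>2 * (?u \<theta> * (?u \<theta> * ?e \<theta>)))"
      by (intro integrable_mu1 a_ge b_ge continuous_intros)
    fix \<theta>
    have "0 \<le> (?v \<theta> * sin \<theta> - l * ?u \<theta>)\<^sup>2" by simp
    then have "?v \<theta> * sin \<theta> * (- (?v \<theta> * sin \<theta>) + 2 * l * ?u \<theta>) \<le> l\<^sup>2 * (?u \<theta> * ?u \<theta>)"
      by (simp add: power2_eq_square algebra_simps)
    then have "?v \<theta> * sin \<theta> * (- (?v \<theta> * sin \<theta>) + 2 * l * ?u \<theta>) * ?e \<theta> \<le> l\<^sup>2 * (?u \<theta> * ?u \<theta>) * ?e \<theta>"
      by (rule mult_right_mono) simp
    then show "?v \<theta> * sin \<theta> * ((- (?v \<theta> * sin \<theta>) + 2 * l * ?u \<theta>) * ?e \<theta>) \<le> l\<^sup>2 * (?u \<theta> * (?u \<theta> * ?e \<theta>))"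
      by (simp only: mult.assoc)
  qed
  also have "\<dots> = l\<^sup>2 * weighted_form l p p" unfolding weighted_form_def by simp
  finally show ?thesis .
qed

lemma weighted_energy_growth:
  assumes "t \<ge> 0"
  shows "weighted_form l (flow c N t) (flow c N t)
      \<le> exp (2 * l\<^sup>2 * t) * weighted_form l (flow c N 0) (flow c N 0)"
proof -
  let ?E = "\<lambda>t. weighted_form l (flow c N t) (flow c N t)"
  define f where "f = (\<lambda>t. ?E t * exp (- (2 * l\<^sup>2) * t))"
  have "f t \<le> f 0"
  proof (rule DERIV_nonpos_imp_nonincreasing[where f=f and a=0 and b=t, OF assms])
    fix s
    have d: "(f has_real_derivative 2 * weighted_form l (jacobi_op a b (flow c N s)) (flow c N s) * exp
        (- (2 * l\<^sup>2) * s)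
        + (- (2 * l\<^sup>2) * exp (- (2 * l\<^sup>2) * s)) * ?E s) (at s)"
      unfolding f_def by (rule DERIV_mult[OF weighted_energy_derivative]) (auto intro!:
          derivative_eq_intros)
    have "2 * weighted_form l (jacobi_op a b (flow c N s)) (flow c N s) * exp (- (2 * l\<^sup>2) * s)
        + (- (2 * l\<^sup>2) * exp (- (2 * l\<^sup>2) * s)) * ?E s
      = 2 * exp (- (2 * l\<^sup>2) * s) * (weighted_form l (jacobi_op a b (flow c N s)) (flow c N s) - l\<^sup>2 *
          ?E s)"
      by (simp add: algebra_simps)
    also have "\<dots> \<le> 0" using weighted_dissipation[of l "flow c N s"] by (intro mult_nonneg_nonpos) auto
    finally show "\<exists>y. (f has_real_derivative y) (at s) \<and> y \<le> 0" using d by blast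
  qed
  then have "?E t * exp (- (2 * l\<^sup>2) * t) * exp (2 * l\<^sup>2 * t) \<le> ?E 0 * exp (2 * l\<^sup>2 * t)"
    unfolding f_def by (intro mult_right_mono) auto
  moreover have "exp (- (2 * l\<^sup>2) * t) * exp (2 * l\<^sup>2 * t) = 1" unfolding exp_add[symmetric] by simp
  ultimately show ?thesis by (simp only: mult.assoc mult_1_right mult.commute[of "?E 0"])
qed

section \<open>Pointwise bounds from the weighted energy\<close>

lemma weight_root: 
  assumes "\<theta> \<in> {0..pi}" shows "jacobi_weight a b \<theta> = (root_weight \<theta>)\<^sup>2"
proof -
  have *: "(x powr (c + 1 / 2))\<^sup>2 = x powr (2 * c + 1)" for x c :: real
    unfolding power2_eq_square powr_add[symmetric] by simp
  show ?thesis unfolding jacobi_weight_def root_weight_def power_mult_distrib * ..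
qed

text \<open>\<open>pi / 4 + 1 / 2\<close> is half of the largest angle within distance 1 of \<open>{0..pi / 2}\<close>.\<close>

definition doubling_const :: real where
  "doubling_const = cos (pi / 4 + 1 / 2) powr (2 * a + 2 * b + 2)"

lemma cos_const: "0 < cos (pi / 4 + 1 / 2)" "cos (pi / 4 + 1 / 2) \<le> (1 :: real)"
  using pi_gt3 by (auto intro!: cos_gt_zero_pi)

lemma doubling_const_pos: "doubling_const > 0"
  unfolding doubling_const_def using cos_const by simp

text \<open>Moving towards the farther endpoint does not decrease one of sin (\<theta> / 2), cos
  (\<theta> / 2); as the step is at most 1, the other stays above cos (pi / 4 + 1 / 2).\<close>

lemma jacobi_weight_comparable:
  assumes "\<theta> \<in> {0..pi}" "\<theta>' \<in> {0..pi}"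
    and "\<theta> \<le> pi / 2 \<and> \<theta> \<le> \<theta>' \<and> \<theta>' \<le> \<theta> + 1 \<or> \<theta> \<ge> pi / 2 \<and> \<theta>' \<le> \<theta> \<and> \<theta> - 1 \<le> \<theta>'"
  shows "doubling_const * jacobi_weight a b \<theta> \<le> jacobi_weight a b \<theta>'"
proof -
  let ?k = "cos (pi / 4 + 1 / 2) :: real"
  have nn: "0 \<le> sin (\<theta> / 2)" "0 \<le> cos (\<theta> / 2)" "0 \<le> sin (\<theta>' / 2)" "0 \<le> cos (\<theta>' / 2)"
    using sin_cos_half_nonneg[OF assms(1)] sin_cos_half_nonneg[OF assms(2)] by auto
  have k: "?k * sin (\<theta> / 2) \<le> sin (\<theta>' / 2)" "?k * cos (\<theta> / 2) \<le> cos (\<theta>' / 2)"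
  proof -
    have one: "?k * sin (\<theta> / 2) \<le> ?k * 1" "?k * cos (\<theta> / 2) \<le> ?k * 1" "?k * sin (\<theta> / 2)
        \<le> 1 * sin (\<theta> / 2)" "?k * cos (\<theta> / 2) \<le> 1 * cos (\<theta> / 2)"
      using cos_const nn by (intro mult_left_mono mult_right_mono; simp)+
    from assms(3) show "?k * sin (\<theta> / 2) \<le> sin (\<theta>' / 2)"
    proof (elim disjE conjE)
      assume "\<theta> \<le> pi / 2" "\<theta> \<le> \<theta>'"
      then have "sin (\<theta> / 2) \<le> sin (\<theta>' / 2)" using assms by (intro sin_monotone_2pi_le) auto
      then show ?thesis using one by simp
    next
      assume h: "\<theta> \<ge> pi / 2" "\<theta> - 1 \<le> \<theta>'"
      have "sin (pi / 4 - 1 / 2) \<le> sin (\<theta>' / 2)" using assms h pi_gt3 by (intro sin_monotone_2pi_le) auto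
      moreover have "sin (pi / 4 - 1 / 2) = ?k"
        unfolding cos_sin_eq by (simp add: field_simps)
      ultimately show ?thesis using one by simp
    qed
    from assms(3) show "?k * cos (\<theta> / 2) \<le> cos (\<theta>' / 2)"
    proof (elim disjE conjE)
      assume h: "\<theta> \<le> pi / 2" "\<theta>' \<le> \<theta> + 1"
      have "?k \<le> cos (\<theta>' / 2)" using assms h pi_gt3 by (intro cos_monotone_0_pi_le) auto
      then show ?thesis using one by simp
    next
      assume "\<theta>' \<le> \<theta>"
      then have "cos (\<theta> / 2) \<le> cos (\<theta>' / 2)" using assms by (intro cos_monotone_0_pi_le) auto
      then show ?thesis using one by simp
    qed
  qed
  have "doubling_const * jacobi_weight a b \<theta> = (?k * sin (\<theta> / 2)) powr (2 * a
      + 1) * (?k * cos (\<theta> / 2)) powr (2 * b + 1)"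
  proof -
    have "doubling_const = ?k powr (2 * a + 1) * ?k powr (2 * b + 1)"
      unfolding doubling_const_def powr_add[symmetric] by (simp add: algebra_simps)
    then show ?thesis unfolding jacobi_weight_def using nn cos_const by (simp add: powr_mult)
  qed
  also have "\<dots> \<le> jacobi_weight a b \<theta>'"
    unfolding jacobi_weight_def using k nn cos_const a_ge b_ge by (intro mult_mono powr_mono2) auto
  finally show ?thesis .
qed

text \<open>Integrate over an interval of length r on one side of \<theta>, the side away from the
  nearer endpoint. It stays inside [0, pi], and the weight there is at least a fixed fraction of its
  value at \<theta>.\<close>

lemma weight_times_local_min:
  assumes \<theta>: "\<theta> \<in> {0..pi}" and r: "0 < r" "r \<le> 1" and v: "v \<ge> 0"
    and F: "continuous_on {0..pi} F" "\<And>\<theta>'. \<theta>' \<in> {0..pi} \<Longrightarrow> 0 \<le> F \<theta>'"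
    and vF: "\<And>\<theta>'. \<theta>' \<in> {0..pi} \<Longrightarrow> \<bar>\<theta>' - \<theta>\<bar> \<le> r \<Longrightarrow> v \<le> F \<theta>'"
  shows "doubling_const * (jacobi_weight a b \<theta> * r * v) \<le> (\<integral>\<theta>. F \<theta> \<partial>\<mu>)"
proof -
  define l where "l = (if \<theta> \<le> pi / 2 then \<theta> else \<theta> - r)"
  let ?J = "{l..l + r}"
  have J: "\<theta>' \<in> {0..pi} \<and> \<bar>\<theta>' - \<theta>\<bar> \<le> r \<and>
      (\<theta> \<le> pi / 2 \<and> \<theta> \<le> \<theta>' \<and> \<theta>' \<le> \<theta> + 1 \<or> \<theta> \<ge> pi / 2 \<and> \<theta>' \<le> \<theta> \<and> \<theta> - 1 \<le> \<theta>')" if "\<theta>' \<in> ?J" for \<theta>'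
    using that \<theta> r pi_gt3 unfolding l_def by (auto split: if_splits)
  let ?c = "doubling_const * jacobi_weight a b \<theta> * v"
  have c: "?c \<ge> 0" using doubling_const_pos v by simp
  have Fm: "F \<in> borel_measurable \<mu>" by (rule borel_measurable_mu1_continuous[OF F(1)])
  have "doubling_const * (jacobi_weight a b \<theta> * r * v) = (\<integral>\<theta>'. ?c * indicator ?J \<theta>' \<partial>lborel)"
    using r by simp
  also have "\<dots> = (\<integral>\<theta>'. ?c * indicator ({0..pi} \<inter> ?J) \<theta>' \<partial>lborel)"
    by (intro Bochner_Integration.integral_cong refl) (use J in \<open>auto split: split_indicator\<close>)
  also have "\<dots> \<le> (LBINT \<theta>':{0..pi}. jacobi_weight a b \<theta>' * F \<theta>')"
    unfolding set_lebesgue_integral_def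
  proof (rule integral_mono)
    show "integrable lborel (\<lambda>\<theta>'. ?c * indicator ({0..pi} \<inter> ?J) \<theta>')"
      by (intro integrable_mult_right integrable_real_indicator) (auto simp: emeasure_lborel_Icc_eq)
    show "integrable lborel (\<lambda>\<theta>'. indicator {0..pi} \<theta>' *\<^sub>R (jacobi_weight a b \<theta>' * F \<theta>'))"
      using integral_mu1(2)[OF Fm] integrable_mu1[OF a_ge b_ge F(1)] by (simp add: set_integrable_def)
    fix \<theta>' :: real
    show "?c * indicator ({0..pi} \<inter> ?J) \<theta>' \<le> indicator {0..pi} \<theta>' *\<^sub>R (jacobi_weight a b \<theta>' * F \<theta>')"
    proof (cases "\<theta>' \<in> {0..pi} \<inter> ?J")
      case True
      then have j: "\<theta>' \<in> {0..pi}" "\<bar>\<theta>' - \<theta>\<bar> \<le> r" "doubling_const * jacobi_weight a b \<theta>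
          \<le> jacobi_weight a b \<theta>'"
        using J[of \<theta>'] jacobi_weight_comparable[OF \<theta>, of \<theta>'] by auto
      then have "?c \<le> jacobi_weight a b \<theta>' * F \<theta>'" using vF v by (intro mult_mono) auto
      then show ?thesis using True by simp
    next
      case False then show ?thesis using F(2)[of \<theta>'] by (auto split: split_indicator)
    qed
  qed
  also have "\<dots> = (\<integral>\<theta>. F \<theta> \<partial>\<mu>)" by (rule integral_mu1(1)[OF Fm, symmetric])
  finally show ?thesis .
qed

text \<open>The Harnack factor between times t and 2 t for angles at distance at most sqrt
  t.\<close>

definition harnack_const :: real where
  "harnack_const = 2 powr (dim / 2) * exp (1 / 4)"

text \<open>The Harnack factor is squared because the energy is quadratic; exp 1 pays for the
  variation of exp (2 l \<theta>) over distance sqrt t, and the denominator for the variation of the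
  weight.\<close>

definition gauss_const :: real where
  "gauss_const = harnack_const\<^sup>2 * exp 1 / doubling_const"

lemma gauss_const_pos: "gauss_const > 0"
  unfolding gauss_const_def harnack_const_def using doubling_const_pos by simp

text \<open>Harnack replaces the value at time t by values at time 2 t throughout distance sqrt t,
  where they can be integrated; the energy estimate then returns to time 0. The assumption t <= 1
  keeps sqrt t within the range of the weight comparison.\<close>

lemma flow_pointwise_bound:
  assumes pos: "\<And>x. x \<in> {-1..1} \<Longrightarrow> poly (flow c N 0) x > 0"
    and t: "0 < t" "t \<le> 1" and \<theta>: "\<theta> \<in> {0..pi}"
  shows "jacobi_weight a b \<theta> * sqrt t * ((poly (flow c N t) (cos \<theta>))\<^sup>2 * exp (2 * l * \<theta>)) \<le>
    gauss_const * exp (5 * l\<^sup>2 * t) * weighted_form l (flow c N 0) (flow c N 0)"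
proof -
  let ?u = "\<lambda>t \<theta>. poly (flow c N t) (cos \<theta>)"
  let ?E = "weighted_form l (flow c N 0) (flow c N 0)"
  define F where "F = (\<lambda>\<theta>'. harnack_const\<^sup>2 * exp (2 * \<bar>l\<bar> * sqrt t) * (?u (2 * t) \<theta>' * (?u (2 * t) \<theta>' *
      exp (2 * l * \<theta>'))))"
  have upos: "?u s \<phi> > 0" if "s \<ge> 0" for s \<phi> using that by (intro flow_positive[OF pos]) auto
  have sq: "sqrt t > 0" "sqrt t \<le> 1" using t by auto
  have "doubling_const * (jacobi_weight a b \<theta> * sqrt t * ((?u t \<theta>)\<^sup>2 * exp (2 * l * \<theta>))) \<le> (\<integral>\<theta>'. F \<theta>' \<partial>\<mu>)"
  proof (rule weight_times_local_min[OF \<theta> sq])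
    show "0 \<le> (?u t \<theta>)\<^sup>2 * exp (2 * l * \<theta>)" by simp
    show "continuous_on {0..pi} F" unfolding F_def by (intro continuous_intros)
    show "0 \<le> F \<theta>'" for \<theta>' unfolding F_def using upos[of "2 * t" \<theta>'] t by simp
    fix \<theta>' assume "\<theta>' \<in> {0..pi}" and d: "\<bar>\<theta>' - \<theta>\<bar> \<le> sqrt t"
    have "(\<theta>' - \<theta>)\<^sup>2 \<le> (sqrt t)\<^sup>2" using d by (metis abs_ge_zero power2_abs power_mono)
    then have "(\<theta>' - \<theta>)\<^sup>2 / (4 * (2 * t - t)) \<le> 1 / 4" using t by (simp add: field_simps)
    then have "exp ((\<theta>' - \<theta>)\<^sup>2 / (4 * (2 * t - t))) \<le> exp (1 / 4)" by simp
    then have "2 powr (dim / 2) * exp ((\<theta>' - \<theta>)\<^sup>2 / (4 * (2 * t - t))) * ?u (2 * t) \<theta>'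
        \<le> harnack_const * ?u (2 * t) \<theta>'"
      unfolding harnack_const_def using upos[of "2 * t" \<theta>'] t by (intro mult_right_mono mult_left_mono) auto
    moreover have "?u t \<theta> \<le> 2 powr (dim / 2) * exp ((\<theta>' - \<theta>)\<^sup>2 / (4 * (2 * t - t))) * ?u (2 * t) \<theta>'"
      using flow_harnack[OF pos t(1), of "2 * t" \<theta> \<theta>'] t by simp
    ultimately have "?u t \<theta> \<le> harnack_const * ?u (2 * t) \<theta>'" by linarith
    then have 1: "(?u t \<theta>)\<^sup>2 \<le> (harnack_const * ?u (2 * t) \<theta>')\<^sup>2" using upos[of t \<theta>] t
        by (intro power_mono) auto
    have "l * (\<theta> - \<theta>') \<le> \<bar>l\<bar> * \<bar>\<theta>' - \<theta>\<bar>" using abs_ge_self[of "l * (\<theta> - \<theta>')"]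
        by (simp add: abs_mult abs_minus_commute)
    also have "\<dots> \<le> \<bar>l\<bar> * sqrt t" using d by (intro mult_left_mono) auto
    finally have "exp (2 * l * \<theta>) \<le> exp (2 * \<bar>l\<bar> * sqrt t + 2 * l * \<theta>')" by (simp add: algebra_simps)
    then have 2: "exp (2 * l * \<theta>) \<le> exp (2 * \<bar>l\<bar> * sqrt t) * exp (2 * l * \<theta>')" by (simp add: exp_add)
    have "(?u t \<theta>)\<^sup>2 * exp (2 * l * \<theta>) \<le> (harnack_const * ?u (2 * t) \<theta>')\<^sup>2 * (exp (2 * \<bar>l\<bar> * sqrt t) *
        exp (2 * l * \<theta>'))"
      by (intro mult_mono 1 2) auto
    also have "\<dots> = F \<theta>'" unfolding F_def by (simp only: power2_eq_square mult_ac)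
    finally show "(?u t \<theta>)\<^sup>2 * exp (2 * l * \<theta>) \<le> F \<theta>'" .
  qed
  also have "(\<integral>\<theta>'. F \<theta>' \<partial>\<mu>) = harnack_const\<^sup>2 * exp (2 * \<bar>l\<bar> * sqrt t) * weighted_form l (flow c N (2 *
      t)) (flow c N (2 * t))"
    unfolding F_def weighted_form_def by (rule integral_mult_right_zero)
  also have "\<dots> \<le> harnack_const\<^sup>2 * exp (2 * \<bar>l\<bar> * sqrt t) * (exp (2 * l\<^sup>2 * (2 * t)) * ?E)"
    using t by (intro mult_left_mono weighted_energy_growth) auto
  also have "\<dots> = harnack_const\<^sup>2 * ?E * exp (2 * \<bar>l\<bar> * sqrt t + 4 * l\<^sup>2 * t)"
    by (simp add: exp_add)
  also have "\<dots> \<le> harnack_const\<^sup>2 * ?E * exp (1 + 5 * l\<^sup>2 * t)"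
  proof (intro mult_left_mono)
    \<comment> \<open>The energy estimate up to time 2 t gives 4 l^2 t; the cross term 2 |l| sqrt t
      is at most 1 + l^2 t, which makes the 5.\<close>
    have "0 \<le> (1 - \<bar>l\<bar> * sqrt t)\<^sup>2" by simp
    also have "(1 - \<bar>l\<bar> * sqrt t)\<^sup>2 = 1 - 2 * \<bar>l\<bar> * sqrt t + l\<^sup>2 * t"
      using t by (simp add: power2_diff power_mult_distrib)
    finally have "2 * \<bar>l\<bar> * sqrt t + 4 * l\<^sup>2 * t \<le> 1 + 5 * l\<^sup>2 * t" by linarith
    then show "exp (2 * \<bar>l\<bar> * sqrt t + 4 * l\<^sup>2 * t) \<le> exp (1 + 5 * l\<^sup>2 * t)" by simp
    have "0 \<le> ?E" unfolding weighted_form_def by (intro integral_nonneg_AE AE_I2) (simp add: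
        mult.assoc[symmetric])
    then show "0 \<le> harnack_const\<^sup>2 * ?E" by simp
  qed
  also have "\<dots> = doubling_const * (gauss_const * exp (5 * l\<^sup>2 * t) * ?E)"
    unfolding gauss_const_def using doubling_const_pos by (simp add: exp_add)
  finally show ?thesis using doubling_const_pos by simp
qed

lemma heat_pointwise_bound:
  assumes f: "continuous_on {-1..1} f" "\<And>x. x \<in> {-1..1} \<Longrightarrow> f x \<ge> 0"
    and t: "0 < t" "t \<le> 1" and \<theta>: "\<theta> \<in> {0..pi}"
  shows "jacobi_weight a b \<theta> * sqrt t * ((heat t f (cos \<theta>))\<^sup>2 * exp (2 * l * \<theta>)) \<le>
    gauss_const * exp (5 * l\<^sup>2 * t) * (\<integral>\<phi>. exp (2 * l * \<phi>) * (f (cos \<phi>))\<^sup>2 \<partial>\<mu>)"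
proof -
  obtain c N where cN: "\<And>k x. x \<in> {-1..1} \<Longrightarrow> poly (flow (c k) (N k) 0) x > 0"
    "\<And>t x. t > 0 \<Longrightarrow> x \<in> {-1..1} \<Longrightarrow> (\<lambda>k. poly (flow (c k) (N k) t) x) \<longlonglongrightarrow> heat t f x"
    "\<And>k x. x \<in> {-1..1} \<Longrightarrow> \<bar>poly (flow (c k) (N k) 0) x - f x\<bar> \<le> 3 / real (Suc k)"
    by (rule heat_approximation[OF f], assumption) (rule that)
  have "compact (f ` {-1..1})" by (intro compact_continuous_image f) auto
  then obtain B where B: "\<And>x. x \<in> {-1..1} \<Longrightarrow> \<bar>f x\<bar> \<le> B"
    using compact_imp_bounded bounded_iff by (metis image_eqI real_norm_def)
  have cosin: "cos \<phi> \<in> {-1..1}" for \<phi> :: real by simp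
  show ?thesis
  proof (rule LIMSEQ_le)
    show "(\<lambda>k. jacobi_weight a b \<theta> * sqrt t * ((poly (flow (c k) (N k) t) (cos \<theta>))\<^sup>2 * exp (2 * l * \<theta>)))
        \<longlonglongrightarrow> jacobi_weight a b \<theta> * sqrt t * ((heat t f (cos \<theta>))\<^sup>2 * exp (2 * l * \<theta>))"
      by (intro tendsto_mult tendsto_const tendsto_power cN(2)[OF t(1) cosin])
    have "(\<lambda>k. \<integral>\<phi>. exp (2 * l * \<phi>) * (poly (flow (c k) (N k) 0) (cos \<phi>))\<^sup>2 \<partial>\<mu>)
        \<longlonglongrightarrow> (\<integral>\<phi>. exp (2 * l * \<phi>) * (f (cos \<phi>))\<^sup>2 \<partial>\<mu>)"
    proof (rule integral_tendsto_uniform)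
      show "continuous_on {0..pi} (\<lambda>\<phi>. exp (2 * l * \<phi>))"
        "continuous_on {0..pi} (\<lambda>\<phi>. (poly (flow (c k) (N k) 0) (cos \<phi>))\<^sup>2)" for k
        by (intro continuous_intros)+
      show "continuous_on {0..pi} (\<lambda>\<phi>. (f (cos \<phi>))\<^sup>2)"
        by (rule continuous_on_power[OF continuous_on_cos_comp[OF f(1)]])
      fix k \<phi>
      let ?p = "poly (flow (c k) (N k) 0) (cos \<phi>)" and ?f = "f (cos \<phi>)"
      have d: "\<bar>?p - ?f\<bar> \<le> 3 / real (Suc k)" by (rule cN(3)[OF cosin])
      have "3 / real (Suc k) \<le> 3" by (simp add: field_simps)
      then have "\<bar>?p + ?f\<bar> \<le> 3 + 2 * B" using d B[OF cosin[of \<phi>]] by linarith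
      then have "\<bar>?p - ?f\<bar> * \<bar>?p + ?f\<bar> \<le> 3 / real (Suc k) * (3 + 2 * B)"
        using d by (intro mult_mono) auto
      moreover have "?p\<^sup>2 - ?f\<^sup>2 = (?p - ?f) * (?p + ?f)" by (simp add: power2_eq_square algebra_simps)
      ultimately show "\<bar>?p\<^sup>2 - ?f\<^sup>2\<bar> \<le> (3 * (3 + 2 * B)) / real (Suc k)" by (simp add: abs_mult)
    qed
    moreover have "weighted_form l p p = (\<integral>\<phi>. exp (2 * l * \<phi>) * (poly p (cos \<phi>))\<^sup>2 \<partial>\<mu>)" for p
      unfolding weighted_form_def by (simp only: power2_eq_square mult_ac)
    ultimately show "(\<lambda>k. gauss_const * exp (5 * l\<^sup>2 * t) * weighted_form l (flow (c k) (N k) 0) (flow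
        (c k) (N k) 0))
        \<longlonglongrightarrow> gauss_const * exp (5 * l\<^sup>2 * t) * (\<integral>\<phi>. exp (2 * l * \<phi>) * (f (cos \<phi>))\<^sup>2 \<partial>\<mu>)"
      by (intro tendsto_mult tendsto_const) simp
    show "\<exists>n. \<forall>k\<ge>n. jacobi_weight a b \<theta> * sqrt t * ((poly (flow (c k) (N k) t) (cos \<theta>))\<^sup>2 * exp (2 * l * \<theta>))
        \<le> gauss_const * exp (5 * l\<^sup>2 * t) * weighted_form l (flow (c k) (N k) 0) (flow (c k) (N k) 0)"
      using flow_pointwise_bound[OF cN(1) t \<theta>] by blast
  qed
qed

text \<open>\<open>heat_pointwise_bound\<close> applied to \<open>f = kernel t (cos \<theta>) \<cdot> exp (- 2 l \<cdot>)\<close>: both sides are then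
    multiples of powers of
  the same integral.\<close>

lemma kernel_weighted_norm:
  assumes t: "0 < t" "t \<le> 1" and \<theta>: "\<theta> \<in> {0..pi}"
  shows "jacobi_weight a b \<theta> * sqrt t * (\<integral>\<psi>. (kernel t (cos \<theta>) (cos \<psi>) * exp (- l * \<psi>))\<^sup>2 \<partial>\<mu>) \<le>
    gauss_const * exp (5 * l\<^sup>2 * t) * exp (- 2 * l * \<theta>)"
proof -
  let ?K = "\<lambda>\<psi>. kernel t (cos \<theta>) (cos \<psi>)"
  define f where "f = (\<lambda>y. kernel t (cos \<theta>) y * exp (- 2 * l * arccos y))"
  define J where "J = (\<integral>\<psi>. (?K \<psi> * exp (- l * \<psi>))\<^sup>2 \<partial>\<mu>)"
  have fcos: "f (cos \<psi>) = ?K \<psi> * exp (- 2 * l * \<psi>)" if "\<psi> \<in> {0..pi}" for \<psi>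
    using that unfolding f_def by (simp add: arccos_cos)
  have e: "exp (- 2 * l * \<psi>) = exp (- l * \<psi>) * exp (- l * \<psi>)" "exp (2 * l * \<psi>) * exp (- 2 * l * \<psi>)
      = 1" for \<psi>
    unfolding exp_add[symmetric] by (simp_all add: algebra_simps)
  have cosin: "cos \<phi> \<in> {-1..1}" for \<phi> :: real by simp
  have fc: "continuous_on {-1..1} f"
    unfolding f_def using continuous_on_kernel_space[OF t(1) cosin] by (intro continuous_intros) auto
  have fn: "f y \<ge> 0" if "y \<in> {-1..1}" for y
    unfolding f_def using kernel_nonneg[OF t(1) cosin that] by simp
  have 1: "heat t f (cos \<theta>) = J"
    unfolding heat_def J_def
  proof (intro Bochner_Integration.integral_cong refl)
    fix \<psi> assume "\<psi> \<in> space \<mu>"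
    then have m: "\<psi> \<in> {0..pi}" by simp
    show "?K \<psi> * f (cos \<psi>) = (?K \<psi> * exp (- l * \<psi>))\<^sup>2"
      unfolding fcos[OF m] e(1) by (simp only: power2_eq_square mult_ac)
  qed
  have 2: "(\<integral>\<phi>. exp (2 * l * \<phi>) * (f (cos \<phi>))\<^sup>2 \<partial>\<mu>) = J"
    unfolding J_def
  proof (intro Bochner_Integration.integral_cong refl)
    fix \<phi> assume "\<phi> \<in> space \<mu>"
    then have "exp (2 * l * \<phi>) * (f (cos \<phi>))\<^sup>2 = (exp (2 * l * \<phi>) * exp (- 2 * l * \<phi>)) * ((?K \<phi>)\<^sup>2 * exp
        (- 2 * l * \<phi>))"
      unfolding space_mu1 by (simp only: fcos) (simp only: power2_eq_square mult_ac)
    then show "exp (2 * l * \<phi>) * (f (cos \<phi>))\<^sup>2 = (?K \<phi> * exp (- l * \<phi>))\<^sup>2"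
      unfolding e(2) unfolding e(1) by (simp only: power2_eq_square mult_ac mult_1_left)
  qed
  have J: "J \<ge> 0" unfolding J_def by (intro integral_nonneg_AE AE_I2) simp
  have "jacobi_weight a b \<theta> * sqrt t * (J\<^sup>2 * exp (2 * l * \<theta>)) \<le> gauss_const * exp (5 * l\<^sup>2 * t) * J"
    using heat_pointwise_bound[OF fc fn t \<theta>, of l] unfolding 1 2 .
  then have *: "J * (jacobi_weight a b \<theta> * sqrt t * J * exp (2 * l * \<theta>))
      \<le> J * (gauss_const * exp (5 * l\<^sup>2 * t))"
    by (simp only: power2_eq_square mult_ac)
  have "jacobi_weight a b \<theta> * sqrt t * J * exp (2 * l * \<theta>) \<le> gauss_const * exp (5 * l\<^sup>2 * t)"
  proof (cases "J = 0")
    case True then show ?thesis using gauss_const_pos by simp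
  next
    case False then show ?thesis using * J by (simp add: mult_le_cancel_left)
  qed
  then have le: "jacobi_weight a b \<theta> * sqrt t * J * exp (2 * l * \<theta>) * exp (- 2 * l * \<theta>)
      \<le> gauss_const * exp (5 * l\<^sup>2 * t) * exp (- 2 * l * \<theta>)"
    by (rule mult_right_mono) simp
  have "jacobi_weight a b \<theta> * sqrt t * J * exp (2 * l * \<theta>) * exp (- 2 * l * \<theta>)
      = jacobi_weight a b \<theta> * sqrt t * J * (exp (2 * l * \<theta>) * exp (- 2 * l * \<theta>))"
    by (rule mult.assoc)
  also have "\<dots> = jacobi_weight a b \<theta> * sqrt t * J" unfolding e(2) by (rule mult_1_right)
  finally show ?thesis using le unfolding J_def by (simp only:)
qed

text \<open>The semigroup law at time t + t with exp (- l \<psi>) exp (l \<psi>) = 1 inserted,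
  followed by Young's inequality in place of Cauchy--Schwarz. The two norms come from
  \<open>kernel_weighted_norm\<close> with l and - l.\<close>

lemma kernel_exponential_bound:
  assumes t: "0 < t" "t \<le> 1" and \<theta>: "\<theta> \<in> {0..pi}" "\<phi> \<in> {0..pi}"
  shows "root_weight \<theta> * root_weight \<phi> * kernel (2 * t) (cos \<theta>) (cos \<phi>) \<le>
    gauss_const / sqrt t * exp (5 * l\<^sup>2 * t - l * (\<theta> - \<phi>))"
proof -
  define wt wp where "wt = root_weight \<theta>" and "wp = root_weight \<phi>"
  have w0: "wt \<ge> 0" "wp \<ge> 0" unfolding wt_def wp_def root_weight_def by auto
  define Q where "Q = gauss_const / sqrt t * exp (5 * l\<^sup>2 * t)"
  have Q: "Q > 0" unfolding Q_def using gauss_const_pos t by simp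
  define A where "A = (\<integral>\<psi>. (kernel t (cos \<theta>) (cos \<psi>) * exp (- l * \<psi>))\<^sup>2 \<partial>\<mu>)"
  define B where "B = (\<integral>\<psi>. (kernel t (cos \<phi>) (cos \<psi>) * exp (l * \<psi>))\<^sup>2 \<partial>\<mu>)"
  have A: "wt\<^sup>2 * A \<le> Q * exp (- 2 * l * \<theta>)"
    using kernel_weighted_norm[OF t \<theta>(1), of l] t
    unfolding A_def[symmetric] weight_root[OF \<theta>(1)] wt_def[symmetric] Q_def by (simp add: field_simps)
  have B: "wp\<^sup>2 * B \<le> Q * exp (2 * l * \<phi>)"
    using kernel_weighted_norm[OF t \<theta>(2), of "- l"] t
    unfolding minus_minus B_def[symmetric] weight_root[OF \<theta>(2)] wp_def[symmetric] Q_def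
        by (simp add: field_simps B_def)
  have R: "gauss_const / sqrt t * exp (5 * l\<^sup>2 * t - l * (\<theta> - \<phi>)) = Q * exp (l * (\<phi> - \<theta>))"
    unfolding Q_def mult.assoc exp_add[symmetric] by (simp add: algebra_simps)
  show ?thesis
  proof (cases "wt = 0 \<or> wp = 0")
    case True
    then show ?thesis unfolding R wt_def[symmetric] wp_def[symmetric] using Q by auto
  next
    case False
    then have w: "wt > 0" "wp > 0" using w0 by auto
    \<comment> \<open>Balances Young's inequality: after the bounds for A and B both terms equal Q
      exp (l (\<phi> - \<theta>)) / 2. Vanishing weights are split off because s must be finite and
      positive.\<close>
    define s where "s = wt / wp * exp (l * (\<theta> + \<phi>))"
    have s: "s > 0" unfolding s_def using w by simp
    have "kernel (t + t) (cos \<theta>) (cos \<phi>) = (\<integral>\<psi>. kernel t (cos \<theta>) (cos \<psi>) * kernel t (cos \<psi>) (cos \<phi>) \<partial>\<mu>)"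
      using t by (intro kernel_semigroup[symmetric]) auto
    also have "\<dots> \<le> (\<integral>\<psi>. s / 2 * (kernel t (cos \<theta>) (cos \<psi>) * exp (- l * \<psi>))\<^sup>2
        + 1 / (2 * s) * (kernel t (cos \<phi>) (cos \<psi>) * exp (l * \<psi>))\<^sup>2 \<partial>\<mu>)"
    proof (rule integral_mono)
      have c: "continuous_on {0..pi} (\<lambda>\<psi>. kernel t (cos \<theta>) (cos \<psi>))" for \<theta> using t
          by (intro continuous_on_kernel_cos) auto
      then show "integrable \<mu> (\<lambda>\<psi>. kernel t (cos \<theta>) (cos \<psi>) * kernel t (cos \<psi>) (cos \<phi>))"
        unfolding kernel_sym[of t "cos _" "cos \<phi>"] by (intro integrable_mu1 a_ge b_ge continuous_on_mult)
      show "integrable \<mu> (\<lambda>\<psi>. s / 2 * (kernel t (cos \<theta>) (cos \<psi>) * exp (- l * \<psi>))\<^sup>2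
        + 1 / (2 * s) * (kernel t (cos \<phi>) (cos \<psi>) * exp (l * \<psi>))\<^sup>2)"
        using c by (intro integrable_mu1 a_ge b_ge continuous_intros) auto
      fix \<psi>
      define x y where "x = kernel t (cos \<theta>) (cos \<psi>) * exp (- l * \<psi>)" and "y
          = kernel t (cos \<phi>) (cos \<psi>) * exp (l * \<psi>)"
      have "exp (- l * \<psi>) * exp (l * \<psi>) = 1" unfolding exp_add[symmetric] by simp
      then have "kernel t (cos \<theta>) (cos \<psi>) * kernel t (cos \<psi>) (cos \<phi>) = x * y"
        unfolding x_def y_def by (simp add: kernel_sym[of t "cos \<phi>"] mult_ac)
      also have "x * y \<le> s / 2 * x\<^sup>2 + 1 / (2 * s) * y\<^sup>2"
      proof -
        have "0 \<le> (s * x - y)\<^sup>2 / (2 * s)" using s by simp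
        then show ?thesis using s by (simp add: power2_eq_square field_simps)
      qed
      finally show "kernel t (cos \<theta>) (cos \<psi>) * kernel t (cos \<psi>) (cos \<phi>) \<le> s / 2 * x\<^sup>2 + 1 / (2 * s) * y\<^sup>2" .
    qed
    also have "\<dots> = s / 2 * A + 1 / (2 * s) * B"
    proof -
      have c: "continuous_on {0..pi} (\<lambda>\<psi>. kernel t (cos \<theta>) (cos \<psi>))" for \<theta> using t
          by (intro continuous_on_kernel_cos) auto
      have "integrable \<mu> (\<lambda>\<psi>. s / 2 * (kernel t (cos \<theta>) (cos \<psi>) * exp (- l * \<psi>))\<^sup>2)"
        "integrable \<mu> (\<lambda>\<psi>. 1 / (2 * s) * (kernel t (cos \<phi>) (cos \<psi>) * exp (l * \<psi>))\<^sup>2)"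
        using c by (intro integrable_mu1 a_ge b_ge continuous_intros; auto)+
      then show ?thesis unfolding A_def B_def
        by (subst Bochner_Integration.integral_add) (auto simp only: integral_mult_right_zero)
    qed
    finally have K: "kernel (2 * t) (cos \<theta>) (cos \<phi>) \<le> s / 2 * A + 1 / (2 * s) * B" by simp
    have "wt * wp * kernel (2 * t) (cos \<theta>) (cos \<phi>) \<le> wt * wp * (s / 2 * A + 1 / (2 * s) * B)"
      using K w by (intro mult_left_mono) auto
    also have "\<dots> = (exp (l * (\<theta> + \<phi>)) * (wt\<^sup>2 * A) + exp (- (l * (\<theta> + \<phi>))) * (wp\<^sup>2 * B)) / 2"
      unfolding s_def exp_minus using w by (simp add: power2_eq_square field_simps)
    also have "\<dots> \<le> (exp (l * (\<theta> + \<phi>)) * (Q * exp (- 2 * l * \<theta>)) + exp (- (l * (\<theta>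
        + \<phi>))) * (Q * exp (2 * l * \<phi>))) / 2"
      using A B by (intro divide_right_mono add_mono mult_left_mono) auto
    also have "\<dots> = Q * exp (l * (\<phi> - \<theta>))"
    proof -
      have "exp (l * (\<theta> + \<phi>)) * exp (- 2 * l * \<theta>) = exp (l * (\<phi> - \<theta>))"
        "exp (- (l * (\<theta> + \<phi>))) * exp (2 * l * \<phi>) = exp (l * (\<phi> - \<theta>))"
        unfolding exp_add[symmetric] by (simp_all add: algebra_simps)
      then show ?thesis by (simp add: mult.left_commute[of _ Q])
    qed
    finally show ?thesis unfolding R wt_def wp_def .
  qed
qed

theorem kernel_gaussian_bound:
  assumes r: "0 < r" "r \<le> 2" and \<theta>: "\<theta> \<in> {0..pi}" "\<phi> \<in> {0..pi}"
  shows "root_weight \<theta> * root_weight \<phi> * kernel r (cos \<theta>) (cos \<phi>) \<le>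
    2 * gauss_const / sqrt r * exp (- (\<theta> - \<phi>)\<^sup>2 / (10 * r))"
proof -
  \<comment> \<open>The minimiser of the exponent 5 l^2 (r / 2) - l (\<theta> - \<phi>).\<close>
  define l where "l = (\<theta> - \<phi>) / (5 * r)"
  have "root_weight \<theta> * root_weight \<phi> * kernel (2 * (r / 2)) (cos \<theta>) (cos \<phi>) \<le>
    gauss_const / sqrt (r / 2) * exp (5 * l\<^sup>2 * (r / 2) - l * (\<theta> - \<phi>))"
    using r \<theta> by (intro kernel_exponential_bound) auto
  also have "5 * l\<^sup>2 * (r / 2) - l * (\<theta> - \<phi>) = - (\<theta> - \<phi>)\<^sup>2 / (10 * r)"
    unfolding l_def using r by (simp add: power2_eq_square field_simps)
  also have "gauss_const / sqrt (r / 2) = sqrt 2 * gauss_const / sqrt r" by (simp add: real_sqrt_divide)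
  also have "sqrt 2 * gauss_const / sqrt r * exp (- (\<theta> - \<phi>)\<^sup>2 / (10 * r))
      \<le> 2 * gauss_const / sqrt r * exp (- (\<theta> - \<phi>)\<^sup>2 / (10 * r))"
    using gauss_const_pos r sqrt2_less_2 by (intro mult_right_mono divide_right_mono) auto
  finally show ?thesis by simp
qed

end

section \<open>The Neumann heat kernel\<close>

text \<open>For \<open>a = b = -1/2\<close> the kernel is the Neumann heat kernel of \<open>[0, \<pi>]\<close> in the angular variable.\<close>

interpretation neumann: jacobi "- 1 / 2" "- 1 / 2"
  by unfold_locales simp_all

text \<open>These are Chebyshev polynomials up to normalisation: in the angle the Jacobi equation
  becomes g'' = - n^2 g, and g'(0) = 0.\<close>

lemma jacobi_poly_chebyshev:
  "poly (neumann.P n) (cos \<theta>) = poly (neumann.P n) 1 * cos (real n * \<theta>)"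
proof (cases "n = 0")
  case True then show ?thesis by simp
next
  case False
  let ?p = "neumann.P n"
  let ?g = "\<lambda>\<theta>. poly ?p (cos \<theta>)" and ?g' = "\<lambda>\<theta>. - (sin \<theta> * poly (pderiv ?p) (cos \<theta>))"
  have n: "real n \<noteq> 0" using False by simp
  have d1: "(?g has_real_derivative ?g' \<theta>) (at \<theta>)" for \<theta>
    by (rule DERIV_cong[OF DERIV_chain2[OF poly_DERIV DERIV_cos]]) simp
  have d2: "(?g' has_real_derivative - ((real n)\<^sup>2 * ?g \<theta>)) (at \<theta>)" for \<theta>
  proof -
    have "((\<lambda>\<theta>. poly (pderiv ?p) (cos \<theta>)) has_real_derivative poly (pderiv (pderiv ?p)) (cos \<theta>) * - sin
        \<theta>) (at \<theta>)"
      by (rule DERIV_chain2[OF poly_DERIV DERIV_cos])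
    from DERIV_minus[OF DERIV_mult[OF DERIV_sin this]]
    have "(?g' has_real_derivative - (cos \<theta> * poly (pderiv ?p) (cos \<theta>)
        + poly (pderiv (pderiv ?p)) (cos \<theta>) * - sin \<theta> * sin \<theta>)) (at \<theta>)" .
    moreover have "poly (jacobi_op (- 1 / 2) (- 1 / 2) ?p) (cos \<theta>) = - ((real n)\<^sup>2 * ?g \<theta>)"
      by (simp add: jacobi_op_jacobi_poly jacobi_eigenvalue_def power2_eq_square)
    then have "(1 - (cos \<theta>)\<^sup>2) * poly (pderiv (pderiv ?p)) (cos \<theta>) - cos \<theta> * poly (pderiv ?p) (cos \<theta>)
        = - ((real n)\<^sup>2 * ?g \<theta>)"
      unfolding neumann.poly_jacobi_op by simp
    then have "- (cos \<theta> * poly (pderiv ?p) (cos \<theta>)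
        + poly (pderiv (pderiv ?p)) (cos \<theta>) * - sin \<theta> * sin \<theta>) = - ((real n)\<^sup>2 * ?g \<theta>)"
      unfolding sin_squared_eq[symmetric] by (simp add: power2_eq_square algebra_simps)
    ultimately show ?thesis by simp
  qed
  have c: "((\<lambda>\<theta>. cos (real n * \<theta>)) has_real_derivative - (real n * sin (real n * \<theta>))) (at \<theta>)"
    and s: "((\<lambda>\<theta>. sin (real n * \<theta>)) has_real_derivative real n * cos (real n * \<theta>)) (at \<theta>)" for \<theta>
    by (auto intro!: derivative_eq_intros)
  \<comment> \<open>A and B are the vector (n g, g') rotated back by the angle n \<theta>, hence
    constant along solutions of g'' = - n^2 g.\<close>
  define A where "A = (\<lambda>\<theta>. real n * (?g \<theta> * cos (real n * \<theta>)) - ?g' \<theta> * sin (real n * \<theta>))"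
  define B where "B = (\<lambda>\<theta>. real n * (?g \<theta> * sin (real n * \<theta>)) + ?g' \<theta> * cos (real n * \<theta>))"
  have "(A has_real_derivative 0) (at \<theta>)" for \<theta>
    unfolding A_def
    by (rule DERIV_cong[OF DERIV_diff[OF DERIV_cmult[OF DERIV_mult[OF d1 c]] DERIV_mult[OF d2 s]]]) algebra
  then have A: "A \<theta> = A 0" by (intro DERIV_isconst_all) auto
  have "(B has_real_derivative 0) (at \<theta>)" for \<theta>
    unfolding B_def
    by (rule DERIV_cong[OF DERIV_add[OF DERIV_cmult[OF DERIV_mult[OF d1 s]] DERIV_mult[OF d2 c]]]) algebra
  then have B: "B \<theta> = B 0" by (intro DERIV_isconst_all) auto
  have "A \<theta> * cos (real n * \<theta>) + B \<theta> * sin (real n * \<theta>) = real n * ?g \<theta> * ((cos (real n * \<theta>))\<^sup>2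
      + (sin (real n * \<theta>))\<^sup>2)"
    unfolding A_def B_def by algebra
  then have "real n * ?g \<theta> = A 0 * cos (real n * \<theta>) + B 0 * sin (real n * \<theta>)"
    unfolding A B by simp
  then have "real n * ?g \<theta> = real n * (poly ?p 1 * cos (real n * \<theta>))" by (simp add: A_def B_def)
  then show ?thesis using n by simp
qed

text \<open>The square of the cosine and the weight are at most 1, so the norm is at most pi times
  the squared value at 1.\<close>

lemma neumann_coefficient_ge:
  "(poly (neumann.P n) 1)\<^sup>2 / neumann.nrm n \<ge> 1 / pi"
proof -
  let ?M = "mu1 (- 1 / 2) (- 1 / 2)" and ?c = "poly (neumann.P n) 1"
  let ?w = "jacobi_weight (- 1 / 2) (- 1 / 2)"
  have "neumann.nrm n = (LBINT \<theta>:{0..pi}. ?w \<theta> * (poly (neumann.P n) (cos \<theta>))\<^sup>2)"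
    unfolding jacobi_norm_def by (intro integral_mu1 borel_measurable_mu1_continuous continuous_intros)
  also have "\<dots> \<le> (LBINT \<theta>:{0..pi}. ?c\<^sup>2)"
  proof (rule set_integral_mono)
    have i: "integrable ?M (\<lambda>\<theta>. (poly (neumann.P n) (cos \<theta>))\<^sup>2)"
      by (intro integrable_mu1 continuous_intros) auto
    then show "set_integrable lborel {0..pi} (\<lambda>\<theta>. ?w \<theta> * (poly (neumann.P n) (cos \<theta>))\<^sup>2)"
      by (subst integral_mu1(2)[symmetric]) auto
    show "set_integrable lborel {0..pi} (\<lambda>\<theta>. ?c\<^sup>2)"
      unfolding set_integrable_def by (intro integrable_scaleR_left) (simp add: emeasure_lborel_Icc_eq)
    fix \<theta> :: real assume \<theta>: "\<theta> \<in> {0..pi}"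
    have "?w \<theta> * (?c * cos (real n * \<theta>))\<^sup>2 \<le> 1 * (?c\<^sup>2 * 1)"
      unfolding power_mult_distrib using jacobi_weight_le_1[OF _ _ \<theta>, of "- 1 / 2" "- 1 / 2"]
      by (intro mult_mono mult_left_mono) (auto simp: abs_square_le_1)
    then show "?w \<theta> * (poly (neumann.P n) (cos \<theta>))\<^sup>2 \<le> ?c\<^sup>2"
      unfolding jacobi_poly_chebyshev[of n \<theta>] by simp
  qed
  also have "\<dots> = pi * ?c\<^sup>2" by (simp add: set_lebesgue_integral_def)
  finally have "neumann.nrm n \<le> pi * ?c\<^sup>2" .
  moreover have "neumann.nrm n > 0" by (intro jacobi_norm_pos) auto
  ultimately show ?thesis by (simp add: field_simps)
qed

text \<open>Termwise, the square of a cosine is half of 1 plus the cosine of the double angle. The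
  point is to reduce the diagonal to the endpoint 1, the other summand being nonnegative as a heat
  kernel.\<close>

lemma neumann_diagonal:
  assumes "t > 0"
  shows "neumann.kernel t (cos \<theta>) (cos \<theta>) = (neumann.kernel t 1 1 + neumann.kernel t (cos (2 * \<theta>)) 1) / 2"
proof -
  let ?p = "\<lambda>n. poly (neumann.P n)" and ?N = "jacobi_norm (- 1 / 2) (- 1 / 2)"
    and ?e = "\<lambda>n. exp (- t * neumann.ev n)"
  have "?e n * (?p n (cos \<theta>) * ?p n (cos \<theta>) / ?N n) =
      (?e n * (?p n 1 * ?p n 1 / ?N n) + ?e n * (?p n (cos (2 * \<theta>)) * ?p n 1 / ?N n)) / 2" for n
  proof -
    have cd: "cos (real n * (2 * \<theta>)) = 2 * (cos (real n * \<theta>))\<^sup>2 - 1"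
      using cos_double_cos[of "real n * \<theta>"] by (simp add: mult.left_commute)
    then show ?thesis
      unfolding jacobi_poly_chebyshev[of n \<theta>] jacobi_poly_chebyshev[of n "2 * \<theta>"] cd
      by (simp add: power2_eq_square algebra_simps add_divide_distrib diff_divide_distrib)
  qed
  then have "neumann.kernel t (cos \<theta>) (cos \<theta>) =
      (\<Sum>n. (?e n * (?p n 1 * ?p n 1 / ?N n) + ?e n * (?p n (cos (2 * \<theta>)) * ?p n 1 / ?N n)) / 2)"
    unfolding neumann.kernel_def by (rule suminf_cong)
  also have "\<dots> = (\<Sum>n. ?e n * (?p n 1 * ?p n 1 / ?N n) + ?e n * (?p n (cos (2 * \<theta>)) * ?p n 1 / ?N n)) / 2"
    using assms by (intro suminf_divide summable_add neumann.summable_kernel) auto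
  also have "(\<Sum>n. ?e n * (?p n 1 * ?p n 1 / ?N n) + ?e n * (?p n (cos (2 * \<theta>)) * ?p n 1 / ?N n))
      = neumann.kernel t 1 1 + neumann.kernel t (cos (2 * \<theta>)) 1"
    unfolding neumann.kernel_def using assms by (intro suminf_add[symmetric] neumann.summable_kernel) auto
  finally show ?thesis .
qed

text \<open>All terms of the series are nonnegative, and those with n <= 1 / sqrt t are at least exp
  (- 1) / pi; for large t the term n = 0 alone gives the 1 in the maximum.\<close>

lemma neumann_kernel_1_1:
  assumes "t > 0"
  shows "neumann.kernel t 1 1 \<ge> exp (- 1) / pi * max 1 (1 / sqrt t)"
proof -
  let ?p = "\<lambda>n. poly (neumann.P n)" and ?N = "jacobi_norm (- 1 / 2) (- 1 / 2)"
  let ?a = "\<lambda>n. exp (- t * neumann.ev n) * (?p n 1 * ?p n 1 / ?N n)"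
  define m where "m = nat \<lfloor>1 / sqrt t\<rfloor>"
  have a: "?a n \<ge> exp (- t * (real n)\<^sup>2) * (1 / pi)" for n
    using neumann_coefficient_ge[of n]
    by (intro mult_mono) (auto simp: jacobi_eigenvalue_def power2_eq_square)
  have a0: "?a n \<ge> 0" for n using a[of n] by (rule order_trans[rotated]) simp
  have m: "real m \<le> 1 / sqrt t" "1 / sqrt t \<le> real m + 1" unfolding m_def using assms by auto
  have "(real m + 1) * (exp (- 1) / pi) = (\<Sum>n\<le>m. exp (- 1) / pi)" by simp
  also have "\<dots> \<le> (\<Sum>n\<le>m. ?a n)"
  proof (rule sum_mono)
    fix n assume "n \<in> {..m}"
    then have "real n \<le> 1 / sqrt t" using m by auto
    then have "(real n)\<^sup>2 \<le> (1 / sqrt t)\<^sup>2" by (intro power_mono) auto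
    then have "t * (real n)\<^sup>2 \<le> 1" using assms by (simp add: power_divide field_simps)
    then have "exp (- 1) * (1 / pi) \<le> exp (- t * (real n)\<^sup>2) * (1 / pi)" by (intro mult_right_mono) auto
    also note a[of n]
    finally show "exp (- 1) / pi \<le> ?a n" by simp
  qed
  also have "\<dots> \<le> neumann.kernel t 1 1"
    unfolding neumann.kernel_def using assms a0
    by (intro sum_le_suminf neumann.summable_kernel) auto
  finally have "(real m + 1) * (exp (- 1) / pi) \<le> neumann.kernel t 1 1" .
  moreover have "max 1 (1 / sqrt t) * (exp (- 1) / pi) \<le> (real m + 1) * (exp (- 1) / pi)"
    using m by (intro mult_right_mono) auto
  ultimately show ?thesis by (simp only: mult.commute)
qed

lemma neumann_diagonal_ge:
  assumes "t > 0"
  shows "neumann.kernel t (cos \<theta>) (cos \<theta>) \<ge> exp (- 1) / (2 * pi) * max 1 (1 / sqrt t)"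
proof -
  have "neumann.kernel t (cos (2 * \<theta>)) 1 \<ge> 0" using assms by (intro neumann.kernel_nonneg) auto
  then have "(exp (- 1) / pi * max 1 (1 / sqrt t)) / 2 \<le> neumann.kernel t (cos \<theta>) (cos \<theta>)"
    unfolding neumann_diagonal[OF assms, of \<theta>]
    by (intro divide_right_mono add_increasing2 neumann_kernel_1_1 assms) auto
  then show ?thesis by simp
qed

text \<open>Harnack from the diagonal point (\<phi>, \<phi>) at time t / 2 to (\<theta>, \<phi>) at
  time t; the time gap t / 2 produces the exponent (\<theta> - \<phi>)^2 / (2 t).\<close>

theorem neumann_kernel_lower_bound:
  obtains c where "c > 0"
    "\<And>t \<theta> \<phi>. t > 0 \<Longrightarrow> c * max 1 (1 / sqrt t) * exp (- (\<theta> - \<phi>)\<^sup>2 / (2 * t))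
        \<le> neumann.kernel t (cos \<theta>) (cos \<phi>)"
proof -
  define H where "H = 2 powr (neumann.dim / 2)"
  have H: "H > 0" unfolding H_def by simp
  show ?thesis
  proof (rule that[of "exp (- 1) / (2 * pi) / H"])
    show "exp (- 1) / (2 * pi) / H > 0" using H by simp
    fix t \<theta> \<phi> :: real assume t: "t > 0"
    let ?E = "(\<theta> - \<phi>)\<^sup>2 / (2 * t)"
    have "exp (- 1) / (2 * pi) * max 1 (1 / sqrt t) \<le> exp (- 1) / (2 * pi) * max 1 (1 / sqrt (t / 2))"
      using t by (intro mult_left_mono max.mono frac_le) auto
    also have "\<dots> \<le> neumann.kernel (t / 2) (cos \<phi>) (cos \<phi>)"
      using t by (intro neumann_diagonal_ge) auto
    also have "\<dots> \<le> (t / (t / 2)) powr (neumann.dim / 2) * exp ((\<theta> - \<phi>)\<^sup>2 / (4 * (t - t / 2))) *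
        neumann.kernel t (cos \<theta>) (cos \<phi>)"
      using t by (intro neumann.kernel_harnack) auto
    also have "\<dots> = H * (exp ?E * neumann.kernel t (cos \<theta>) (cos \<phi>))"
      unfolding H_def using t by simp
    finally have "exp (- 1) / (2 * pi) * max 1 (1 / sqrt t) / H \<le> exp ?E * neumann.kernel t (cos \<theta>) (cos \<phi>)"
      using H by (simp add: field_simps)
    then have "exp (- 1) / (2 * pi) * max 1 (1 / sqrt t) / H * exp (- ?E)
        \<le> exp ?E * neumann.kernel t (cos \<theta>) (cos \<phi>) * exp (- ?E)"
      by (rule mult_right_mono) simp
    also have "\<dots> = neumann.kernel t (cos \<theta>) (cos \<phi>)" by (simp add: exp_minus)
    finally show "exp (- 1) / (2 * pi) / H * max 1 (1 / sqrt t) * exp (- (\<theta> - \<phi>)\<^sup>2 / (2 * t))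
        \<le> neumann.kernel t (cos \<theta>) (cos \<phi>)"
      by simp
  qed
qed

context jacobi
begin

lemma root_weight_bounds:
  assumes "\<theta> \<in> {0..pi}" shows "0 \<le> root_weight \<theta>" "root_weight \<theta> \<le> 1"
  unfolding root_weight_def using sin_cos_half_nonneg[OF assms] a_ge b_ge
  by (auto intro!: mult_le_one powr_le1)

text \<open>For t <= 2 the Gaussian exponents agree at time 5 t. For t > 2 the left side is bounded
  by a constant, and the Neumann kernel stays above a positive constant because the angles differ by
  at most pi.\<close>

theorem kernel_le_neumann:
  obtains C where "C > 0" "\<And>t \<theta> \<phi>. t > 0 \<Longrightarrow> \<theta> \<in> {0..pi} \<Longrightarrow> \<phi> \<in> {0..pi} \<Longrightarrow>
    root_weight \<theta> * root_weight \<phi> * kernel t (cos \<theta>) (cos \<phi>) \<le> C * neumann.kernel (5 * t) (cos \<theta>) (cos \<phi>)"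
proof -
  obtain c where c: "c > 0"
    "\<And>t \<theta> \<phi>. t > 0 \<Longrightarrow> c * max 1 (1 / sqrt t) * exp (- (\<theta> - \<phi>)\<^sup>2 / (2 * t))
        \<le> neumann.kernel t (cos \<theta>) (cos \<phi>)"
    by (rule neumann_kernel_lower_bound) (rule that)
  define C1 where "C1 = 2 * gauss_const * sqrt 5 / c"
  define C2 where "C2 = \<bar>kernel_bound 2\<bar> * exp (pi\<^sup>2) / c"
  have C1: "C1 > 0" unfolding C1_def using gauss_const_pos c(1) by simp
  have C2: "C2 \<ge> 0" unfolding C2_def using c(1) by simp
  show ?thesis
  proof (rule that[of "C1 + C2"])
    show "C1 + C2 > 0" using C1 C2 by simp
    fix t \<theta> \<phi> :: real assume t: "t > 0" and \<theta>: "\<theta> \<in> {0..pi}" "\<phi> \<in> {0..pi}"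
    let ?W = "neumann.kernel (5 * t) (cos \<theta>) (cos \<phi>)"
    have W0: "?W \<ge> 0" using t by (intro neumann.kernel_nonneg) auto
    have W: "c * max 1 (1 / sqrt (5 * t)) * exp (- (\<theta> - \<phi>)\<^sup>2 / (10 * t)) \<le> ?W"
      using c(2)[of "5 * t" \<theta> \<phi>] t by simp
    show "root_weight \<theta> * root_weight \<phi> * kernel t (cos \<theta>) (cos \<phi>) \<le> (C1 + C2) * ?W"
    proof (cases "t \<le> 2")
      case True
      have "root_weight \<theta> * root_weight \<phi> * kernel t (cos \<theta>) (cos \<phi>)
          \<le> 2 * gauss_const / sqrt t * exp (- (\<theta> - \<phi>)\<^sup>2 / (10 * t))"
        by (rule kernel_gaussian_bound[OF t True \<theta>])
      also have "\<dots> = C1 * (c * (1 / sqrt (5 * t)) * exp (- (\<theta> - \<phi>)\<^sup>2 / (10 * t)))"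
        unfolding C1_def using c(1) t by (simp add: real_sqrt_mult)
      also have "\<dots> \<le> C1 * (c * max 1 (1 / sqrt (5 * t)) * exp (- (\<theta> - \<phi>)\<^sup>2 / (10 * t)))"
        using C1 c(1) by (intro mult_left_mono mult_right_mono) auto
      also have "\<dots> \<le> C1 * ?W" using W C1 by (intro mult_left_mono) auto
      also have "\<dots> \<le> (C1 + C2) * ?W" using C2 W0 by (intro mult_right_mono) auto
      finally show ?thesis .
    next
      case False
      have "root_weight \<theta> * root_weight \<phi> * kernel t (cos \<theta>) (cos \<phi>) \<le> 1 * \<bar>kernel_bound 2\<bar>"
      proof (rule mult_mono)
        show "root_weight \<theta> * root_weight \<phi> \<le> 1"
          using root_weight_bounds[OF \<theta>(1)] root_weight_bounds[OF \<theta>(2)] by (intro mult_le_one) auto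
        show "kernel t (cos \<theta>) (cos \<phi>) \<le> \<bar>kernel_bound 2\<bar>"
          using abs_kernel_le[of 2 t "cos \<theta>" "cos \<phi>"] False by (auto simp: abs_le_iff)
        show "0 \<le> kernel t (cos \<theta>) (cos \<phi>)" using t by (intro kernel_nonneg) auto
      qed simp
      also have "\<dots> = C2 * (c * 1 * exp (- (pi\<^sup>2)))" unfolding C2_def using c(1) by (simp add: exp_minus)
      also have "\<dots> \<le> C2 * (c * max 1 (1 / sqrt (5 * t)) * exp (- (\<theta> - \<phi>)\<^sup>2 / (10 * t)))"
      proof (intro mult_left_mono mult_mono)
        have "\<bar>\<theta> - \<phi>\<bar> \<le> pi" using \<theta> by auto
        then have "(\<theta> - \<phi>)\<^sup>2 \<le> pi\<^sup>2" by (metis abs_ge_zero power2_abs power_mono)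
        also have "\<dots> \<le> pi\<^sup>2 * (10 * t)" using False by simp
        finally have "(\<theta> - \<phi>)\<^sup>2 / (10 * t) \<le> pi\<^sup>2" using t by (simp add: field_simps)
        then show "exp (- (pi\<^sup>2)) \<le> exp (- (\<theta> - \<phi>)\<^sup>2 / (10 * t))" by simp
      qed (use c(1) C2 in auto)
      also have "\<dots> \<le> C2 * ?W" using W C2 by (intro mult_left_mono) auto
      also have "\<dots> \<le> (C1 + C2) * ?W" using C1 W0 by (intro mult_right_mono) auto
      finally show ?thesis .
    qed
  qed
qed

end

section \<open>Weak type (1,1)\<close>

text \<open>Only an almost everywhere argument works: both exponents are 0, but 0 powr 0 = 0 makes
  the density vanish at the endpoints.\<close>

lemma mu1_neumann: "mu1 (- 1 / 2) (- 1 / 2) = restrict_space lborel {0..pi}"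
proof -
  have "AE \<theta> in restrict_space lborel {0..pi}. ennreal (jacobi_weight (- 1 / 2) (- 1 / 2) \<theta>) = 1"
  proof (subst AE_restrict_space_iff)
    have "AE \<theta> in lborel. \<theta> \<noteq> (0 :: real)" "AE \<theta> in lborel. \<theta> \<noteq> pi" by (rule AE_lborel_singleton)+
    then show "AE \<theta> in lborel. \<theta> \<in> {0..pi} \<longrightarrow> ennreal (jacobi_weight (- 1 / 2) (- 1 / 2) \<theta>) = 1"
    proof eventually_elim
      case (elim \<theta>)
      show ?case
      proof
        assume "\<theta> \<in> {0..pi}"
        then have "sin (\<theta> / 2) > 0" "cos (\<theta> / 2) > 0" using elim by (auto intro!: sin_gt_zero cos_gt_zero)
        then show "ennreal (jacobi_weight (- 1 / 2) (- 1 / 2) \<theta>) = 1" by (simp add: jacobi_weight_def)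
      qed
    qed
  qed auto
  then have "mu1 (- 1 / 2) (- 1 / 2) = density (restrict_space lborel {0..pi}) (\<lambda>_. 1)"
    unfolding mu1_eq by (intro density_cong) (auto simp: measurable_restrict_space1)
  then show ?thesis by (simp add: density_1)
qed

context jacobi
begin

section \<open>Bounds, continuity and measurability of the one-dimensional kernels\<close>

lemma G1_abs_le:
  assumes "t \<ge> t0" "t0 > 0" "x \<in> {-1..1}" "y \<in> {-1..1}"
  shows "\<bar>G1 a b t x y\<bar> \<le> kernel_bound t0 / 2 powr (a + b + 1)"
  using abs_kernel_le[OF assms] assms by (simp add: G1_eq divide_right_mono)

lemma continuous_on_G1_time:
  assumes "x \<in> {-1..1}" "y \<in> {-1..1}"
  shows "continuous_on {0<..} (\<lambda>t. G1 a b t x y)"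
proof -
  have "continuous_on {0<..} (\<lambda>t. kernel t x y / 2 powr (a + b + 1))"
    by (intro continuous_intros continuous_on_kernel_time assms) auto
  moreover have "continuous_on {0<..} (\<lambda>t. G1 a b t x y)
      \<longleftrightarrow> continuous_on {0<..} (\<lambda>t. kernel t x y / 2 powr (a + b + 1))"
    using assms by (intro continuous_on_cong refl G1_eq) auto
  ultimately show ?thesis by simp
qed

lemma exp_shift_le_1: "t > 0 \<Longrightarrow> exp (- t * ((a + b + 1) / 2)\<^sup>2) \<le> 1"
  by simp

text \<open>The factor exp (- t ((a + b + 1) / 2)^2) may destroy monotonicity in t, so this kernel
  enters the maximal theorem through domination and not as a heat family.\<close>

lemma G1_trig_abs_le:
  assumes "t > 0" shows "\<bar>G1_trig a b t \<theta> \<phi>\<bar> \<le> kernel t (cos \<theta>) (cos \<phi>)"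
proof -
  have "kernel t (cos \<theta>) (cos \<phi>) \<ge> 0" using assms by (intro kernel_nonneg) auto
  then show ?thesis
    unfolding G1_trig_eq[OF assms] abs_mult using mult_right_mono[OF exp_shift_le_1[OF assms]] by simp
qed

lemma G1_phi_abs_le:
  assumes "t > 0" "\<theta> \<in> {0..pi}" "\<phi> \<in> {0..pi}"
  shows "\<bar>G1_phi a b t \<theta> \<phi>\<bar> \<le> root_weight \<theta> * root_weight \<phi> * kernel t (cos \<theta>) (cos \<phi>)"
proof -
  have "kernel t (cos \<theta>) (cos \<phi>) \<ge> 0" using assms by (intro kernel_nonneg) auto
  then have "root_weight \<theta> * root_weight \<phi> * kernel t (cos \<theta>) (cos \<phi>) \<ge> 0"
    using root_weight_bounds assms by simp
  then show ?thesis
    unfolding G1_phi_eq[OF assms(1)] abs_mult[of "exp _"]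
        using mult_right_mono[OF exp_shift_le_1[OF assms(1)]] by simp
qed

lemma continuous_on_kernel_cos_time: "continuous_on {0<..} (\<lambda>t. kernel t (cos \<theta>) (cos \<phi>))"
  by (rule continuous_on_kernel_time) auto

lemma continuous_on_G1_trig_time: "continuous_on {0<..} (\<lambda>t. G1_trig a b t \<theta> \<phi>)"
proof -
  have "continuous_on {0<..} (\<lambda>t. exp (- t * ((a + b + 1) / 2)\<^sup>2) * kernel t (cos \<theta>) (cos \<phi>))"
    by (intro continuous_intros continuous_on_kernel_cos_time)
  moreover have "continuous_on {0<..} (\<lambda>t. G1_trig a b t \<theta> \<phi>) \<longleftrightarrow> continuous_on {0<..} (\<lambda>t. exp (- t * ((a
      + b + 1) / 2)\<^sup>2) * kernel t (cos \<theta>) (cos \<phi>))"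
    by (intro continuous_on_cong refl G1_trig_eq) auto
  ultimately show ?thesis by simp
qed

lemma continuous_on_G1_phi_time: "continuous_on {0<..} (\<lambda>t. G1_phi a b t \<theta> \<phi>)"
proof -
  have "continuous_on {0<..} (\<lambda>t. exp (- t * ((a + b
      + 1) / 2)\<^sup>2) * (root_weight \<theta> * root_weight \<phi> * kernel t (cos \<theta>) (cos \<phi>)))"
    by (intro continuous_intros continuous_on_kernel_cos_time)
  moreover have "continuous_on {0<..} (\<lambda>t. G1_phi a b t \<theta> \<phi>) \<longleftrightarrow> continuous_on {0<..} (\<lambda>t. exp (- t * ((a
      + b + 1) / 2)\<^sup>2) * (root_weight \<theta> * root_weight \<phi> * kernel t (cos \<theta>) (cos \<phi>)))"
    by (intro continuous_on_cong refl G1_phi_eq) auto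
  ultimately show ?thesis by simp
qed

end

lemma G1_measurable: "(\<lambda>z. G1_trig a b t (fst z) (snd z)) \<in> borel_measurable (borel \<Otimes>\<^sub>M borel)"
  "(\<lambda>z. G1_phi a b t (fst z) (snd z)) \<in> borel_measurable (borel \<Otimes>\<^sub>M borel)"
proof -
  have [measurable]: "poly p \<in> borel_measurable borel" for p :: "real poly"
    by (intro borel_measurable_continuous_onI continuous_intros)
  show "(\<lambda>z. G1_trig a b t (fst z) (snd z)) \<in> borel_measurable (borel \<Otimes>\<^sub>M borel)"
    unfolding G1_trig_def jacobi_trig_def by measurable
  show "(\<lambda>z. G1_phi a b t (fst z) (snd z)) \<in> borel_measurable (borel \<Otimes>\<^sub>M borel)"
    unfolding G1_phi_def jacobi_phi_def jacobi_trig_def by measurable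
qed

lemma measurable_pair_mu1:
  fixes f :: "real \<times> real \<Rightarrow> real"
  assumes "f \<in> borel_measurable (borel \<Otimes>\<^sub>M borel)"
  shows "f \<in> borel_measurable (mu1 a b \<Otimes>\<^sub>M mu1 a' b')"
proof -
  have id: "(\<lambda>x. x) \<in> mu1 a b \<rightarrow>\<^sub>M borel" for a b by (rule borel_measurable_mu1) simp
  have [measurable]: "fst \<in> (mu1 a b \<Otimes>\<^sub>M mu1 a' b') \<rightarrow>\<^sub>M borel" "snd \<in> (mu1 a b \<Otimes>\<^sub>M mu1 a' b') \<rightarrow>\<^sub>M borel"
    using measurable_compose[OF measurable_fst id] measurable_compose[OF measurable_snd id] by auto
  have "(\<lambda>z. (fst z, snd z)) \<in> (mu1 a b \<Otimes>\<^sub>M mu1 a' b') \<rightarrow>\<^sub>M (borel \<Otimes>\<^sub>M borel)" by measurable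
  then show ?thesis using measurable_compose[OF _ assms] by simp
qed

theorem theorem5p1:
  fixes d :: nat and \<alpha> \<beta> :: "nat \<Rightarrow> real"
  assumes "d \<ge> 1"
    and "\<And>i. i < d \<Longrightarrow> \<alpha> i \<ge> - 1 / 2"
    and "\<And>i. i < d \<Longrightarrow> \<beta> i \<ge> - 1 / 2"
  shows "weak_type_1_1 (rho d \<alpha> \<beta>) (maximal (T d \<alpha> \<beta>)) \<and>
         weak_type_1_1 (mu d \<alpha> \<beta>) (maximal (T_trig d \<alpha> \<beta>)) \<and>
         weak_type_1_1 (lebesgue_cube d) (maximal (T_phi d \<alpha> \<beta>))"
proof (intro conjI)
  have jac: "jacobi (\<alpha> i) (\<beta> i)" if "i \<in> {..<d}" for i
    using assms(2,3) that by unfold_locales auto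
  show "weak_type_1_1 (rho d \<alpha> \<beta>) (maximal (T d \<alpha> \<beta>))"
    unfolding rho_def T_def[abs_def] G_def
  \<comment> \<open>\<open>G1\<close> has no spectral shift and is itself a heat family, so it
    dominates itself.\<close>
  proof (rule weak_type_PiM[where C="\<lambda>_. 1" and c=1])
    fix i assume i: "i \<in> {..<d}"
    interpret jacobi "\<alpha> i" "\<beta> i" by (rule jac[OF i])
    show hf: "heat_family (rho1 (\<alpha> i) (\<beta> i)) (G1 (\<alpha> i) (\<beta> i)) (dim / 2)" by (rule heat_family_rho1)
    show "(\<lambda>z. G1 (\<alpha> i) (\<beta> i) t (fst z) (snd z)) \<in> borel_measurable (rho1 (\<alpha> i) (\<beta> i) \<Otimes>\<^sub>M rho1 (\<alpha> i) (\<beta>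
        i))" if "t > 0" for t
      by (rule heat_family.kernel_measurable[OF hf that])
    show "\<exists>B. \<forall>t\<ge>t0. \<forall>x\<in>space (rho1 (\<alpha> i) (\<beta> i)). \<forall>y\<in>space (rho1 (\<alpha> i) (\<beta> i)). \<bar>G1 (\<alpha> i) (\<beta> i) t x y\<bar>
        \<le> B" if "t0 > 0" for t0
      using G1_abs_le[OF _ that]
      by (intro exI[of _ "kernel_bound t0 / 2 powr (\<alpha> i + \<beta> i
          + 1)"] allI impI ballI) (simp only: space_rho1)
    show "continuous_on {0<..} (\<lambda>t. G1 (\<alpha> i) (\<beta> i) t x y)"
      if "x \<in> space (rho1 (\<alpha> i) (\<beta> i))" "y \<in> space (rho1 (\<alpha> i) (\<beta> i))" for x y
      using that by (intro continuous_on_G1_time) auto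
    show "\<bar>G1 (\<alpha> i) (\<beta> i) t x y\<bar> \<le> 1 * G1 (\<alpha> i) (\<beta> i) (1 * t) x y"
      if "t > 0" "x \<in> space (rho1 (\<alpha> i) (\<beta> i))" "y \<in> space (rho1 (\<alpha> i) (\<beta> i))" for t x y
      using heat_family.kernel_nonneg[OF hf that] by simp
  qed auto
  show "weak_type_1_1 (mu d \<alpha> \<beta>) (maximal (T_trig d \<alpha> \<beta>))"
    unfolding mu_def T_trig_def[abs_def] G_trig_def
  proof (rule weak_type_PiM[where C="\<lambda>_. 1" and c=1])
    fix i assume i: "i \<in> {..<d}"
    interpret jacobi "\<alpha> i" "\<beta> i" by (rule jac[OF i])
    show "heat_family \<mu> (\<lambda>t \<theta> \<phi>. jacobi.kernel (\<alpha> i) (\<beta> i) t (cos \<theta>) (cos \<phi>)) (dim / 2)"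
        by (rule heat_family_trig)
    show "(\<lambda>z. G1_trig (\<alpha> i) (\<beta> i) t (fst z) (snd z)) \<in> borel_measurable (\<mu> \<Otimes>\<^sub>M \<mu>)" for t
      by (intro measurable_pair_mu1 G1_measurable)
    show "\<exists>B. \<forall>t\<ge>t0. \<forall>x\<in>space \<mu>. \<forall>y\<in>space \<mu>. \<bar>G1_trig (\<alpha> i) (\<beta> i) t x y\<bar> \<le> B" if "t0 > 0" for t0
    proof (intro exI allI impI ballI)
      fix t x y assume "t \<ge> t0"
      then show "\<bar>G1_trig (\<alpha> i) (\<beta> i) t x y\<bar> \<le> kernel_bound t0"
        using abs_kernel_le[OF _ that, of t "cos x" "cos y"] G1_trig_abs_le[of t x y] that by auto
    qed
    show "continuous_on {0<..} (\<lambda>t. G1_trig (\<alpha> i) (\<beta> i) t x y)" for x y by (rule continuous_on_G1_trig_time)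
    show "\<bar>G1_trig (\<alpha> i) (\<beta> i) t x y\<bar> \<le> 1 * kernel (1 * t) (cos x) (cos y)" if "t > 0" for t x y
      using G1_trig_abs_le[OF that] by simp
  qed auto
  \<comment> \<open>The constant may depend on the coordinate, but the time factor 5 does not;
    \<open>weak_type_PiM\<close> requires one rescaling of time for all factors.\<close>
  have "\<forall>i\<in>{..<d}. \<exists>C>0. \<forall>t \<theta> \<phi>. t > 0 \<longrightarrow> \<theta> \<in> {0..pi} \<longrightarrow> \<phi> \<in> {0..pi} \<longrightarrow>
      \<bar>G1_phi (\<alpha> i) (\<beta> i) t \<theta> \<phi>\<bar> \<le> C * neumann.kernel (5 * t) (cos \<theta>) (cos \<phi>)"
  proof
    fix i assume i: "i \<in> {..<d}"
    interpret jacobi "\<alpha> i" "\<beta> i" by (rule jac[OF i])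
    obtain C where "C > 0" "\<And>t \<theta> \<phi>. t > 0 \<Longrightarrow> \<theta> \<in> {0..pi} \<Longrightarrow> \<phi> \<in> {0..pi} \<Longrightarrow>
        root_weight \<theta> * root_weight \<phi> * kernel t (cos \<theta>) (cos \<phi>)
            \<le> C * neumann.kernel (5 * t) (cos \<theta>) (cos \<phi>)"
      by (rule kernel_le_neumann) (rule that)
    then show "\<exists>C>0. \<forall>t \<theta> \<phi>. t > 0 \<longrightarrow> \<theta> \<in> {0..pi} \<longrightarrow> \<phi> \<in> {0..pi} \<longrightarrow>
      \<bar>G1_phi (\<alpha> i) (\<beta> i) t \<theta> \<phi>\<bar> \<le> C * neumann.kernel (5 * t) (cos \<theta>) (cos \<phi>)"
      using order_trans[OF G1_phi_abs_le] by (intro exI[of _ C]) blast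
  qed
  then obtain C where C: "\<And>i. i \<in> {..<d} \<Longrightarrow> C i > 0"
    "\<And>i t \<theta> \<phi>. i \<in> {..<d} \<Longrightarrow> t > 0 \<Longrightarrow> \<theta> \<in> {0..pi} \<Longrightarrow> \<phi> \<in> {0..pi} \<Longrightarrow>
      \<bar>G1_phi (\<alpha> i) (\<beta> i) t \<theta> \<phi>\<bar> \<le> C i * neumann.kernel (5 * t) (cos \<theta>) (cos \<phi>)"
    by metis
  show "weak_type_1_1 (lebesgue_cube d) (maximal (T_phi d \<alpha> \<beta>))"
    unfolding lebesgue_cube_def T_phi_def[abs_def] G_phi_def mu1_neumann[symmetric]
  \<comment> \<open>With Lebesgue measure rewritten as \<open>mu1\<close> for the parameters -1/2,
    the Neumann kernels form the dominating heat family, whatever \<alpha> and \<beta> are.\<close>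
  proof (rule weak_type_PiM[where C=C and c=5])
    fix i assume i: "i \<in> {..<d}"
    interpret jacobi "\<alpha> i" "\<beta> i" by (rule jac[OF i])
    let ?M = "mu1 (- 1 / 2) (- 1 / 2)"
    show "C i > 0" by (rule C(1)[OF i])
    show "heat_family ?M (\<lambda>t \<theta> \<phi>. neumann.kernel t (cos \<theta>) (cos \<phi>)) (neumann.dim / 2)"
        by (rule neumann.heat_family_trig)
    show "(\<lambda>z. G1_phi (\<alpha> i) (\<beta> i) t (fst z) (snd z)) \<in> borel_measurable (?M \<Otimes>\<^sub>M ?M)" for t
      by (intro measurable_pair_mu1 G1_measurable)
    show "\<exists>B. \<forall>t\<ge>t0. \<forall>x\<in>space ?M. \<forall>y\<in>space ?M. \<bar>G1_phi (\<alpha> i) (\<beta> i) t x y\<bar> \<le> B" if "t0 > 0" for t0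
    proof (intro exI allI impI ballI)
      fix t x y assume t: "t \<ge> t0" and xy: "x \<in> space ?M" "y \<in> space ?M"
      have "neumann.kernel (5 * t) (cos x) (cos y) \<le> neumann.kernel_bound (5 * t0)"
        using neumann.abs_kernel_le[of "5 * t0" "5 * t" "cos x" "cos y"] t that by (auto simp: abs_le_iff)
      then have "C i * neumann.kernel (5 * t) (cos x) (cos y) \<le> C i * neumann.kernel_bound (5 * t0)"
        using C(1)[OF i] by (intro mult_left_mono) auto
      then show "\<bar>G1_phi (\<alpha> i) (\<beta> i) t x y\<bar> \<le> C i * neumann.kernel_bound (5 * t0)"
        using C(2)[OF i, of t x y] t that xy by auto
    qed
    show "continuous_on {0<..} (\<lambda>t. G1_phi (\<alpha> i) (\<beta> i) t x y)" for x y by (rule continuous_on_G1_phi_time)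
    show "\<bar>G1_phi (\<alpha> i) (\<beta> i) t x y\<bar> \<le> C i * neumann.kernel (5 * t) (cos x) (cos y)"
      if "t > 0" "x \<in> space ?M" "y \<in> space ?M" for t x y
      using C(2)[OF i that(1)] that(2,3) by simp
  qed auto
qed

end
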